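(* Let $n\ge 1$ be an integer, let $\alpha>-1$, and let $w_\alpha(x)=(1+|x|^2)^{(\alpha+n+1)/2}$ for $x\in\mathbb{R}^n$. Let $f\in w_\alpha\mathcal{D}'_{L^1}$. Then there exists a nonnegative integer $m$, depending only on the distribution $f$, such that the Poisson integral $\mathcal{K}_\alpha[f]$ satisfies $$\sup_{(x,y)\in S_r}\big|\mathcal{K}_{\alpha,y}\ast f(x)\,\cos^{n+m}\vartheta\big|=o(r^{\alpha+1})\quad\text{as }r\to\infty,$$ where $S_r=\{(x,y)\in\mathbb{R}^n\times(0,\infty):|x|^2+y^2=r^2\}$ and $\vartheta\in[0,\pi/2)$ is the angle defined by $y=r\cos\vartheta$ and $|x|=r\sin\vartheta$ for $(x,y)\in S_r$.
   Context: All function and distribution spaces are on $\mathbb{R}^n$. The kernel is $\mathcal{K}_\alpha(x,y)=\frac{\Gamma((\alpha+n+1)/2)}{\Gamma((\alpha+1)/2)\pi^{n/2}}\cdot\frac{y^{\alpha+1}}{(|x|^2+y^2)^{(\alpha+n+1)/2}}$ for $x\in\mathbb{R}^n$, $y>0$, and $\mathcal{K}_{\alpha,y}(x)=\mathcal{K}_\alpha(x,y)$. Translation is $\tau_\eta\varphi(x)=\varphi(x-\eta)$. $\mathcal{B}$ is the space of smooth $\varphi:\mathbb{R}^n\to\mathbb{C}$ such that $\varphi$ and all its derivatives are bounded; $\dot{\mathcal{B}}$ is the closed subspace of those $\varphi\in\mathcal{B}$ with $\partial^\beta\varphi(x)\to0$ as $|x|\to\infty$ for all multi-indices $\beta$ (topology: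 uniform convergence of all derivatives). $\mathcal{D}'_{L^1}$ is the dual of $\dot{\mathcal{B}}$; it is a space of tempered distributions, consisting exactly of the finite sums $u=\sum_\beta\partial^\beta u_\beta$ with $u_\beta\in L^1$. $\mathcal{B}_c$ is $\mathcal{B}$ endowed with the finest locally convex topology that on bounded subsets of $\mathcal{B}$ induces the topology inherited from $C^\infty$; every $u\in\mathcal{D}'_{L^1}$ extends uniquely to a continuous linear form on $\mathcal{B}_c$, with pairing $\langle u,\varphi\rangle_{\mathcal{D}'_{L^1},\mathcal{B}_c}=\sum_\beta(-1)^{|\beta|}\int u_\beta\,\partial^\beta\varphi\,dx$ for $\varphi\in\mathcal{B}$. The weighted space is $w_\alpha\mathcal{D}'_{L^1}=\{u\in\mathcal{S}': w_\alpha^{-1}u\in\mathcal{D}'_{L^1}\}$. $\mathcal{S}'$-convolution: two tempered distributions $u,v$ are $\mathcal{S}'$-convolvable if $u(\check v\ast\varphi)\in\mathcal{D}'_{L^1}$ for every $\varphi\in\mathcal{S}$, where $\check\varphi(x)=\varphi(-x)$ (extended to $\mathcal{S}'$ by duality) and $\check v\ast\varphi$ is the function $\eta\mapsto\langle v,\tau_{-\eta}\varphi\rangle_{\mathcal{S}',\mathcal{S}}$. Then $u\ast v\in\mathcal{S}'$ is defined by $\langle u\ast v,\varphi\rangle=\langle u(\check v\ast\varphi),1\rangle_{\mathcal{D}'_{L^1},\mathcal{B}_c}$. For $f\in w_\alpha\mathcal{D}'_{L^1}$ the $\mathcal{S}'$-convolution $\mathcal{K}_{\alpha,y}\ast f$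 exists for every $y>0$ and is the function $x\mapsto\langle w_\alpha^{-1}f,w_\alpha\tau_x\mathcal{K}_{\alpha,y}\rangle_{\mathcal{D}'_{L^1},\mathcal{B}_c}$. The Poisson integral of $f$ is the function $\mathcal{K}_\alpha[f](x,y)=\mathcal{K}_{\alpha,y}\ast f(x)$, $x\in\mathbb{R}^n$, $y>0$. *)

theory Defs
  imports "HOL-Analysis.Analysis" "HOL-Library.Landau_Symbols"
begin

section \<open>Smooth functions and iterated partial derivatives\<close>

definition partial :: "'n::finite \<Rightarrow> (real^'n \<Rightarrow> complex) \<Rightarrow> real^'n \<Rightarrow> complex" where
  "partial i \<phi> x = frechet_derivative \<phi> (at x) (axis i 1)"

text \<open>
  Derivatives are indexed by lists of directions: \<open>[i\<^sub>1, \<dots>, i\<^sub>k]\<close> stands for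
  \<open>\<partial>\<^sub>i\<^sub>1 \<dots> \<partial>\<^sub>i\<^sub>k\<close>. For smooth functions the order is irrelevant, so the list
  \<open>is\<close> represents \<open>\<partial>\<^sup>\<beta>\<close> with \<open>\<beta> i\<close> the number of occurrences of \<open>i\<close> in \<open>is\<close>.
\<close>

primrec partials :: "'n::finite list \<Rightarrow> (real^'n \<Rightarrow> complex) \<Rightarrow> real^'n \<Rightarrow> complex" where
  "partials [] \<phi> = \<phi>"
| "partials (i # is) \<phi> = partial i (partials is \<phi>)"

definition smooth_space :: "(real^'n::finite \<Rightarrow> complex) set" where
  "smooth_space = {\<phi>. \<forall>is x. partials is \<phi> differentiable (at x)}"

definition B_space :: "(real^'n::finite \<Rightarrow> complex) set" where
  "B_space = {\<phi> \<in> smooth_space. \<forall>is. bounded (range (partials is \<phi>))}"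

definition B_dot_space :: "(real^'n::finite \<Rightarrow> complex) set" where
  "B_dot_space = {\<phi> \<in> B_space. \<forall>is. (partials is \<phi> \<longlongrightarrow> 0) at_infinity}"

definition Schwartz_space :: "(real^'n::finite \<Rightarrow> complex) set" where
  "Schwartz_space = {\<phi> \<in> smooth_space. \<forall>k is.
     bounded (range (\<lambda>x. of_real ((1 + norm x) ^ k) * partials is \<phi> x))}"

section \<open>Topologies given by seminorms\<close>

definition seminorm_on :: "('a \<Rightarrow> complex) set \<Rightarrow> (('a \<Rightarrow> complex) \<Rightarrow> real) \<Rightarrow> bool" where
  "seminorm_on V p \<longleftrightarrow>
     (\<forall>\<phi>\<in>V. 0 \<le> p \<phi>) \<and>
     (\<forall>\<phi>\<in>V. \<forall>\<psi>\<in>V. p (\<lambda>x. \<phi> x + \<psi> x) \<le> p \<phi> + p \<psi>) \<and>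
     (\<forall>c. \<forall>\<phi>\<in>V. p (\<lambda>x. c * \<phi> x) = norm c * p \<phi>)"

text \<open>
  The locally convex topology on the vector space \<open>V\<close> defined by a family \<open>P\<close> of seminorms;
  every locally convex topology on \<open>V\<close> is of this form.
\<close>

definition seminorm_topology ::
    "('a \<Rightarrow> complex) set \<Rightarrow> (('a \<Rightarrow> complex) \<Rightarrow> real) set \<Rightarrow> ('a \<Rightarrow> complex) topology" where
  "seminorm_topology V P = topology_generated_by
     (insert V {{\<psi> \<in> V. p (\<lambda>x. \<psi> x - \<phi> x) < \<epsilon>} | p \<phi> \<epsilon>. p \<in> P \<and> \<phi> \<in> V \<and> 0 < \<epsilon>})"

definition sup_seminorm :: "'n::finite list \<Rightarrow> (real^'n \<Rightarrow> complex) \<Rightarrow> real" where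
  "sup_seminorm is \<phi> = (SUP x. norm (partials is \<phi> x))"

definition local_seminorm :: "nat \<Rightarrow> 'n::finite list \<Rightarrow> (real^'n \<Rightarrow> complex) \<Rightarrow> real" where
  "local_seminorm k is \<phi> = (SUP x\<in>cball 0 (real k). norm (partials is \<phi> x))"

definition Schwartz_seminorm :: "nat \<Rightarrow> 'n::finite list \<Rightarrow> (real^'n \<Rightarrow> complex) \<Rightarrow> real" where
  "Schwartz_seminorm k is \<phi> = (SUP x. (1 + norm x) ^ k * norm (partials is \<phi> x))"

definition smooth_topology :: "(real^'n::finite \<Rightarrow> complex) topology" where
  "smooth_topology = seminorm_topology smooth_space {local_seminorm k is | k is. True}"

definition B_dot_topology :: "(real^'n::finite \<Rightarrow> complex) topology" where
  "B_dot_topology = seminorm_topology B_dot_space (range sup_seminorm)"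

definition Schwartz_topology :: "(real^'n::finite \<Rightarrow> complex) topology" where
  "Schwartz_topology = seminorm_topology Schwartz_space {Schwartz_seminorm k is | k is. True}"

definition B_bounded :: "(real^'n::finite \<Rightarrow> complex) set \<Rightarrow> bool" where
  "B_bounded A \<longleftrightarrow> A \<subseteq> B_space \<and> (\<forall>is. \<exists>C. \<forall>\<phi>\<in>A. sup_seminorm is \<phi> \<le> C)"

text \<open>
  The locally convex topologies on \<open>B_space\<close> that coincide with the topology of \<open>C\<^sup>\<infinity>\<close> on bounded
  sets, and the finest of them: the supremum of all of them is again one of them
  (lemmas \<open>Bc_topology_admissible\<close> and \<open>Bc_topology_finest\<close> below).
\<close>

definition Bc_admissible :: "((real^'n::finite \<Rightarrow> complex) \<Rightarrow> real) set \<Rightarrow> bool" where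
  "Bc_admissible P \<longleftrightarrow> (\<forall>p\<in>P. seminorm_on B_space p) \<and>
     (\<forall>A. B_bounded A \<longrightarrow>
        subtopology (seminorm_topology B_space P) A = subtopology smooth_topology A)"

definition Bc_seminorms :: "((real^'n::finite \<Rightarrow> complex) \<Rightarrow> real) set" where
  "Bc_seminorms = \<Union>{P. Bc_admissible P}"

definition Bc_topology :: "(real^'n::finite \<Rightarrow> complex) topology" where
  "Bc_topology = seminorm_topology B_space Bc_seminorms"

section \<open>Distributions\<close>

type_synonym 'n form = "(real^'n \<Rightarrow> complex) \<Rightarrow> complex"

definition linear_form_on :: "(real^'n::finite \<Rightarrow> complex) set \<Rightarrow> 'n form \<Rightarrow> bool" where
  "linear_form_on V u \<longleftrightarrow>
     (\<forall>\<phi>\<in>V. \<forall>\<psi>\<in>V. u (\<lambda>x. \<phi> x + \<psi> x) = u \<phi> + u \<psi>) \<and>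
     (\<forall>c. \<forall>\<phi>\<in>V. u (\<lambda>x. c * \<phi> x) = c * u \<phi>)"

text \<open>
  A tempered distribution is represented by any \<open>u\<close> that is a continuous linear form on
  \<open>Schwartz_space\<close>; the values of \<open>u\<close> outside \<open>Schwartz_space\<close> are irrelevant everywhere below.
\<close>

definition tempered_distributions :: "'n::finite form set" where
  "tempered_distributions =
     {u. linear_form_on Schwartz_space u \<and> continuous_map Schwartz_topology euclidean u}"

definition fun_dist :: "(real^'n::finite \<Rightarrow> complex) \<Rightarrow> 'n form" where
  "fun_dist g = (\<lambda>\<phi>. \<integral>x. g x * \<phi> x \<partial>lborel)"

definition mult_dist :: "(real^'n::finite \<Rightarrow> complex) \<Rightarrow> 'n form \<Rightarrow> 'n form" where
  "mult_dist g u = (\<lambda>\<phi>. u (\<lambda>x. g x * \<phi> x))"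

definition B_dot_dual :: "'n::finite form set" where
  "B_dot_dual = {l. linear_form_on B_dot_space l \<and> continuous_map B_dot_topology euclidean l}"

text \<open>
  The dual of \<open>B_dot_space\<close> as a space of tempered distributions: an element of the dual is
  identified with its restriction to the dense subspace \<open>Schwartz_space\<close>.
\<close>

definition DL1 :: "'n::finite form set" where
  "DL1 = {u. \<exists>l\<in>B_dot_dual. \<forall>\<phi>\<in>Schwartz_space. u \<phi> = l \<phi>}"

text \<open>
  The value at \<open>\<phi>\<close> of the unique continuous linear form on \<open>B_space\<close> with the topology
  \<open>Bc_topology\<close> that extends \<open>u\<close>.
\<close>

definition DL1_pairing :: "'n::finite form \<Rightarrow> (real^'n \<Rightarrow> complex) \<Rightarrow> complex" where
  "DL1_pairing u \<phi> = (THE c. \<exists>L. linear_form_on B_space L \<and> continuous_map Bc_topology euclidean L \<and>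
      (\<forall>\<psi>\<in>Schwartz_space. L \<psi> = u \<psi>) \<and> L \<phi> = c)"

section \<open>Convolution of tempered distributions\<close>

definition translate :: "real^'n::finite \<Rightarrow> (real^'n \<Rightarrow> complex) \<Rightarrow> real^'n \<Rightarrow> complex" where
  "translate \<eta> \<phi> = (\<lambda>x. \<phi> (x - \<eta>))"

text \<open>The smooth function usually written as the convolution of the reflection of \<open>v\<close> with \<open>\<phi>\<close>.\<close>

definition reflected_conv :: "'n::finite form \<Rightarrow> (real^'n \<Rightarrow> complex) \<Rightarrow> real^'n \<Rightarrow> complex" where
  "reflected_conv v \<phi> = (\<lambda>\<eta>. v (translate (- \<eta>) \<phi>))"

definition S_convolvable :: "'n::finite form \<Rightarrow> 'n form \<Rightarrow> bool" where
  "S_convolvable u v \<longleftrightarrow> (\<forall>\<phi>\<in>Schwartz_space. mult_dist (reflected_conv v \<phi>) u \<in> DL1)"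

text \<open>For pairs that are not convolvable the value is the dummy \<open>0\<close>.\<close>

definition S_conv :: "'n::finite form \<Rightarrow> 'n form \<Rightarrow> 'n form" where
  "S_conv u v = (\<lambda>\<phi>. if S_convolvable u v
      then DL1_pairing (mult_dist (reflected_conv v \<phi>) u) (\<lambda>_. 1) else 0)"

section \<open>Weights and the Poisson integral\<close>

definition weight :: "real \<Rightarrow> real^'n::finite \<Rightarrow> real" where
  "weight \<alpha> x = (1 + (norm x)\<^sup>2) powr ((\<alpha> + real CARD('n) + 1) / 2)"

definition weighted_DL1 :: "real \<Rightarrow> 'n::finite form set" where
  "weighted_DL1 \<alpha> = {u \<in> tempered_distributions.
     mult_dist (\<lambda>x. complex_of_real (inverse (weight \<alpha> x))) u \<in> DL1}"

definition poisson_kernel :: "real \<Rightarrow> real \<Rightarrow> real^'n::finite \<Rightarrow> real" where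
  "poisson_kernel \<alpha> y x =
     Gamma ((\<alpha> + real CARD('n) + 1) / 2) / (Gamma ((\<alpha> + 1) / 2) * pi powr (real CARD('n) / 2)) *
     (y powr (\<alpha> + 1) / ((norm x)\<^sup>2 + y\<^sup>2) powr ((\<alpha> + real CARD('n) + 1) / 2))"

definition is_function :: "'n::finite form \<Rightarrow> (real^'n \<Rightarrow> complex) \<Rightarrow> bool" where
  "is_function T g \<longleftrightarrow>
     (\<forall>\<phi>\<in>Schwartz_space. integrable lborel (\<lambda>x. g x * \<phi> x) \<and> T \<phi> = fun_dist g \<phi>)"

text \<open>
  The point values of the distribution \<open>\<K>\<^sub>\<alpha>\<^sub>,\<^sub>y \<star> f\<close> are those of the continuous function
  (there is at most one) with which it coincides.
\<close>

definition poisson_integral :: "real \<Rightarrow> 'n::finite form \<Rightarrow> real^'n \<Rightarrow> real \<Rightarrow> complex" where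
  "poisson_integral \<alpha> f x y =
     (THE g. continuous_on UNIV g \<and>
        is_function (S_conv (fun_dist (\<lambda>x. complex_of_real (poisson_kernel \<alpha> y x))) f) g) x"

definition half_sphere :: "real \<Rightarrow> ((real^'n::finite) \<times> real) set" where
  "half_sphere r = {(x, y). 0 < y \<and> (norm x)\<^sup>2 + y\<^sup>2 = r\<^sup>2}"

definition polar_angle :: "real^'n::finite \<Rightarrow> real \<Rightarrow> real" where
  "polar_angle x y = (THE \<theta>. 0 \<le> \<theta> \<and> \<theta> < pi / 2 \<and>
     y = sqrt ((norm x)\<^sup>2 + y\<^sup>2) * cos \<theta> \<and> norm x = sqrt ((norm x)\<^sup>2 + y\<^sup>2) * sin \<theta>)"

section \<open>The topology of the space of bounded smooth functions\<close>

lemma seminorm_on_add: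
  "seminorm_on V p \<Longrightarrow> f \<in> V \<Longrightarrow> g \<in> V \<Longrightarrow> p (\<lambda>x. f x + g x) \<le> p f + p g"
  by (simp add: seminorm_on_def)

lemma seminorm_on_cmult:
  "seminorm_on V p \<Longrightarrow> f \<in> V \<Longrightarrow> p (\<lambda>x. c * f x) = norm c * p f"
  by (simp add: seminorm_on_def)

lemma smooth_spaceD: "\<phi> \<in> smooth_space \<Longrightarrow> partials is \<phi> differentiable (at x)"
  by (simp add: smooth_space_def)

lemma partial_add:
  assumes "f differentiable (at x)" "g differentiable (at x)"
  shows "partial i (\<lambda>x. f x + g x) x = partial i f x + partial i g x"
proof -
  have "((\<lambda>x. f x + g x) has_derivative (\<lambda>h. frechet_derivative f (at x) h + frechet_derivative g (at x) h)) (at x)"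
    using assms by (intro has_derivative_add) (simp_all add: frechet_derivative_works[symmetric])
  from frechet_derivative_at[OF this] show ?thesis
    by (simp add: partial_def fun_eq_iff)
qed

lemma partial_cmult:
  assumes "f differentiable (at x)"
  shows "partial i (\<lambda>x. c * f x) x = c * partial i f x"
proof -
  have "((\<lambda>x. c * f x) has_derivative (\<lambda>h. c * frechet_derivative f (at x) h)) (at x)"
    using assms by (intro has_derivative_mult_right) (simp_all add: frechet_derivative_works[symmetric])
  from frechet_derivative_at[OF this] show ?thesis
    by (simp add: partial_def fun_eq_iff)
qed

lemma partials_add:
  assumes "f \<in> smooth_space" "g \<in> smooth_space"
  shows "partials is (\<lambda>x. f x + g x) = (\<lambda>x. partials is f x + partials is g x)"
  proof (induction "is")
  case (Cons i "is")
  then show ?case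
    by (intro ext) (simp add: partial_add smooth_spaceD assms)
qed simp

lemma partials_cmult:
  assumes "f \<in> smooth_space"
  shows "partials is (\<lambda>x. c * f x) = (\<lambda>x. c * partials is f x)"
  proof (induction "is")
  case (Cons i "is")
  then show ?case
    by (intro ext) (simp add: partial_cmult smooth_spaceD assms)
qed simp

lemma smooth_space_add:
  "f \<in> smooth_space \<Longrightarrow> g \<in> smooth_space \<Longrightarrow> (\<lambda>x. f x + g x) \<in> smooth_space"
  by (subst smooth_space_def) (auto simp: partials_add intro!: differentiable_add smooth_spaceD)

lemma smooth_space_cmult:
  "f \<in> smooth_space \<Longrightarrow> (\<lambda>x. c * f x) \<in> smooth_space"
  by (subst smooth_space_def) (auto simp: partials_cmult intro!: differentiable_mult smooth_spaceD)

lemma smooth_space_diff: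
  "f \<in> smooth_space \<Longrightarrow> g \<in> smooth_space \<Longrightarrow> (\<lambda>x. f x - g x) \<in> smooth_space"
  using smooth_space_add[OF _ smooth_space_cmult[of g "-1"], of f] by simp

lemma bdd_above_local:
  assumes "\<phi> \<in> smooth_space"
  shows "bdd_above ((\<lambda>x. norm (partials is \<phi> x)) ` cball 0 (real k))"
proof -
  have "continuous_on (cball 0 (real k)) (\<lambda>x. norm (partials is \<phi> x))"
    by (intro continuous_on_norm continuous_at_imp_continuous_on ballI
        differentiable_imp_continuous_within smooth_spaceD assms)
  then show ?thesis
    by (intro bounded_imp_bdd_above compact_imp_bounded compact_continuous_image) auto
qed

lemma seminorm_on_local:
  "seminorm_on smooth_space (local_seminorm k (is :: 'n::finite list))"
  unfolding seminorm_on_def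
proof (intro conjI ballI allI)
  fix \<phi> :: "real^'n \<Rightarrow> complex" assume \<phi>: "\<phi> \<in> smooth_space"
  have "norm (partials is \<phi> 0) \<le> local_seminorm k is \<phi>"
    unfolding local_seminorm_def by (intro cSUP_upper bdd_above_local \<phi>) auto
  then show "0 \<le> local_seminorm k is \<phi>" by (rule order_trans[OF norm_ge_zero])
  fix c
  show "local_seminorm k is (\<lambda>x. c * \<phi> x) = norm c * local_seminorm k is \<phi>"
  proof (rule antisym)
    show "local_seminorm k is (\<lambda>x. c * \<phi> x) \<le> norm c * local_seminorm k is \<phi>"
      unfolding local_seminorm_def partials_cmult[OF \<phi>] norm_mult
    proof (rule cSUP_least)
      fix x :: "real^'n" assume x: "x \<in> cball 0 (real k)"
      show "norm c * norm (partials is \<phi> x) \<le> norm c * (SUP x\<in>cball 0 (real k). norm (partials is \<phi> x))"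
        by (rule mult_left_mono[OF cSUP_upper[OF x bdd_above_local[OF \<phi>]] norm_ge_zero])
    qed simp
    show "norm c * local_seminorm k is \<phi> \<le> local_seminorm k is (\<lambda>x. c * \<phi> x)"
    proof (cases "c = 0")
      case True
      have "norm (partials is (\<lambda>x. c * \<phi> x) 0) \<le> local_seminorm k is (\<lambda>x. c * \<phi> x)"
        unfolding local_seminorm_def
        by (intro cSUP_upper bdd_above_local smooth_space_cmult \<phi>) auto
      then have "0 \<le> local_seminorm k is (\<lambda>x. c * \<phi> x)" by (rule order_trans[OF norm_ge_zero])
      then show ?thesis using True by simp
    next
      case False
      have "local_seminorm k is \<phi> \<le> local_seminorm k is (\<lambda>x. c * \<phi> x) / norm c"
        unfolding local_seminorm_def
      proof (intro cSUP_least)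
        fix x :: "real^'n" assume x: "x \<in> cball 0 (real k)"
        have "norm c * norm (partials is \<phi> x) = norm (partials is (\<lambda>x. c * \<phi> x) x)"
          using \<phi> by (simp add: partials_cmult norm_mult)
        also have "\<dots> \<le> (SUP x\<in>cball 0 (real k). norm (partials is (\<lambda>x. c * \<phi> x) x))"
          by (intro cSUP_upper bdd_above_local smooth_space_cmult \<phi> x)
        finally show "norm (partials is \<phi> x)
            \<le> (SUP x\<in>cball 0 (real k). norm (partials is (\<lambda>x. c * \<phi> x) x)) / norm c"
          using False by (simp add: field_simps)
      qed auto
      then show ?thesis using False by (simp add: field_simps)
    qed
  qed
next
  fix \<phi> \<psi> :: "real^'n \<Rightarrow> complex"
  assume *: "\<phi> \<in> smooth_space" "\<psi> \<in> smooth_space"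
  show "local_seminorm k is (\<lambda>x. \<phi> x + \<psi> x) \<le> local_seminorm k is \<phi> + local_seminorm k is \<psi>"
    unfolding local_seminorm_def partials_add[OF *]
  proof (intro cSUP_least)
    fix x :: "real^'n" assume x: "x \<in> cball 0 (real k)"
    have "norm (partials is \<phi> x) \<le> (SUP x\<in>cball 0 (real k). norm (partials is \<phi> x))"
      "norm (partials is \<psi> x) \<le> (SUP x\<in>cball 0 (real k). norm (partials is \<psi> x))"
      by (intro cSUP_upper bdd_above_local * x)+
    then show "norm (partials is \<phi> x + partials is \<psi> x) \<le>
      (SUP x\<in>cball 0 (real k). norm (partials is \<phi> x)) + (SUP x\<in>cball 0 (real k). norm (partials is \<psi> x))"
      using norm_triangle_ineq[of "partials is \<phi> x" "partials is \<psi> x"] by linarith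
  qed auto
qed

lemma topspace_seminorm_topology [simp]: "topspace (seminorm_topology V P) = V"
  unfolding seminorm_topology_def by auto

lemma openin_seminorm_topology_ball:
  "p \<in> P \<Longrightarrow> \<phi> \<in> V \<Longrightarrow> 0 < \<epsilon> \<Longrightarrow> openin (seminorm_topology V P) {\<psi> \<in> V. p (\<lambda>x. \<psi> x - \<phi> x) < \<epsilon>}"
  unfolding seminorm_topology_def by (rule topology_generated_by_Basis) blast

lemma openin_seminorm_topology_subset:
  fixes T :: "('a \<Rightarrow> complex) topology"
  assumes U: "openin (seminorm_topology V P) U" and A: "A \<subseteq> topspace T" "A \<subseteq> V"
    and balls: "\<And>p \<phi> \<epsilon>. p \<in> P \<Longrightarrow> \<phi> \<in> V \<Longrightarrow> 0 < \<epsilon> \<Longrightarrow>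
      openin (subtopology T A) (A \<inter> {\<psi> \<in> V. p (\<lambda>x. \<psi> x - \<phi> x) < \<epsilon>})"
  shows "openin (subtopology T A) (A \<inter> U)"
proof -
  have "generate_topology_on
     (insert V {{\<psi> \<in> V. p (\<lambda>x. \<psi> x - \<phi> x) < \<epsilon>} | p \<phi> \<epsilon>. p \<in> P \<and> \<phi> \<in> V \<and> 0 < \<epsilon>}) U"
    using U unfolding seminorm_topology_def openin_topology_generated_by_iff .
  then show ?thesis
  proof induction
    case Empty
    then show ?case by simp
  next
    case (Int a b)
    have "A \<inter> (a \<inter> b) = (A \<inter> a) \<inter> (A \<inter> b)" by blast
    then show ?case using Int by (metis openin_Int)
  next
    case (UN K)
    have "A \<inter> \<Union>K = (\<Union>k\<in>K. A \<inter> k)" by blast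
    moreover have "openin (subtopology T A) (\<Union>k\<in>K. A \<inter> k)"
      by (rule openin_Union) (use UN in auto)
    ultimately show ?case by simp
  next
    case (Basis s)
    have "openin (subtopology T A) A"
      using A(1) openin_subtopology_refl by blast
    then show ?case using Basis A balls by (auto simp: Int_absorb2)
  qed
qed

lemma openin_seminorm_topology_ball_in:
  fixes p :: "('a \<Rightarrow> complex) \<Rightarrow> real"
  assumes p: "p \<in> P" "seminorm_on W p" and VW: "V \<subseteq> W" and \<phi>: "\<phi> \<in> W" and A: "A \<subseteq> V"
    and diff: "\<And>f g. f \<in> W \<Longrightarrow> g \<in> W \<Longrightarrow> (\<lambda>x. f x - g x) \<in> W"
  shows "openin (subtopology (seminorm_topology V P) A) {\<psi> \<in> A. p (\<lambda>x. \<psi> x - \<phi> x) < \<epsilon>}"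
proof (subst openin_subopen, intro ballI)
  fix \<psi> assume \<psi>: "\<psi> \<in> {\<psi> \<in> A. p (\<lambda>x. \<psi> x - \<phi> x) < \<epsilon>}"
  define \<delta> where "\<delta> = \<epsilon> - p (\<lambda>x. \<psi> x - \<phi> x)"
  have pd: "0 < \<delta>" using \<psi> by (simp add: \<delta>_def)
  let ?T = "A \<inter> {\<omega> \<in> V. p (\<lambda>x. \<omega> x - \<psi> x) < \<delta>}"
  have "openin (seminorm_topology V P) {\<omega> \<in> V. p (\<lambda>x. \<omega> x - \<psi> x) < \<delta>}"
    using \<psi> A p pd by (intro openin_seminorm_topology_ball) auto
  then have "openin (subtopology (seminorm_topology V P) A) ?T"
    by (rule openin_subtopology_Int2)
  moreover have "\<psi> \<in> ?T"
  proof -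
    have "p (\<lambda>x. 0 * (\<psi> x - \<psi> x)) = norm (0::complex) * p (\<lambda>x. \<psi> x - \<psi> x)"
      by (rule seminorm_on_cmult[OF p(2)]) (use diff[of \<psi> \<psi>] \<psi> A VW in blast)
    then show ?thesis using \<psi> A pd by auto
  qed
  moreover have "?T \<subseteq> {\<psi> \<in> A. p (\<lambda>x. \<psi> x - \<phi> x) < \<epsilon>}"
  proof
    fix \<omega> assume \<omega>: "\<omega> \<in> ?T"
    have "p (\<lambda>x. (\<omega> x - \<psi> x) + (\<psi> x - \<phi> x)) \<le> p (\<lambda>x. \<omega> x - \<psi> x) + p (\<lambda>x. \<psi> x - \<phi> x)"
      by (rule seminorm_on_add[OF p(2)])
        (use diff[of \<omega> \<psi>] diff[of \<psi> \<phi>] \<psi> \<omega> \<phi> A VW in blast)+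
    then show "\<omega> \<in> {\<psi> \<in> A. p (\<lambda>x. \<psi> x - \<phi> x) < \<epsilon>}" using \<omega> by (auto simp: \<delta>_def)
  qed
  ultimately show "\<exists>T. openin (subtopology (seminorm_topology V P) A) T \<and> \<psi> \<in> T \<and>
      T \<subseteq> {\<psi> \<in> A. p (\<lambda>x. \<psi> x - \<phi> x) < \<epsilon>}" by blast
qed

lemma B_space_subset: "B_space \<subseteq> smooth_space"
  by (auto simp: B_space_def)

lemma subtopology_eqI:
  assumes "\<And>U. openin T U \<Longrightarrow> openin (subtopology S A) (A \<inter> U)"
    and "\<And>U. openin S U \<Longrightarrow> openin (subtopology T A) (A \<inter> U)"
  shows "subtopology T A = subtopology S A"
  unfolding topology_eq
proof (intro allI iffI)
  fix U
  show "openin (subtopology S A) U" if U: "openin (subtopology T A) U"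
  proof -
    from U obtain W where "openin T W" "U = W \<inter> A" unfolding openin_subtopology by blast
    then show ?thesis using assms(1)[of W] by (simp add: Int_commute)
  qed
  show "openin (subtopology T A) U" if U: "openin (subtopology S A) U"
  proof -
    from U obtain W where "openin S W" "U = W \<inter> A" unfolding openin_subtopology by blast
    then show ?thesis using assms(2)[of W] by (simp add: Int_commute)
  qed
qed

lemma Bc_admissible_local: "Bc_admissible {local_seminorm k is | k (is :: 'n::finite list). True}"
  unfolding Bc_admissible_def
proof (intro conjI ballI allI impI)
  fix p assume "p \<in> {local_seminorm k is | k (is :: 'n list). True}"
  then obtain k "is" where p: "p = local_seminorm k is" by blast
  show "seminorm_on B_space p"
    using seminorm_on_local[of k "is"] B_space_subset unfolding seminorm_on_def p by blast
next
  fix A :: "(real^'n \<Rightarrow> complex) set" assume "B_bounded A"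
  then have A: "A \<subseteq> B_space" by (simp add: B_bounded_def)
  then have A': "A \<subseteq> smooth_space" using B_space_subset by blast
  let ?P = "{local_seminorm k is | k (is :: 'n list). True}"
  have key: "openin (subtopology (seminorm_topology V' ?P) A) (A \<inter> U)"
    if U: "openin (seminorm_topology V ?P) U" and "A \<subseteq> V'" "V' \<subseteq> smooth_space" "A \<subseteq> V" "V \<subseteq> smooth_space"
    for U V V'
  proof (rule openin_seminorm_topology_subset[OF U])
    show "A \<subseteq> topspace (seminorm_topology V' ?P)" "A \<subseteq> V" using that by auto
    fix p and \<phi> :: "real^'n \<Rightarrow> complex" and \<epsilon> :: real assume p: "p \<in> ?P" and "\<phi> \<in> V" "0 < \<epsilon>"
    from p have "seminorm_on smooth_space p" using seminorm_on_local by blast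
    then have "openin (subtopology (seminorm_topology V' ?P) A) {\<psi> \<in> A. p (\<lambda>x. \<psi> x - \<phi> x) < \<epsilon>}"
      using p that \<open>\<phi> \<in> V\<close>
      by (intro openin_seminorm_topology_ball_in[where W = smooth_space] smooth_space_diff) auto
    moreover have "A \<inter> {\<psi> \<in> V. p (\<lambda>x. \<psi> x - \<phi> x) < \<epsilon>} = {\<psi> \<in> A. p (\<lambda>x. \<psi> x - \<phi> x) < \<epsilon>}"
      using that by auto
    ultimately show "openin (subtopology (seminorm_topology V' ?P) A) (A \<inter> {\<psi> \<in> V. p (\<lambda>x. \<psi> x - \<phi> x) < \<epsilon>})"
      by simp
  qed
  show "subtopology (seminorm_topology B_space ?P) A = subtopology smooth_topology A"
    unfolding smooth_topology_def
    by (rule subtopology_eqI; erule key) (simp_all add: A A' B_space_subset)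
qed

lemma Bc_topology_finest:
  fixes U :: "(real^'n::finite \<Rightarrow> complex) set"
  assumes "Bc_admissible P" "openin (seminorm_topology B_space P) U"
  shows "openin Bc_topology U"
proof -
  have "openin (subtopology Bc_topology B_space) (B_space \<inter> U)"
  proof (rule openin_seminorm_topology_subset[OF assms(2)])
    fix p and \<phi> :: "real^'n \<Rightarrow> complex" and \<epsilon> :: real
    assume *: "p \<in> P" "\<phi> \<in> B_space" "0 < \<epsilon>"
    then have "p \<in> Bc_seminorms" using assms(1) by (auto simp: Bc_seminorms_def)
    with * show "openin (subtopology Bc_topology B_space)
        (B_space \<inter> {\<psi> \<in> B_space. p (\<lambda>x. \<psi> x - \<phi> x) < \<epsilon>})"
      unfolding Bc_topology_def by (intro openin_subtopology_Int2 openin_seminorm_topology_ball)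
  qed (auto simp: Bc_topology_def)
  moreover have "U \<subseteq> B_space" using openin_subset[OF assms(2)] by simp
  moreover have "subtopology Bc_topology (B_space :: (real^'n \<Rightarrow> complex) set) = Bc_topology"
    unfolding Bc_topology_def by (metis subtopology_topspace topspace_seminorm_topology)
  ultimately show ?thesis by (simp add: Int_absorb1)
qed

lemma Bc_topology_admissible: "Bc_admissible Bc_seminorms"
proof -
  have "subtopology Bc_topology A = subtopology smooth_topology A" if A: "B_bounded A"
    for A :: "(real^'n \<Rightarrow> complex) set"
  proof (rule subtopology_eqI)
    have AB: "A \<subseteq> B_space" using A by (simp add: B_bounded_def)
    have AS: "A \<subseteq> smooth_space" using AB B_space_subset by blast
    fix U :: "(real^'n \<Rightarrow> complex) set"
    show "openin (subtopology smooth_topology A) (A \<inter> U)" if U: "openin Bc_topology U"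
    proof (rule openin_seminorm_topology_subset[OF U[unfolded Bc_topology_def]])
      show "A \<subseteq> topspace smooth_topology" "A \<subseteq> B_space"
        using AS AB by (simp_all add: smooth_topology_def)
      fix p :: "(real^'n \<Rightarrow> complex) \<Rightarrow> real" and \<phi> :: "real^'n \<Rightarrow> complex" and \<epsilon> :: real
      assume p: "p \<in> Bc_seminorms" "\<phi> \<in> B_space" "0 < \<epsilon>"
      then obtain P where P: "Bc_admissible P" "p \<in> P" by (auto simp: Bc_seminorms_def)
      then have "openin (subtopology (seminorm_topology B_space P) A)
          (A \<inter> {\<psi> \<in> B_space. p (\<lambda>x. \<psi> x - \<phi> x) < \<epsilon>})"
        using p by (intro openin_subtopology_Int2 openin_seminorm_topology_ball)
      then show "openin (subtopology smooth_topology A)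
          (A \<inter> {\<psi> \<in> B_space. p (\<lambda>x. \<psi> x - \<phi> x) < \<epsilon>})"
        using P(1) A by (simp add: Bc_admissible_def)
    qed
    show "openin (subtopology Bc_topology A) (A \<inter> U)" if U: "openin smooth_topology U"
    proof -
      let ?P = "{local_seminorm k is | k (is :: 'n list). True}"
      have "subtopology (seminorm_topology B_space ?P) A = subtopology smooth_topology A"
        using Bc_admissible_local A unfolding Bc_admissible_def by blast
      then have "openin (subtopology (seminorm_topology B_space ?P) A) (A \<inter> U)"
        using openin_subtopology_Int2[OF U, of A] by simp
      then obtain T where T: "openin (seminorm_topology B_space ?P) T" "A \<inter> U = T \<inter> A"
        unfolding openin_subtopology by blast
      have "openin Bc_topology T"
        by (rule Bc_topology_finest[OF Bc_admissible_local T(1)])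
      then show ?thesis unfolding openin_subtopology T(2) by blast
    qed
  qed
  moreover have "\<forall>p\<in>Bc_seminorms. seminorm_on B_space p"
    by (auto simp: Bc_seminorms_def Bc_admissible_def)
  ultimately show ?thesis
    unfolding Bc_admissible_def Bc_topology_def by blast
qed

end

theory Submission
  imports Defs
begin

text \<open>
  The distribution is \<open>f = w\<^sub>\<alpha> l\<close> with a continuous form \<open>l\<close> on
  \<open>B_dot_space\<close>, and continuity means that \<open>l\<close> is bounded by the suprema of the derivatives up to some
  order \<open>m\<close>. The Poisson integral at \<open>(x, y)\<close> is the value of the extension of \<open>l\<close> at
  \<open>w\<^sub>\<alpha> \<tau>\<^sub>x \<K>\<^sub>\<alpha>\<^sub>,\<^sub>y\<close>. On the half sphere of radius \<open>r \<ge> 1\<close> this function is at most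
  a constant times \<open>r powr (\<alpha> + 1) \<cdot> (r / y)\<^sup>n\<close>, and each of at most \<open>m\<close> derivatives costs
  another factor \<open>r / y\<close>, where \<open>y / r\<close> is \<open>cos \<theta>\<close>. So the product with \<open>cos\<^sup>n\<^sup>+\<^sup>m \<theta>\<close> is \<open>O(r powr (\<alpha> + 1))\<close>
  (\<open>jet_weighted_kernel_half_sphere\<close>).

  The step from \<open>O\<close> to \<open>o\<close> uses that \<open>l\<close> is a form on functions vanishing at infinity: it is
  concentrated on compact sets up to an error of arbitrarily small norm (\<open>form_tail\<close>). The proof is a
  gliding hump argument. If the tails were not small, there would be functions on infinitely many
  successive shells on which \<open>l\<close> is large, while the sum of these functions stays bounded. The
  concentrated part of \<open>l\<close> meets only bounded values of the weight and contributes a bounded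
  amount (\<open>jet_cutoff_weighted_kernel_half_sphere\<close>), which is negligible because \<open>\<alpha> + 1 > 0\<close>.
  The same lemma yields the extension of \<open>l\<close> to \<open>B_space\<close> as the limit of \<open>l (\<chi>\<^sub>j \<phi>)\<close> for Gaussian
  cut-off functions \<open>\<chi>\<^sub>j\<close>.

  It remains to identify the Poisson integral, which is defined by convolution, with this value
  (\<open>poisson_integral_eq\<close>). For a Schwartz function \<open>\<phi>\<close> the convolution is the integral of
  \<open>\<K>\<^sub>\<alpha>\<^sub>,\<^sub>y(x) \<cdot> l (w\<^sub>\<alpha> \<phi>(\<cdot> + x))\<close> over \<open>x\<close>. That this function is integrable, and that \<open>l\<close> may be
  interchanged with integrals over a parameter, is proved by partition sums
  (\<open>form_nn_integral_le\<close>, \<open>form_integral\<close>).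
  An integrable function is paired with \<open>1\<close> by integration (\<open>DL1_pairing_integrable\<close>), and a
  continuous function is determined by its distribution (\<open>continuous_is_function_unique\<close>).
\<close>

section \<open>Smooth functions and their jets\<close>

lemma partial_eq_derivative:
  "(f has_derivative D) (at x) \<Longrightarrow> partial i f x = D (axis i 1)"
  unfolding partial_def using frechet_derivative_at by metis

lemma partials_append: "partials (is @ js) f = partials is (partials js f)"
  by (induction "is") auto

lemma partials_in_smooth_space: "f \<in> smooth_space \<Longrightarrow> partials js f \<in> smooth_space"
  unfolding smooth_space_def by (auto simp: partials_append[symmetric])

lemma partial_in_smooth_space: "f \<in> smooth_space \<Longrightarrow> partial i f \<in> smooth_space"
  using partials_in_smooth_space[of f "[i]"] by simp

lemma smooth_space_differentiable: "f \<in> smooth_space \<Longrightarrow> f differentiable (at x)"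
  using smooth_spaceD[of f "[]" x] by simp

lemma smooth_space_continuous:
  assumes "f \<in> smooth_space"
  shows "continuous_on UNIV (partials is f)"
  by (intro continuous_at_imp_continuous_on ballI differentiable_imp_continuous_within
      smooth_spaceD assms)

text \<open>
  Coinduction: smoothness of a concrete function is shown by exhibiting a class of functions that
  contains it and is stable under all \<open>\<partial>\<^sub>i\<close>.
\<close>

lemma smooth_space_coinduct:
  assumes "f \<in> F"
    and "\<And>g x. g \<in> F \<Longrightarrow> g differentiable (at x)"
    and "\<And>g i. g \<in> F \<Longrightarrow> partial i g \<in> F"
  shows "f \<in> smooth_space"
proof -
  have "partials is f \<in> F" for "is"
    by (induction "is") (use assms in auto)
  then show ?thesis
    using assms(2) by (simp add: smooth_space_def)
qed

lemma partial_mult: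
  assumes "f differentiable (at x)" "g differentiable (at x)"
  shows "partial i (\<lambda>x. f x * g x) x = f x * partial i g x + partial i f x * g x"
proof -
  have "((\<lambda>x. f x * g x) has_derivative
     (\<lambda>h. f x * frechet_derivative g (at x) h + frechet_derivative f (at x) h * g x)) (at x)"
    using assms by (intro has_derivative_mult) (simp_all add: frechet_derivative_works[symmetric])
  from partial_eq_derivative[OF this] show ?thesis
    by (simp add: partial_def)
qed

lemma partial_const: "partial i (\<lambda>x. c) = (\<lambda>x. 0)"
proof
  fix x :: "real^'a"
  have "((\<lambda>x. c) has_derivative (\<lambda>h. 0)) (at x)" by simp
  from partial_eq_derivative[OF this] show "partial i (\<lambda>x. c) x = 0" by simp
qed

lemma partials_zero: "partials is (\<lambda>x. 0) = (\<lambda>x. 0)"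
  by (induction "is") (auto simp: partial_const)

lemma partials_const: "partials is (\<lambda>x. c) = (if is = [] then (\<lambda>x. c) else (\<lambda>x. 0))"
  by (induction "is") (auto simp: partial_const)

lemma smooth_space_const: "(\<lambda>x. c) \<in> smooth_space"
  by (simp add: smooth_space_def partials_const)

text \<open>
  Products alone are not stable under \<open>\<partial>\<^sub>i\<close>, but by the Leibniz rule their finite sums are.
\<close>

inductive_set product_sums :: "(real^'n::finite \<Rightarrow> complex) set" where
  prod: "f \<in> smooth_space \<Longrightarrow> g \<in> smooth_space \<Longrightarrow> (\<lambda>x. f x * g x) \<in> product_sums"
| add: "f \<in> product_sums \<Longrightarrow> g \<in> product_sums \<Longrightarrow> (\<lambda>x. f x + g x) \<in> product_sums"

lemma smooth_space_mult:
  fixes f g :: "real^'n::finite \<Rightarrow> complex"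
  assumes "f \<in> smooth_space" "g \<in> smooth_space"
  shows "(\<lambda>x. f x * g x) \<in> smooth_space"
proof -
  have *: "(\<forall>x. h differentiable (at x)) \<and> (\<forall>i. partial i h \<in> product_sums)"
    if "h \<in> product_sums" for h :: "real^'n \<Rightarrow> complex"
    using that
  proof induction
    case (prod f g)
    have "partial i (\<lambda>x. f x * g x) = (\<lambda>x. f x * partial i g x + partial i f x * g x)" for i
      by (intro ext partial_mult smooth_space_differentiable prod)
    moreover have "(\<lambda>x. f x * g x) differentiable (at x)" for x
      by (intro differentiable_mult smooth_space_differentiable prod)
    ultimately show ?case
      using prod by (auto intro!: product_sums.intros partial_in_smooth_space)
  next
    case (add f g)
    then have "partial i (\<lambda>x. f x + g x) = (\<lambda>x. partial i f x + partial i g x)" for i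
      by (intro ext partial_add) auto
    with add show ?case by (auto intro!: differentiable_add product_sums.add)
  qed
  show ?thesis
    by (rule smooth_space_coinduct[of _ product_sums]) (use * assms in \<open>auto intro: product_sums.prod\<close>)
qed

lemma smooth_space_sum:
  assumes "finite T" "\<And>t. t \<in> T \<Longrightarrow> f t \<in> smooth_space"
  shows "(\<lambda>x. \<Sum>t\<in>T. f t x) \<in> smooth_space"
  using assms by (induction rule: finite_induct) (auto intro!: smooth_space_const smooth_space_add)

lemma partials_sum:
  assumes "finite T" "\<And>t. t \<in> T \<Longrightarrow> f t \<in> smooth_space"
  shows "partials is (\<lambda>x. \<Sum>t\<in>T. f t x) = (\<lambda>x. \<Sum>t\<in>T. partials is (f t) x)"
  using assms
  by (induction rule: finite_induct) (auto simp: partials_zero partials_add smooth_space_sum)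

lemma partial_affine:
  assumes "f differentiable (at (c *\<^sub>R x + a))"
  shows "(\<lambda>x. f (c *\<^sub>R x + a)) differentiable (at x)"
    and "partial i (\<lambda>x. f (c *\<^sub>R x + a)) x = of_real c * partial i f (c *\<^sub>R x + a)"
proof -
  let ?D = "frechet_derivative f (at (c *\<^sub>R x + a))"
  have D: "(f has_derivative ?D) (at (c *\<^sub>R x + a))"
    using assms by (simp add: frechet_derivative_works[symmetric])
  have "((\<lambda>x. c *\<^sub>R x + a) has_derivative (\<lambda>h. c *\<^sub>R h)) (at x)"
    by (auto intro!: derivative_eq_intros)
  from has_derivative_compose[OF this D]
  have E: "((\<lambda>x. f (c *\<^sub>R x + a)) has_derivative (\<lambda>h. ?D (c *\<^sub>R h))) (at x)" .
  then show "(\<lambda>x. f (c *\<^sub>R x + a)) differentiable (at x)"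
    unfolding differentiable_def by blast
  have "?D (c *\<^sub>R axis i 1) = c *\<^sub>R ?D (axis i 1)"
    using D by (intro linear_scale) (simp add: has_derivative_linear)
  with partial_eq_derivative[OF E]
  show "partial i (\<lambda>x. f (c *\<^sub>R x + a)) x = of_real c * partial i f (c *\<^sub>R x + a)"
    by (simp add: partial_def scaleR_conv_of_real)
qed

lemma partials_affine:
  assumes "f \<in> smooth_space"
  shows "partials is (\<lambda>x. f (c *\<^sub>R x + a)) = (\<lambda>x. of_real (c ^ length is) * partials is f (c *\<^sub>R x + a))"
proof (induction "is")
  case (Cons i "is")
  have d: "partials is f differentiable (at (c *\<^sub>R x + a))" for x
    by (rule smooth_spaceD[OF assms])
  show ?case
    by (rule ext) (simp add: Cons partial_cmult[OF partial_affine(1)[OF d]] partial_affine(2)[OF d])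
qed simp

lemma smooth_space_affine:
  assumes "f \<in> smooth_space"
  shows "(\<lambda>x. f (c *\<^sub>R x + a)) \<in> smooth_space"
proof -
  have "partials is (\<lambda>x. f (c *\<^sub>R x + a)) differentiable (at x)" for "is" x
    unfolding partials_affine[OF assms]
    by (intro differentiable_mult differentiable_const partial_affine(1) smooth_spaceD assms)
  then show ?thesis by (simp add: smooth_space_def)
qed

text \<open>
  The seminorms of all the function spaces are suprema, possibly weighted, of \<open>jet k f\<close>. Keeping
  the jet as a function of the point, instead of its supremum, makes the Leibniz rule and
  inequalities of Minkowski type available point by point.
\<close>

definition jet :: "nat \<Rightarrow> (real^'n::finite \<Rightarrow> complex) \<Rightarrow> real^'n \<Rightarrow> real" where
  "jet k f x = (\<Sum>is | length is \<le> k. norm (partials is f x))"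

lemma finite_short_lists [simp]: "finite {is :: 'n::finite list. length is \<le> k}"
  using finite_lists_length_le[of "UNIV :: 'n set" k] by simp

lemma jet_nonneg [simp]: "0 \<le> jet k f x"
  by (simp add: jet_def sum_nonneg)

lemma norm_partials_le_jet: "length is \<le> k \<Longrightarrow> norm (partials is f x) \<le> jet k f x"
  unfolding jet_def by (rule member_le_sum) auto

lemma norm_le_jet: "norm (f x) \<le> jet k f x"
  using norm_partials_le_jet[of "[]" k f x] by simp

lemma jet_mono: "k \<le> l \<Longrightarrow> jet k f x \<le> jet l f x"
  unfolding jet_def by (rule sum_mono2) auto

lemma jet_cmult: "f \<in> smooth_space \<Longrightarrow> jet k (\<lambda>x. c * f x) x = norm c * jet k f x"
  by (simp add: jet_def partials_cmult norm_mult sum_distrib_left)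

lemma jet_add:
  "f \<in> smooth_space \<Longrightarrow> g \<in> smooth_space \<Longrightarrow> jet k (\<lambda>x. f x + g x) x \<le> jet k f x + jet k g x"
  unfolding jet_def sum.distrib[symmetric]
  by (rule sum_mono) (simp add: partials_add norm_triangle_ineq)

lemma jet_minus: "f \<in> smooth_space \<Longrightarrow> jet k (\<lambda>x. - f x) x = jet k f x"
  using jet_cmult[of f k "-1" x] by simp

lemma jet_diff:
  assumes "f \<in> smooth_space" "g \<in> smooth_space"
  shows "jet k (\<lambda>x. f x - g x) x \<le> jet k f x + jet k g x"
  using jet_add[of f "\<lambda>x. -1 * g x" k x] assms smooth_space_cmult[of g "-1"]
  by (simp add: jet_minus)

lemma partials_diff:
  assumes "f \<in> smooth_space" "g \<in> smooth_space"
  shows "partials is (\<lambda>x. f x - g x) = (\<lambda>x. partials is f x - partials is g x)"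
  using partials_add[OF assms(1) smooth_space_cmult[OF assms(2), of "-1"], of "is"]
    partials_cmult[OF assms(2), of "is" "-1"] by simp

lemma jet_diff_commute:
  assumes "f \<in> smooth_space" "g \<in> smooth_space"
  shows "jet k (\<lambda>x. f x - g x) x = jet k (\<lambda>x. g x - f x) x"
  using jet_minus[OF smooth_space_diff[OF assms], of k x] by simp

lemma jet_sum:
  assumes "finite T" "\<And>t. t \<in> T \<Longrightarrow> f t \<in> smooth_space"
  shows "jet k (\<lambda>x. \<Sum>t\<in>T. f t x) x \<le> (\<Sum>t\<in>T. jet k (f t) x)"
  unfolding jet_def sum.swap[of _ _ T]
  by (rule sum_mono) (use assms in \<open>simp add: partials_sum norm_sum\<close>)

lemma jet_translate: "f \<in> smooth_space \<Longrightarrow> jet k (\<lambda>x. f (x + a)) x = jet k f (x + a)"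
  using partials_affine[of f _ 1 a] by (simp add: jet_def)

lemma smooth_space_translate: "f \<in> smooth_space \<Longrightarrow> (\<lambda>x. f (x + a)) \<in> smooth_space"
  using smooth_space_affine[of f 1 a] by simp

lemma jet_partial_le: "jet k (partial i f) x \<le> jet (Suc k) f x"
proof -
  have "jet k (partial i f) x = (\<Sum>is | length is \<le> k. norm (partials (is @ [i]) f x))"
    by (simp add: jet_def partials_append)
  also have "\<dots> = (\<Sum>js\<in>(\<lambda>is. is @ [i]) ` {is. length is \<le> k}. norm (partials js f x))"
    by (subst sum.reindex) (auto simp: inj_on_def)
  also have "\<dots> \<le> jet (Suc k) f x"
    unfolding jet_def by (rule sum_mono2) auto
  finally show ?thesis .
qed

text \<open>
  Induction from the innermost derivative outwards, with both factors generalised, so that the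
  Leibniz rule for one derivative suffices.
\<close>

lemma norm_partials_mult_le:
  assumes "f \<in> smooth_space" "g \<in> smooth_space"
  shows "norm (partials is (\<lambda>x. f x * g x) x) \<le> 2 ^ length is * jet (length is) f x * jet (length is) g x"
  using assms
proof (induction "is" arbitrary: f g rule: rev_induct)
  case Nil
  then show ?case
    using mult_mono[OF norm_le_jet[of f x 0] norm_le_jet[of g x 0]] by (simp add: norm_mult)
next
  case (snoc i "is")
  let ?k = "length is"
  have eq: "partial i (\<lambda>x. f x * g x) = (\<lambda>x. f x * partial i g x + partial i f x * g x)"
    by (intro ext partial_mult smooth_space_differentiable snoc.prems)
  have sm: "(\<lambda>x. f x * partial i g x) \<in> smooth_space" "(\<lambda>x. partial i f x * g x) \<in> smooth_space"
    by (auto intro!: smooth_space_mult partial_in_smooth_space snoc.prems)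
  have "norm (partials (is @ [i]) (\<lambda>x. f x * g x) x) \<le>
     norm (partials is (\<lambda>x. f x * partial i g x) x) + norm (partials is (\<lambda>x. partial i f x * g x) x)"
    by (simp add: partials_append eq partials_add[OF sm] norm_triangle_ineq)
  also have "\<dots> \<le> 2 ^ ?k * jet ?k f x * jet ?k (partial i g) x + 2 ^ ?k * jet ?k (partial i f) x * jet ?k g x"
    by (intro add_mono snoc.IH snoc.prems partial_in_smooth_space)
  also have "\<dots> \<le> 2 ^ ?k * jet (Suc ?k) f x * jet (Suc ?k) g x + 2 ^ ?k * jet (Suc ?k) f x * jet (Suc ?k) g x"
    by (intro add_mono mult_mono jet_partial_le jet_mono) auto
  finally show ?case by (simp add: mult_ac)
qed

text \<open>
  The number of derivatives of order at most \<open>k\<close> depends on the dimension, hence the type argument.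
\<close>

definition leibniz_const :: "'n::finite itself \<Rightarrow> nat \<Rightarrow> real" where
  "leibniz_const _ k = real (card {is :: 'n list. length is \<le> k}) * 2 ^ k"

lemma leibniz_const_nonneg [simp]: "0 \<le> leibniz_const T k"
  by (simp add: leibniz_const_def)

lemma jet_mult:
  fixes f g :: "real^'n::finite \<Rightarrow> complex"
  assumes "f \<in> smooth_space" "g \<in> smooth_space"
  shows "jet k (\<lambda>x. f x * g x) x \<le> leibniz_const TYPE('n) k * (jet k f x * jet k g x)"
proof -
  have "jet k (\<lambda>x. f x * g x) x \<le> (\<Sum>is :: 'n list | length is \<le> k. 2 ^ k * jet k f x * jet k g x)"
    unfolding jet_def[of k "\<lambda>x. f x * g x"]
  proof (rule sum_mono)
    fix "is" :: "'n list" assume "is \<in> {is. length is \<le> k}"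
    then have *: "length is \<le> k" by simp
    have "norm (partials is (\<lambda>x. f x * g x) x) \<le> 2 ^ length is * jet (length is) f x * jet (length is) g x"
      by (rule norm_partials_mult_le[OF assms])
    also have "\<dots> \<le> 2 ^ k * jet k f x * jet k g x"
      by (intro mult_mono jet_mono power_increasing *) auto
    finally show "norm (partials is (\<lambda>x. f x * g x) x) \<le> 2 ^ k * jet k f x * jet k g x" .
  qed
  then show ?thesis by (simp add: leibniz_const_def mult_ac)
qed

lemma has_derivative_partials:
  fixes f :: "real^'n::finite \<Rightarrow> complex"
  assumes "f differentiable (at x)"
  shows "(f has_derivative (\<lambda>h. \<Sum>i\<in>UNIV. of_real (h $ i) * partial i f x)) (at x)"
proof -
  let ?D = "frechet_derivative f (at x)"
  have D: "(f has_derivative ?D) (at x)"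
    using assms by (simp add: frechet_derivative_works[symmetric])
  have lin: "linear ?D" using D has_derivative_linear by blast
  have "?D h = (\<Sum>i\<in>UNIV. of_real (h $ i) * partial i f x)" for h
  proof -
    have "h = (\<Sum>i\<in>UNIV. h $ i *\<^sub>R axis i 1)"
      using basis_expansion[of h] by (simp add: scalar_mult_eq_scaleR)
    then have "?D h = ?D (\<Sum>i\<in>UNIV. h $ i *\<^sub>R axis i 1)" by simp
    also have "\<dots> = (\<Sum>i\<in>UNIV. h $ i *\<^sub>R ?D (axis i 1))"
      by (simp add: linear_sum[OF lin] linear_scale[OF lin])
    finally show ?thesis by (simp add: partial_def scaleR_conv_of_real)
  qed
  then have "?D = (\<lambda>h. \<Sum>i\<in>UNIV. of_real (h $ i) * partial i f x)" by (rule ext)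
  with D show ?thesis by simp
qed

lemma norm_partial_sum_le:
  fixes f g :: "'n::finite \<Rightarrow> complex" and h :: "real^'n"
  assumes "\<And>i. norm (f i) \<le> e"
  shows "norm (\<Sum>i\<in>UNIV. of_real (h $ i) * f i) \<le> real CARD('n) * e * norm h"
proof -
  have "norm (\<Sum>i\<in>UNIV. of_real (h $ i) * f i) \<le> (\<Sum>i\<in>(UNIV::'n set). norm h * e)"
  proof (rule sum_norm_le)
    fix i
    have "\<bar>h $ i\<bar> * norm (f i) \<le> norm h * e"
      by (rule mult_mono[OF component_le_norm_cart assms]) auto
    then show "norm (of_real (h $ i) * f i) \<le> norm h * e"
      by (simp add: norm_mult)
  qed
  then show ?thesis by (simp add: mult_ac)
qed

lemma jet_Lipschitz:
  fixes f :: "real^'n::finite \<Rightarrow> complex"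
  assumes f: "f \<in> smooth_space" and C: "\<And>x. jet (Suc k) f x \<le> C"
  shows "jet k (\<lambda>x. f (x + a) - f (x + b)) x \<le>
    real (card {is :: 'n list. length is \<le> k}) * (real CARD('n) * C * norm (a - b))"
proof -
  have "norm (partials is f (x + a) - partials is f (x + b)) \<le> real CARD('n) * C * norm (a - b)"
    if "length is \<le> k" for "is" :: "'n list"
  proof -
    have "norm (partials is f (x + a) - partials is f (x + b)) \<le> real CARD('n) * C * norm ((x + a) - (x + b))"
    proof (rule differentiable_bound[OF convex_UNIV])
      fix z :: "real^'n"
      show "(partials is f has_derivative (\<lambda>h. \<Sum>i\<in>UNIV. of_real (h $ i) * partial i (partials is f) z)) (at z within UNIV)"
        using has_derivative_partials[OF smooth_spaceD[OF f]] by simp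
      have "norm (partial i (partials is f) z) \<le> C" for i
        using norm_partials_le_jet[of "i # is" "Suc k" f z] C[of z] that by simp
      then show "onorm (\<lambda>h. \<Sum>i\<in>UNIV. of_real (h $ i) * partial i (partials is f) z) \<le> real CARD('n) * C"
        by (intro onorm_bound norm_partial_sum_le)
          (use C[of z] jet_nonneg[of "Suc k" f z] in \<open>auto intro!: mult_nonneg_nonneg simp del: jet_nonneg\<close>)
    qed auto
    then show ?thesis by simp
  qed
  then have "jet k (\<lambda>x. f (x + a) - f (x + b)) x \<le> (\<Sum>is :: 'n list | length is \<le> k. real CARD('n) * C * norm (a - b))"
    unfolding jet_def
    by (intro sum_mono) (simp add: partials_diff smooth_space_translate f partials_affine[of f _ 1, simplified])
  then show ?thesis by simp
qed

section \<open>The function spaces in terms of jets\<close>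

lemma smooth_space_jet_continuous:
  "f \<in> smooth_space \<Longrightarrow> continuous_on UNIV (jet k f)"
  unfolding jet_def[abs_def] by (intro continuous_on_sum continuous_on_norm smooth_space_continuous)

lemma B_space_iff: "f \<in> B_space \<longleftrightarrow> f \<in> smooth_space \<and> (\<forall>k. \<exists>C. \<forall>x. jet k f x \<le> C)"
proof (intro iffI conjI allI)
  assume f: "f \<in> B_space"
  then show "f \<in> smooth_space" by (simp add: B_space_def)
  fix k
  have "\<forall>is. \<exists>C. \<forall>x. norm (partials is f x) \<le> C"
    using f by (auto simp: B_space_def bounded_iff)
  then obtain C where "\<And>is x. norm (partials is f x) \<le> C is" by metis
  then show "\<exists>C. \<forall>x. jet k f x \<le> C"
    by (intro exI[of _ "\<Sum>is | length is \<le> k. C is"]) (simp add: jet_def sum_mono)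
next
  assume f: "f \<in> smooth_space \<and> (\<forall>k. \<exists>C. \<forall>x. jet k f x \<le> C)"
  have "bounded (range (partials is f))" for "is"
  proof -
    obtain C where "\<And>x. jet (length is) f x \<le> C" using f by blast
    then have "norm (partials is f x) \<le> C" for x
      using norm_partials_le_jet[OF order_refl, of "is" f x] order_trans by blast
    then show ?thesis by (auto simp: bounded_iff)
  qed
  then show "f \<in> B_space" using f by (simp add: B_space_def)
qed

lemma B_dot_space_iff: "f \<in> B_dot_space \<longleftrightarrow> f \<in> B_space \<and> (\<forall>k. (jet k f \<longlongrightarrow> 0) at_infinity)"
proof (intro iffI conjI allI)
  assume f: "f \<in> B_dot_space"
  then show "f \<in> B_space" by (simp add: B_dot_space_def)
  fix k
  have "((\<lambda>x. \<Sum>is | length is \<le> k. norm (partials is f x)) \<longlongrightarrow> (\<Sum>is :: 'a list | length is \<le> k. 0)) at_infinity"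
    using f by (intro tendsto_sum) (auto simp: B_dot_space_def intro: tendsto_norm_zero)
  then show "(jet k f \<longlongrightarrow> 0) at_infinity" by (simp add: jet_def[abs_def])
next
  assume f: "f \<in> B_space \<and> (\<forall>k. (jet k f \<longlongrightarrow> 0) at_infinity)"
  have "(partials is f \<longlongrightarrow> 0) at_infinity" for "is"
  proof (rule Lim_null_comparison)
    show "(jet (length is) f \<longlongrightarrow> 0) at_infinity" using f by simp
    show "\<forall>\<^sub>F x in at_infinity. norm (partials is f x) \<le> jet (length is) f x"
      by (simp add: norm_partials_le_jet)
  qed
  then show "f \<in> B_dot_space" using f by (simp add: B_dot_space_def)
qed

lemma Schwartz_space_iff:
  "f \<in> Schwartz_space \<longleftrightarrow> f \<in> smooth_space \<and> (\<forall>k N. \<exists>C. \<forall>x. (1 + norm x) ^ N * jet k f x \<le> C)"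
proof (intro iffI conjI allI)
  assume f: "f \<in> Schwartz_space"
  then show "f \<in> smooth_space" by (simp add: Schwartz_space_def)
  fix k N
  have "\<forall>is. \<exists>C. \<forall>x. norm (of_real ((1 + norm x) ^ N) * partials is f x) \<le> C"
    using f by (auto simp: Schwartz_space_def bounded_iff)
  then obtain C where *: "norm (of_real ((1 + norm x) ^ N) * partials is f x) \<le> C is" for x "is" by metis
  have "(1 + norm x) ^ N * norm (partials is f x) \<le> C is" for x "is"
    using *[of x "is"] by (simp add: norm_mult norm_power del: of_real_add of_real_power)
  then show "\<exists>C. \<forall>x. (1 + norm x) ^ N * jet k f x \<le> C"
    by (intro exI[of _ "\<Sum>is | length is \<le> k. C is"]) (simp add: jet_def sum_mono sum_distrib_left)
next
  assume f: "f \<in> smooth_space \<and> (\<forall>k N. \<exists>C. \<forall>x. (1 + norm x) ^ N * jet k f x \<le> C)"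
  have "bounded (range (\<lambda>x. of_real ((1 + norm x) ^ N) * partials is f x))" for "is" N
  proof -
    obtain C where *: "\<And>x. (1 + norm x) ^ N * jet (length is) f x \<le> C" using f by blast
    have "(1 + norm x) ^ N * norm (partials is f x) \<le> C" for x
      by (rule order_trans[OF mult_left_mono[OF norm_partials_le_jet[OF order_refl]] *]) simp
    then show ?thesis
      by (auto simp: bounded_iff norm_mult norm_power simp del: of_real_add of_real_power)
  qed
  then show "f \<in> Schwartz_space" using f by (simp add: Schwartz_space_def)
qed

lemma B_dot_smooth: "f \<in> B_dot_space \<Longrightarrow> f \<in> smooth_space"
  and B_smooth: "f \<in> B_space \<Longrightarrow> f \<in> smooth_space"
  and B_dot_B: "f \<in> B_dot_space \<Longrightarrow> f \<in> B_space"
  and Schwartz_smooth: "f \<in> Schwartz_space \<Longrightarrow> f \<in> smooth_space"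
  by (auto simp: B_dot_space_def B_space_def Schwartz_space_def)

lemma B_dot_spaceI:
  assumes "f \<in> smooth_space" and "\<And>k. (jet k f \<longlongrightarrow> 0) at_infinity"
  shows "f \<in> B_dot_space"
proof -
  have "\<exists>C. \<forall>x. jet k f x \<le> C" for k
  proof -
    have "\<forall>\<^sub>F x in at_infinity. norm (jet k f x) < 1"
      using tendstoD[OF assms(2), of 1 k] by simp
    then obtain R where R: "\<And>x. norm x \<ge> R \<Longrightarrow> norm (jet k f x) < 1"
      unfolding eventually_at_infinity by blast
    have "bounded (jet k f ` cball 0 R)"
      by (intro compact_imp_bounded compact_continuous_image
          continuous_on_subset[OF smooth_space_jet_continuous[OF assms(1)]]) auto
    then obtain C where C: "\<And>x. x \<in> cball 0 R \<Longrightarrow> norm (jet k f x) \<le> C"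
      unfolding bounded_iff by blast
    have "jet k f x \<le> max C 1" for x
      using C[of x] R[of x] by (cases "norm x \<le> R") (auto simp del: jet_nonneg)
    then show ?thesis by blast
  qed
  then show ?thesis using assms by (simp add: B_dot_space_iff B_space_iff)
qed

lemma tendsto_inverse_norm_at_infinity:
  "((\<lambda>x::real^'n::finite. C / (1 + norm x)) \<longlongrightarrow> 0) at_infinity"
proof -
  have "LIM x at_infinity. (1 + norm (x::real^'n)) :> at_top"
    by (rule filterlim_tendsto_add_at_top[OF tendsto_const filterlim_norm_at_top])
  then show ?thesis
    by (intro tendsto_divide_0[OF tendsto_const] filterlim_at_top_imp_at_infinity)
qed

lemma Schwartz_B_dot:
  assumes "f \<in> Schwartz_space"
  shows "f \<in> B_dot_space"
proof (rule B_dot_spaceI)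
  show "f \<in> smooth_space" using assms by (simp add: Schwartz_smooth)
  fix k
  obtain C where C: "\<And>x. (1 + norm x) ^ 1 * jet k f x \<le> C"
    using assms unfolding Schwartz_space_iff by blast
  show "(jet k f \<longlongrightarrow> 0) at_infinity"
  proof (rule Lim_null_comparison[OF _ tendsto_inverse_norm_at_infinity[of C]])
    have "1 + norm x > 0" for x :: "real^'a" by (simp add: add_pos_nonneg)
    then show "\<forall>\<^sub>F x in at_infinity. norm (jet k f x) \<le> C / (1 + norm x)"
      using C by (intro always_eventually) (simp add: field_simps)
  qed
qed

lemma B_space_mult:
  assumes "f \<in> B_space" "g \<in> B_space"
  shows "(\<lambda>x. f x * g x) \<in> B_space"
  unfolding B_space_iff
proof (intro conjI allI)
  show "(\<lambda>x. f x * g x) \<in> smooth_space" using assms by (simp add: smooth_space_mult B_smooth)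
  fix k
  obtain C D where CD: "\<And>x. jet k f x \<le> C" "\<And>x. jet k g x \<le> D" using assms unfolding B_space_iff by metis
  have "0 \<le> C" using CD(1)[of 0] jet_nonneg[of k f 0] by linarith
  have "jet k (\<lambda>x. f x * g x) x \<le> leibniz_const TYPE('a) k * (C * D)" for x
    by (rule order_trans[OF jet_mult])
      (use assms \<open>0 \<le> C\<close> in \<open>auto intro!: mult_left_mono mult_mono CD simp: B_smooth\<close>)
  then show "\<exists>C. \<forall>x. jet k (\<lambda>x. f x * g x) x \<le> C" by blast
qed

lemma B_dot_space_mult:
  assumes "f \<in> B_space" "g \<in> B_dot_space"
  shows "(\<lambda>x. f x * g x) \<in> B_dot_space"
proof (rule B_dot_spaceI)
  have sm: "f \<in> smooth_space" "g \<in> smooth_space" using assms by (auto simp: B_smooth B_dot_smooth)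
  then show "(\<lambda>x. f x * g x) \<in> smooth_space" by (rule smooth_space_mult)
  fix k
  obtain C where C: "\<And>x. jet k f x \<le> C" using assms unfolding B_space_iff by metis
  have "((\<lambda>x. leibniz_const TYPE('a) k * (C * jet k g x)) \<longlongrightarrow> 0) at_infinity"
    using assms(2) unfolding B_dot_space_iff by (intro tendsto_mult_right_zero) auto
  then show "(jet k (\<lambda>x. f x * g x) \<longlongrightarrow> 0) at_infinity"
  proof (rule Lim_null_comparison[rotated])
    have "jet k (\<lambda>x. f x * g x) x \<le> leibniz_const TYPE('a) k * (C * jet k g x)" for x
      by (rule order_trans[OF jet_mult[OF sm]]) (auto intro!: mult_left_mono mult_right_mono C)
    then show "\<forall>\<^sub>F x in at_infinity. norm (jet k (\<lambda>x. f x * g x) x) \<le> leibniz_const TYPE('a) k * (C * jet k g x)"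
      by simp
  qed
qed

text \<open>
  A factor of polynomial growth is enough: in particular the weights act on \<open>Schwartz_space\<close>.
\<close>

lemma Schwartz_space_mult:
  fixes f g :: "real^'n::finite \<Rightarrow> complex"
  assumes f: "f \<in> smooth_space" "\<And>k. \<exists>C N. \<forall>x. jet k f x \<le> C * (1 + norm x) ^ N"
    and g: "g \<in> Schwartz_space"
  shows "(\<lambda>x. f x * g x) \<in> Schwartz_space"
  unfolding Schwartz_space_iff
proof (intro conjI allI)
  have sm: "g \<in> smooth_space" using g by (simp add: Schwartz_smooth)
  show "(\<lambda>x. f x * g x) \<in> smooth_space" by (rule smooth_space_mult[OF f(1) sm])
  fix k N
  obtain C M where C: "\<And>x. jet k f x \<le> C * (1 + norm x) ^ M" using f(2) by blast
  obtain D where D: "\<And>x. (1 + norm x) ^ (N + M) * jet k g x \<le> D"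
    using g unfolding Schwartz_space_iff by blast
  have C0: "0 \<le> C" using order_trans[OF jet_nonneg C, of 0] by simp
  have "(1 + norm x) ^ N * jet k (\<lambda>x. f x * g x) x \<le> leibniz_const TYPE('n) k * (C * D)" for x
  proof -
    have "(1 + norm x) ^ N * jet k (\<lambda>x. f x * g x) x \<le>
      (1 + norm x) ^ N * (leibniz_const TYPE('n) k * (jet k f x * jet k g x))"
      by (intro mult_left_mono jet_mult f sm) simp
    also have "\<dots> \<le> (1 + norm x) ^ N * (leibniz_const TYPE('n) k * ((C * (1 + norm x) ^ M) * jet k g x))"
      by (intro mult_left_mono mult_right_mono C) auto
    also have "\<dots> = leibniz_const TYPE('n) k * (C * ((1 + norm x) ^ (N + M) * jet k g x))"
      by (simp add: power_add mult_ac)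
    also have "\<dots> \<le> leibniz_const TYPE('n) k * (C * D)"
      by (intro mult_left_mono D C0) auto
    finally show ?thesis .
  qed
  then show "\<exists>C. \<forall>x. (1 + norm x) ^ N * jet k (\<lambda>x. f x * g x) x \<le> C" by blast
qed

lemma Schwartz_translate:
  fixes f :: "real^'n::finite \<Rightarrow> complex"
  assumes "f \<in> Schwartz_space"
  shows "(\<lambda>x. f (x + a)) \<in> Schwartz_space"
  unfolding Schwartz_space_iff
proof (intro conjI allI)
  have sm: "f \<in> smooth_space" using assms by (simp add: Schwartz_smooth)
  show "(\<lambda>x. f (x + a)) \<in> smooth_space" by (rule smooth_space_translate[OF sm])
  fix k N
  obtain D where D: "\<And>x. (1 + norm x) ^ N * jet k f x \<le> D"
    using assms unfolding Schwartz_space_iff by blast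
  have "(1 + norm x) ^ N * jet k (\<lambda>x. f (x + a)) x \<le> (1 + norm a) ^ N * D" for x
  proof -
    have "norm x \<le> norm (x + a) + norm a"
      using norm_triangle_ineq4[of "x + a" a] by simp
    also have "\<dots> \<le> norm (x + a) + norm a + norm (x + a) * norm a" by simp
    finally have "1 + norm x \<le> (1 + norm a) * (1 + norm (x + a))" by (simp add: algebra_simps)
    then have "(1 + norm x) ^ N \<le> ((1 + norm a) * (1 + norm (x + a))) ^ N"
      by (rule power_mono) simp
    then have "(1 + norm x) ^ N * jet k f (x + a) \<le> ((1 + norm a) * (1 + norm (x + a))) ^ N * jet k f (x + a)"
      by (rule mult_right_mono) simp
    also have "\<dots> = (1 + norm a) ^ N * ((1 + norm (x + a)) ^ N * jet k f (x + a))"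
      by (simp add: power_mult_distrib)
    also have "\<dots> \<le> (1 + norm a) ^ N * D" by (intro mult_left_mono D) simp
    finally show ?thesis by (simp add: jet_translate[OF sm])
  qed
  then show "\<exists>C. \<forall>x. (1 + norm x) ^ N * jet k (\<lambda>x. f (x + a)) x \<le> C" by blast
qed

lemma B_space_translate: "f \<in> B_space \<Longrightarrow> (\<lambda>x. f (x + a)) \<in> B_space"
  unfolding B_space_iff by (simp add: jet_translate smooth_space_translate) meson

lemma B_space_diff: "f \<in> B_space \<Longrightarrow> g \<in> B_space \<Longrightarrow> (\<lambda>x. f x - g x) \<in> B_space"
  unfolding B_space_iff
proof (intro conjI allI)
  assume *: "f \<in> smooth_space \<and> (\<forall>k. \<exists>C. \<forall>x. jet k f x \<le> C)" "g \<in> smooth_space \<and> (\<forall>k. \<exists>C. \<forall>x. jet k g x \<le> C)"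
  then show "(\<lambda>x. f x - g x) \<in> smooth_space" by (simp add: smooth_space_diff)
  fix k
  obtain C D where "\<And>x. jet k f x \<le> C" "\<And>x. jet k g x \<le> D" using * by metis
  then have "jet k (\<lambda>x. f x - g x) x \<le> C + D" for x
    using * by (intro order_trans[OF jet_diff add_mono]) auto
  then show "\<exists>C. \<forall>x. jet k (\<lambda>x. f x - g x) x \<le> C" by blast
qed

lemma B_space_const: "(\<lambda>x. c) \<in> B_space"
  by (auto simp: B_space_def smooth_space_const partials_const)

lemma B_dot_space_sum:
  assumes "finite T" "\<And>t. t \<in> T \<Longrightarrow> f t \<in> B_dot_space"
  shows "(\<lambda>x. \<Sum>t\<in>T. f t x) \<in> B_dot_space"
proof (rule B_dot_spaceI)
  show "(\<lambda>x. \<Sum>t\<in>T. f t x) \<in> smooth_space"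
    using assms by (intro smooth_space_sum) (auto simp: B_dot_smooth)
  fix k
  have "((\<lambda>x. \<Sum>t\<in>T. jet k (f t) x) \<longlongrightarrow> (\<Sum>t\<in>T. 0)) at_infinity"
    using assms by (intro tendsto_sum) (auto simp: B_dot_space_iff)
  then have "((\<lambda>x. \<Sum>t\<in>T. jet k (f t) x) \<longlongrightarrow> 0) at_infinity" by simp
  then show "(jet k (\<lambda>x. \<Sum>t\<in>T. f t x) \<longlongrightarrow> 0) at_infinity"
  proof (rule Lim_null_comparison[rotated])
    have "jet k (\<lambda>x. \<Sum>t\<in>T. f t x) x \<le> (\<Sum>t\<in>T. jet k (f t) x)" for x
      using assms by (intro jet_sum) (auto simp: B_dot_smooth)
    then show "\<forall>\<^sub>F x in at_infinity. norm (jet k (\<lambda>x. \<Sum>t\<in>T. f t x) x) \<le> (\<Sum>t\<in>T. jet k (f t) x)"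
      by simp
  qed
qed

lemma B_dot_space_add: "f \<in> B_dot_space \<Longrightarrow> g \<in> B_dot_space \<Longrightarrow> (\<lambda>x. f x + g x) \<in> B_dot_space"
  using B_dot_space_sum[of "UNIV :: bool set" "\<lambda>b. if b then f else g"]
  by (simp add: UNIV_bool add.commute[of "g _"])

lemma B_dot_space_cmult: "f \<in> B_dot_space \<Longrightarrow> (\<lambda>x. c * f x) \<in> B_dot_space"
  by (rule B_dot_space_mult[OF B_space_const])

lemma B_dot_space_diff: "f \<in> B_dot_space \<Longrightarrow> g \<in> B_dot_space \<Longrightarrow> (\<lambda>x. f x - g x) \<in> B_dot_space"
  using B_dot_space_add[OF _ B_dot_space_cmult[of g "-1"], of f] by simp

section \<open>Powers of \<open>c + |x|\<^sup>2\<close>\<close>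

text \<open>
  Homogeneity in \<open>(\<surd>c, x)\<close>: the functions of class \<open>s\<close> behave like \<open>(c + |x|\<^sup>2)\<^sup>s\<close> with constants
  independent of \<open>c\<close>, and each derivative lowers the class by \<open>1/2\<close>. This is the source of all
  bounds on the weight (\<open>c = 1\<close>) and on the kernel (\<open>c = y\<^sup>2\<close>) that are uniform in \<open>y\<close>.
\<close>

inductive radial_class :: "real \<Rightarrow> (real \<Rightarrow> real^'n::finite \<Rightarrow> complex) \<Rightarrow> bool" where
  power: "radial_class s (\<lambda>c x. of_real ((c + (norm x)\<^sup>2) powr s))"
| coord: "radial_class s g \<Longrightarrow> t = s + 1/2 \<Longrightarrow> radial_class t (\<lambda>c x. of_real (x $ i) * g c x)"
| add: "radial_class s g \<Longrightarrow> radial_class s h \<Longrightarrow> radial_class s (\<lambda>c x. g c x + h c x)"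
| cmult: "radial_class s g \<Longrightarrow> radial_class s (\<lambda>c x. a * g c x)"

lemma radial_class_bound:
  fixes g :: "real \<Rightarrow> real^'n::finite \<Rightarrow> complex"
  assumes "radial_class s g"
  shows "\<exists>C\<ge>0. \<forall>c>0. \<forall>x. norm (g c x) \<le> C * (c + (norm x)\<^sup>2) powr s"
  using assms
proof induction
  case (power s)
  then show ?case by (intro exI[of _ 1]) auto
next
  case (coord s g t i)
  then obtain C where C: "C \<ge> 0" "\<And>c x. c > 0 \<Longrightarrow> norm (g c x) \<le> C * (c + (norm x)\<^sup>2) powr s" by auto
  have "norm (of_real (x $ i) * g c x) \<le> C * (c + (norm x)\<^sup>2) powr t" if c: "c > 0" for c x
  proof -
    have pos: "c + (norm x)\<^sup>2 > 0" using c by (simp add: add_pos_nonneg)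
    have "\<bar>x $ i\<bar> \<le> norm x" by (rule component_le_norm_cart)
    also have "\<dots> \<le> sqrt (c + (norm x)\<^sup>2)" using c by (intro real_le_rsqrt) auto
    also have "\<dots> = (c + (norm x)\<^sup>2) powr (1/2)" using pos by (simp add: powr_half_sqrt)
    finally have "norm (of_real (x $ i) * g c x) \<le> (c + (norm x)\<^sup>2) powr (1/2) * (C * (c + (norm x)\<^sup>2) powr s)"
      unfolding norm_mult using C(2)[OF c, of x] by (intro mult_mono) auto
    also have "\<dots> = C * (c + (norm x)\<^sup>2) powr t" by (simp add: coord.hyps powr_add mult_ac)
    finally show ?thesis .
  qed
  then show ?case using C(1) by blast
next
  case (add s g h)
  then obtain C D where CD: "C \<ge> 0" "\<And>c x. c > 0 \<Longrightarrow> norm (g c x) \<le> C * (c + (norm x)\<^sup>2) powr s"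
     "D \<ge> 0" "\<And>c x. c > 0 \<Longrightarrow> norm (h c x) \<le> D * (c + (norm x)\<^sup>2) powr s" by metis
  have "norm (g c x + h c x) \<le> (C + D) * (c + (norm x)\<^sup>2) powr s" if "c > 0" for c x
    using norm_triangle_ineq[of "g c x" "h c x"] CD(2)[OF that, of x] CD(4)[OF that, of x]
    by (simp add: algebra_simps)
  then show ?case using CD by (intro exI[of _ "C + D"]) auto
next
  case (cmult s g a)
  then obtain C where C: "C \<ge> 0" "\<And>c x. c > 0 \<Longrightarrow> norm (g c x) \<le> C * (c + (norm x)\<^sup>2) powr s" by auto
  then have "norm (a * g c x) \<le> (norm a * C) * (c + (norm x)\<^sup>2) powr s" if "c > 0" for c x
    using mult_left_mono[OF C(2)[OF that, of x], of "norm a"] by (simp add: norm_mult mult_ac)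
  then show ?case using C(1) by (intro exI[of _ "norm a * C"]) auto
qed

lemma partial_coord:
  fixes x :: "real^'n::finite"
  shows "(\<lambda>x. of_real (x $ j) :: complex) differentiable (at x)"
    "partial i (\<lambda>x. of_real (x $ j)) x = (if i = j then 1 else 0)"
proof -
  have D: "((\<lambda>x :: real^'n. of_real (x $ j) :: complex) has_derivative (\<lambda>h. of_real (h $ j))) (at x)"
    by (auto intro!: derivative_eq_intros bounded_linear_imp_has_derivative bounded_linear_compose[OF bounded_linear_of_real] bounded_linear_vec_nth)
  then show "(\<lambda>x. of_real (x $ j) :: complex) differentiable (at x)"
    unfolding differentiable_def by blast
  from partial_eq_derivative[OF D] show "partial i (\<lambda>x. of_real (x $ j)) x = (if i = j then 1 else 0)"
    by (simp add: axis_def)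
qed

lemma radial_class_partial:
  fixes g :: "real \<Rightarrow> real^'n::finite \<Rightarrow> complex"
  assumes "radial_class s g"
  shows "(\<forall>c>0. \<forall>x. g c differentiable (at x)) \<and>
    (\<exists>h. radial_class (s - 1/2) h \<and> (\<forall>c>0. partial i (g c) = h c))"
  using assms
proof induction
  case (power s)
  let ?g = "\<lambda>c x :: real^'n. of_real ((c + (norm x)\<^sup>2) powr s) :: complex"
  let ?h = "\<lambda>c x :: real^'n. of_real (x $ i) * (of_real (2 * s) * of_real ((c + (norm x)\<^sup>2) powr (s - 1))) :: complex"
  have D: "(?g c has_derivative (\<lambda>h. of_real (s * (c + (norm x)\<^sup>2) powr (s - 1) * (2 * (x \<bullet> h))))) (at x)"
    if "c > 0" for c x
  proof -
    have pos: "c + x \<bullet> x > 0" using that by (simp add: add_pos_nonneg)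
    have "((\<lambda>x. (c + x \<bullet> x) powr s) has_derivative (\<lambda>h. s * (c + x \<bullet> x) powr (s - 1) * (2 * (x \<bullet> h)))) (at x)"
    proof -
      have "((\<lambda>t. t powr s) has_real_derivative s * (c + x \<bullet> x) powr (s - 1)) (at (c + x \<bullet> x))"
        using pos by (rule has_real_derivative_powr)
      then have "((\<lambda>t. t powr s) has_derivative (\<lambda>t. s * (c + x \<bullet> x) powr (s - 1) * t)) (at (c + x \<bullet> x))"
        by (simp add: has_field_derivative_def)
      moreover have "((\<lambda>x. c + x \<bullet> x) has_derivative (\<lambda>h. 2 * (x \<bullet> h))) (at x)"
        by (auto intro!: derivative_eq_intros simp: inner_commute)
      ultimately show ?thesis
        using has_derivative_compose by fastforce
    qed
    then show ?thesis
      unfolding power2_norm_eq_inner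
      by (rule bounded_linear.has_derivative[OF bounded_linear_of_real])
  qed
  have "radial_class (s - 1/2) ?h"
    by (rule radial_class.coord[OF radial_class.cmult[OF radial_class.power]]) simp
  moreover have "partial i (?g c) = ?h c" if "c > 0" for c
    by (rule ext) (simp add: partial_eq_derivative[OF D[OF that]] inner_axis)
  moreover have "?g c differentiable (at x)" if "c > 0" for c x
    using D[OF that] unfolding differentiable_def by blast
  ultimately show ?case by blast
next
  case (coord s g t j)
  then obtain h where h: "radial_class (s - 1/2) h" "\<And>c. c > 0 \<Longrightarrow> partial i (g c) = h c"
    and d: "\<And>c x. c > 0 \<Longrightarrow> g c differentiable (at x)" by blast
  let ?h = "\<lambda>c x. of_real (x $ j) * h c x + (if i = j then 1 else 0) * g c x"
  have "partial i (\<lambda>x. of_real (x $ j) * g c x) = ?h c" if "c > 0" for c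
    by (rule ext) (simp add: partial_mult partial_coord d h(2)[symmetric] that)
  moreover have "radial_class (t - 1/2) ?h"
    using coord.hyps by (intro radial_class.add radial_class.coord[OF h(1)] radial_class.cmult) auto
  moreover have "(\<lambda>x. of_real (x $ j) * g c x) differentiable (at x)" if "c > 0" for c x
    by (intro differentiable_mult partial_coord d that)
  ultimately show ?case by blast
next
  case (add s g h)
  then obtain g' h' where h: "radial_class (s - 1/2) g'" "\<And>c. c > 0 \<Longrightarrow> partial i (g c) = g' c"
    "radial_class (s - 1/2) h'" "\<And>c. c > 0 \<Longrightarrow> partial i (h c) = h' c" by blast
  have "partial i (\<lambda>x. g c x + h c x) = (\<lambda>x. g' c x + h' c x)" if "c > 0" for c
    by (rule ext) (simp add: partial_add add h(2,4)[symmetric] that)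
  then show ?case
    using radial_class.add[OF h(1,3)] add by (auto intro!: differentiable_add)
next
  case (cmult s g a)
  then obtain h where h: "radial_class (s - 1/2) h" "\<And>c. c > 0 \<Longrightarrow> partial i (g c) = h c" by blast
  have "partial i (\<lambda>x. a * g c x) = (\<lambda>x. a * h c x)" if "c > 0" for c
    by (rule ext) (simp add: partial_cmult cmult h(2)[symmetric] that)
  then show ?case
    using radial_class.cmult[OF h(1)] cmult by (auto intro!: differentiable_mult)
qed

lemma radial_class_partials:
  assumes "radial_class s g"
  shows "\<exists>h. radial_class (s - length is / 2) h \<and> (\<forall>c>0. partials is (g c) = h c)"
proof (induction "is")
  case (Cons i "is")
  then obtain h where h: "radial_class (s - length is / 2) h" "\<And>c. c > 0 \<Longrightarrow> partials is (g c) = h c" by blast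
  with radial_class_partial[OF h(1), of i] show ?case
    by (auto simp: add_divide_distrib algebra_simps)
qed (use assms in auto)

lemma radial_power_smooth:
  fixes s c :: real
  assumes "c > 0"
  shows "(\<lambda>x :: real^'n::finite. of_real ((c + (norm x)\<^sup>2) powr s)) \<in> smooth_space"
  unfolding smooth_space_def
proof (clarify)
  fix "is" :: "'n list" and x :: "real^'n"
  show "partials is (\<lambda>x. of_real ((c + (norm x)\<^sup>2) powr s)) differentiable (at x)"
    using radial_class_partials[OF radial_class.power, of s "is"] radial_class_partial assms by force
qed

text \<open>
  With \<open>c = y\<^sup>2\<close> the loss of \<open>1/2\<close> in the exponent per derivative is at most a factor \<open>1 / y\<close>.
\<close>

lemma jet_radial_power:
  "\<exists>C\<ge>0. \<forall>y>0. \<forall>x :: real^'n::finite.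
     jet k (\<lambda>x. of_real ((y\<^sup>2 + (norm x)\<^sup>2) powr s)) x \<le> C * ((y\<^sup>2 + (norm x)\<^sup>2) powr s * (1 + 1 / y) ^ k)"
proof -
  have "\<exists>C\<ge>0. \<forall>c>0. \<forall>x. norm (partials is (\<lambda>x :: real^'n. of_real ((c + (norm x)\<^sup>2) powr s)) x) \<le>
      C * (c + (norm x)\<^sup>2) powr (s - length is / 2)" for "is"
    using radial_class_partials[OF radial_class.power, of s "is"] radial_class_bound by metis
  then obtain C where C: "\<And>is. C is \<ge> 0" "\<And>is c x. c > 0 \<Longrightarrow>
      norm (partials is (\<lambda>x :: real^'n. of_real ((c + (norm x)\<^sup>2) powr s)) x) \<le> C is * (c + (norm x)\<^sup>2) powr (s - length is / 2)"
    by metis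
  have "jet k (\<lambda>x. of_real ((y\<^sup>2 + (norm x)\<^sup>2) powr s)) x \<le>
      (\<Sum>is :: 'n list | length is \<le> k. C is) * ((y\<^sup>2 + (norm x)\<^sup>2) powr s * (1 + 1 / y) ^ k)"
    if y: "y > 0" for y and x :: "real^'n"
    unfolding jet_def sum_distrib_right
  proof (rule sum_mono)
    fix "is" :: "'n list" assume "is \<in> {is. length is \<le> k}"
    then have len: "length is \<le> k" by simp
    let ?q = "y\<^sup>2 + (norm x)\<^sup>2"
    have q: "?q > 0" "y\<^sup>2 \<le> ?q" using y by (auto simp: add_pos_nonneg)
    have "norm (partials is (\<lambda>x. of_real ((y\<^sup>2 + (norm x)\<^sup>2) powr s)) x) \<le> C is * ?q powr (s - length is / 2)"
      using C(2)[of "y\<^sup>2" "is" x] y by simp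
    also have "?q powr (s - length is / 2) = ?q powr s * ?q powr (- (length is / 2))"
      by (simp add: powr_add[symmetric])
    also have "?q powr (- (length is / 2)) \<le> (y\<^sup>2) powr (- (length is / 2))"
      using q y by (intro powr_mono2') auto
    also have "(y\<^sup>2) powr (- (length is / 2)) = (1 / y) ^ length is"
    proof -
      have "(y\<^sup>2) powr (- (length is / 2)) = (y powr 2) powr (- (length is / 2))"
        using y powr_realpow[of y 2] by simp
      also have "\<dots> = y powr (- real (length is))" by (simp add: powr_powr)
      also have "\<dots> = 1 / y ^ length is" using y by (simp add: powr_minus_divide powr_realpow)
      finally show ?thesis by (simp add: power_divide)
    qed
    also have "\<dots> \<le> (1 + 1 / y) ^ length is" using y by (intro power_mono) auto
    also have "\<dots> \<le> (1 + 1 / y) ^ k" using y by (intro power_increasing len) auto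
    finally show "norm (partials is (\<lambda>x. of_real ((y\<^sup>2 + (norm x)\<^sup>2) powr s)) x) \<le> C is * (?q powr s * (1 + 1 / y) ^ k)"
      using C(1)[of "is"] by (simp add: mult_left_mono)
  qed
  then show ?thesis using C(1) by (intro exI[of _ "\<Sum>is :: 'n list | length is \<le> k. C is"]) (simp add: sum_nonneg)
qed

lemma radial_power_polynomial_bound:
  "\<exists>N. \<forall>x :: real^'n::finite. (1 + (norm x)\<^sup>2) powr s \<le> (1 + norm x) ^ N"
proof -
  obtain N :: nat where N: "s \<le> N" using real_arch_simple by blast
  have "(1 + (norm x)\<^sup>2) powr s \<le> (1 + norm x) ^ (2 * N)" for x :: "real^'n"
  proof -
    have "(1 + (norm x)\<^sup>2) powr s \<le> (1 + (norm x)\<^sup>2) powr N" using N by (intro powr_mono) auto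
    also have "\<dots> = (1 + (norm x)\<^sup>2) ^ N" by (simp add: powr_realpow add_pos_nonneg)
    also have "\<dots> \<le> ((1 + norm x)\<^sup>2) ^ N" by (intro power_mono) (auto simp: power2_eq_square algebra_simps)
    finally show ?thesis by (simp add: power_mult)
  qed
  then show ?thesis by blast
qed

lemma jet_weight_power:
  "\<exists>C\<ge>0. \<forall>x :: real^'n::finite. jet k (\<lambda>x. of_real ((1 + (norm x)\<^sup>2) powr s)) x \<le> C * (1 + (norm x)\<^sup>2) powr s"
proof -
  obtain C where C: "C \<ge> 0" "\<And>y x. y > 0 \<Longrightarrow>
     jet k (\<lambda>x :: real^'n. of_real ((y\<^sup>2 + (norm x)\<^sup>2) powr s)) x \<le> C * ((y\<^sup>2 + (norm x)\<^sup>2) powr s * (1 + 1 / y) ^ k)"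
    using jet_radial_power by blast
  then show ?thesis using C(2)[of 1] by (intro exI[of _ "C * 2 ^ k"]) (simp add: mult_ac)
qed

lemma weight_power_mult_Schwartz:
  assumes "\<phi> \<in> Schwartz_space"
  shows "(\<lambda>x :: real^'n::finite. of_real ((1 + (norm x)\<^sup>2) powr s) * \<phi> x) \<in> Schwartz_space"
proof (rule Schwartz_space_mult[OF radial_power_smooth _ assms])
  fix k
  obtain C N where C: "C \<ge> 0" "\<And>x :: real^'n. jet k (\<lambda>x. of_real ((1 + (norm x)\<^sup>2) powr s)) x \<le> C * (1 + (norm x)\<^sup>2) powr s"
    and N: "\<And>x :: real^'n. (1 + (norm x)\<^sup>2) powr s \<le> (1 + norm x) ^ N"
    using jet_weight_power[of k s] radial_power_polynomial_bound[of s] by metis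
  have "jet k (\<lambda>x. of_real ((1 + (norm x)\<^sup>2) powr s)) x \<le> C * (1 + norm x) ^ N" for x :: "real^'n"
    using C(2)[of x] mult_left_mono[OF N[of x] C(1)] by linarith
  then show "\<exists>C N. \<forall>x :: real^'n. jet k (\<lambda>x. of_real ((1 + (norm x)\<^sup>2) powr s)) x \<le> C * (1 + norm x) ^ N" by blast
qed simp

section \<open>Gaussian cut-off functions\<close>

text \<open>
  Polynomials times the Gaussian: stable under derivatives and rapidly decreasing.
\<close>

inductive_set gaussian_class :: "(real^'n::finite \<Rightarrow> complex) set" where
  gaussian: "(\<lambda>x. of_real (exp (- (norm x)\<^sup>2))) \<in> gaussian_class"
| coord: "g \<in> gaussian_class \<Longrightarrow> (\<lambda>x. of_real (x $ i) * g x) \<in> gaussian_class"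
| add: "g \<in> gaussian_class \<Longrightarrow> h \<in> gaussian_class \<Longrightarrow> (\<lambda>x. g x + h x) \<in> gaussian_class"
| cmult: "g \<in> gaussian_class \<Longrightarrow> (\<lambda>x. a * g x) \<in> gaussian_class"

lemma gaussian_class_partial:
  fixes g :: "real^'n::finite \<Rightarrow> complex"
  assumes "g \<in> gaussian_class"
  shows "(\<forall>x. g differentiable (at x)) \<and> (\<forall>i. partial i g \<in> gaussian_class)"
  using assms
proof induction
  case gaussian
  let ?g = "\<lambda>x :: real^'n. of_real (exp (- (norm x)\<^sup>2)) :: complex"
  have D: "(?g has_derivative (\<lambda>h. of_real (exp (- (norm x)\<^sup>2) * (- (2 * (x \<bullet> h)))))) (at x)" for x
    unfolding power2_norm_eq_inner
    by (auto intro!: derivative_eq_intros bounded_linear.has_derivative[OF bounded_linear_of_real] simp: inner_commute)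
  have "partial i ?g = (\<lambda>x. of_real (x $ i) * (-2 * ?g x))" for i
    by (rule ext) (simp add: partial_eq_derivative[OF D] inner_axis)
  then have "partial i ?g \<in> gaussian_class" for i
    using gaussian_class.coord[OF gaussian_class.cmult[OF gaussian_class.gaussian], of i "-2"] by metis
  then show ?case
    using D unfolding differentiable_def by blast
next
  case (coord g j)
  have "partial i (\<lambda>x. of_real (x $ j) * g x) = (\<lambda>x. of_real (x $ j) * partial i g x + (if i = j then 1 else 0) * g x)" for i
    by (rule ext) (simp add: partial_mult partial_coord coord)
  then show ?case
    using coord by (auto intro!: gaussian_class.intros differentiable_mult partial_coord)
next
  case (add g h)
  have "partial i (\<lambda>x. g x + h x) = (\<lambda>x. partial i g x + partial i h x)" for i
    by (rule ext) (simp add: partial_add add)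
  then show ?case using add by (auto intro!: gaussian_class.add differentiable_add)
next
  case (cmult g a)
  have "partial i (\<lambda>x. a * g x) = (\<lambda>x. a * partial i g x)" for i
    by (rule ext) (simp add: partial_cmult cmult)
  then show ?case using cmult by (auto intro!: gaussian_class.cmult differentiable_mult)
qed

lemma gaussian_class_bound:
  fixes g :: "real^'n::finite \<Rightarrow> complex"
  assumes "g \<in> gaussian_class"
  shows "\<exists>C. \<forall>x. (1 + norm x) ^ N * norm (g x) \<le> C"
  using assms
proof (induction arbitrary: N)
  case gaussian
  have "(1 + t) ^ N * exp (- t\<^sup>2) \<le> fact N * exp 2" if "t \<ge> 0" for t :: real
  proof -
    have "(1 + t) ^ N / fact N \<le> exp (1 + t)"
    proof -
      have "(\<Sum>n\<in>{N}. (1 + t) ^ n /\<^sub>R fact n) \<le> (\<Sum>n. (1 + t) ^ n /\<^sub>R fact n)"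
        by (rule sum_le_suminf[OF summable_exp_generic]) (use that in auto)
      then show ?thesis by (simp add: exp_def divide_inverse mult_ac)
    qed
    then have "(1 + t) ^ N \<le> fact N * exp (1 + t)" by (simp add: field_simps)
    then have "(1 + t) ^ N * exp (- t\<^sup>2) \<le> fact N * (exp (1 + t) * exp (- t\<^sup>2))"
      by (simp add: mult_right_mono flip: mult.assoc)
    also have "exp (1 + t) * exp (- t\<^sup>2) = exp (1 + t - t\<^sup>2)" by (simp add: exp_add[symmetric])
    also have "1 + t - t\<^sup>2 \<le> 2" using sum_squares_ge_zero[of "t - 1/2" 0] by (simp add: power2_eq_square algebra_simps)
    finally show ?thesis by simp
  qed
  then show ?case by (intro exI[of _ "fact N * exp 2"]) simp
next
  case (coord g i)
  obtain C where C: "\<And>x. (1 + norm x) ^ Suc N * norm (g x) \<le> C" using coord by blast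
  have "(1 + norm x) ^ N * norm (of_real (x $ i) * g x) \<le> C" for x
  proof -
    have "\<bar>x $ i\<bar> \<le> 1 + norm x" using component_le_norm_cart[of x i] by linarith
    then have "(1 + norm x) ^ N * norm (of_real (x $ i) * g x) \<le> (1 + norm x) ^ N * ((1 + norm x) * norm (g x))"
      by (auto simp: norm_mult intro!: mult_left_mono mult_right_mono)
    with C[of x] show ?thesis by (simp add: mult_ac)
  qed
  then show ?case by blast
next
  case (add g h)
  obtain C D where "\<And>x. (1 + norm x) ^ N * norm (g x) \<le> C" "\<And>x. (1 + norm x) ^ N * norm (h x) \<le> D"
    using add by metis
  then have "(1 + norm x) ^ N * norm (g x + h x) \<le> C + D" for x
    by (intro order_trans[OF mult_left_mono[OF norm_triangle_ineq]]) (auto simp: distrib_left add_mono)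
  then show ?case by blast
next
  case (cmult g a)
  obtain C where C: "\<And>x. (1 + norm x) ^ N * norm (g x) \<le> C" using cmult by blast
  have "(1 + norm x) ^ N * norm (a * g x) \<le> norm a * C" for x
    using mult_left_mono[OF C[of x], of "norm a"] by (simp add: norm_mult mult_ac)
  then show ?case by blast
qed

lemma gaussian_Schwartz: "(\<lambda>x :: real^'n::finite. of_real (exp (- (norm x)\<^sup>2))) \<in> Schwartz_space"
proof -
  let ?g = "\<lambda>x :: real^'n. of_real (exp (- (norm x)\<^sup>2)) :: complex"
  have *: "partials is ?g \<in> gaussian_class" for "is"
    by (induction "is") (auto simp: gaussian_class.gaussian gaussian_class_partial)
  have "?g \<in> smooth_space"
    using gaussian_class_partial[OF *] by (simp add: smooth_space_def)
  moreover have "bounded (range (\<lambda>x. of_real ((1 + norm x) ^ k) * partials is ?g x))" for k "is"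
  proof -
    obtain C where "\<And>x. (1 + norm x) ^ k * norm (partials is ?g x) \<le> C"
      using gaussian_class_bound[OF *] by blast
    then show ?thesis by (auto simp: bounded_iff norm_mult norm_power simp del: of_real_add of_real_power)
  qed
  ultimately show ?thesis by (simp add: Schwartz_space_def)
qed

lemma Schwartz_dilate:
  fixes f :: "real^'n::finite \<Rightarrow> complex"
  assumes f: "f \<in> Schwartz_space" and c: "c \<noteq> 0"
  shows "(\<lambda>x. f (c *\<^sub>R x)) \<in> Schwartz_space"
proof -
  have sm: "f \<in> smooth_space" using f by (rule Schwartz_smooth)
  have p: "partials is (\<lambda>x. f (c *\<^sub>R x)) = (\<lambda>x. of_real (c ^ length is) * partials is f (c *\<^sub>R x))" for "is"
    using partials_affine[OF sm, of "is" c 0] by simp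
  have "bounded (range (\<lambda>x. of_real ((1 + norm x) ^ k) * partials is (\<lambda>x. f (c *\<^sub>R x)) x))" for k "is"
  proof -
    obtain C where C: "\<And>x. (1 + norm x) ^ k * norm (partials is f x) \<le> C"
    proof -
      have "bounded (range (\<lambda>x. of_real ((1 + norm x) ^ k) * partials is f x))"
        using f unfolding Schwartz_space_def by blast
      then obtain C where "\<And>x. norm (of_real ((1 + norm x) ^ k) * partials is f x) \<le> C"
        unfolding bounded_iff by blast
      then have "(1 + norm x) ^ k * norm (partials is f x) \<le> C" for x
        by (simp add: norm_mult norm_power del: of_real_add of_real_power)
      then show ?thesis using that by blast
    qed
    let ?a = "1 + 1 / \<bar>c\<bar>"
    have "norm (of_real ((1 + norm x) ^ k) * partials is (\<lambda>x. f (c *\<^sub>R x)) x) \<le> \<bar>c\<bar> ^ length is * (?a ^ k * C)" for x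
    proof -
      have "1 + norm x \<le> ?a * (1 + norm (c *\<^sub>R x))" using c by (simp add: field_simps)
      then have "(1 + norm x) ^ k \<le> ?a ^ k * (1 + norm (c *\<^sub>R x)) ^ k"
        unfolding power_mult_distrib[symmetric] by (intro power_mono) auto
      then have "(1 + norm x) ^ k * norm (partials is f (c *\<^sub>R x)) \<le> ?a ^ k * (1 + norm (c *\<^sub>R x)) ^ k * norm (partials is f (c *\<^sub>R x))"
        by (rule mult_right_mono) simp
      also have "\<dots> \<le> ?a ^ k * C"
        using mult_left_mono[OF C[of "c *\<^sub>R x"], of "?a ^ k"] by (simp add: mult_ac)
      finally have "(1 + norm x) ^ k * norm (partials is f (c *\<^sub>R x)) \<le> ?a ^ k * C" .
      from mult_left_mono[OF this, of "\<bar>c\<bar> ^ length is"] show ?thesis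
        by (simp add: p norm_mult norm_power power_abs mult_ac del: of_real_add of_real_power)
    qed
    then show ?thesis by (auto simp: bounded_iff)
  qed
  then show ?thesis using smooth_space_affine[OF sm, of c 0] by (simp add: Schwartz_space_def)
qed

text \<open>
  The Gaussian at scale \<open>2\<^sup>j\<close>. Two of its properties replace compact supports: it increases with
  \<open>j\<close>, so that sums of differences telescope and stay bounded by \<open>1\<close>, and its derivatives are
  \<open>O(2\<^sup>-\<^sup>j)\<close>, so that they are summable over \<open>j\<close>.
\<close>

definition cutoff :: "nat \<Rightarrow> real^'n::finite \<Rightarrow> real" where
  "cutoff j x = exp (- (norm ((1 / 2 ^ j) *\<^sub>R x))\<^sup>2)"

lemma cutoff_Schwartz: "(\<lambda>x :: real^'n::finite. of_real (cutoff j x)) \<in> Schwartz_space"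
  unfolding cutoff_def by (rule Schwartz_dilate[OF gaussian_Schwartz]) simp

lemma cutoff_nonneg [simp]: "0 \<le> cutoff j x" and cutoff_le_1: "cutoff j x \<le> 1"
  by (auto simp: cutoff_def)

lemma cutoff_mono:
  assumes "i \<le> j" shows "cutoff i x \<le> cutoff j x"
proof -
  have "norm x / 2 ^ j \<le> norm x / 2 ^ i"
    using assms by (intro divide_left_mono power_increasing) auto
  then show ?thesis by (auto simp: cutoff_def intro!: power_mono)
qed

lemma one_minus_cutoff_le: "1 - cutoff j x \<le> (norm x)\<^sup>2 / 2 ^ j"
proof -
  have "1 - cutoff j x \<le> (norm x / 2 ^ j)\<^sup>2"
    using exp_ge_add_one_self[of "- (norm x / 2 ^ j)\<^sup>2"] by (simp add: cutoff_def)
  also have "\<dots> = (norm x)\<^sup>2 / (2 ^ j * 2 ^ j)" by (simp add: power_divide power2_eq_square)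
  also have "\<dots> \<le> (norm x)\<^sup>2 / 2 ^ j"
    by (intro divide_left_mono) (auto simp: mult_le_cancel_right1)
  finally show ?thesis .
qed

text \<open>
  Separates the value from the derivatives, since for the cut-off functions the former is controlled
  by monotonicity and the latter by the scale.
\<close>

lemma jet_le_value_plus:
  fixes f :: "real^'n::finite \<Rightarrow> complex"
  assumes "\<And>is. is \<noteq> [] \<Longrightarrow> length is \<le> k \<Longrightarrow> norm (partials is f x) \<le> e" "0 \<le> e"
  shows "jet k f x \<le> norm (f x) + real (card {is :: 'n list. length is \<le> k}) * e"
proof -
  let ?L = "{is :: 'n list. length is \<le> k}"
  have "jet k f x = norm (partials [] f x) + (\<Sum>is\<in>?L - {[]}. norm (partials is f x))"
    unfolding jet_def by (subst sum.remove[of _ "[]"]) auto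
  also have "(\<Sum>is\<in>?L - {[]}. norm (partials is f x)) \<le> (\<Sum>is\<in>?L - {[]}. e)"
    by (rule sum_mono) (use assms in auto)
  also have "\<dots> \<le> (\<Sum>is\<in>?L. e)" using assms(2) by (intro sum_mono2) auto
  finally show ?thesis by simp
qed

lemma partials_cutoff_le:
  "\<exists>C\<ge>0. \<forall>j. \<forall>is. is \<noteq> [] \<and> length is \<le> k \<longrightarrow>
     (\<forall>x :: real^'n::finite. norm (partials is (\<lambda>x. of_real (cutoff j x)) x) \<le> C / 2 ^ j)"
proof -
  let ?g = "\<lambda>x :: real^'n. of_real (exp (- (norm x)\<^sup>2)) :: complex"
  have sm: "?g \<in> smooth_space" by (rule Schwartz_smooth[OF gaussian_Schwartz])
  have "?g \<in> B_space" by (intro B_dot_B Schwartz_B_dot gaussian_Schwartz)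
  then obtain C where C: "\<And>x. jet k ?g x \<le> C" unfolding B_space_iff by blast
  have "norm (partials is (\<lambda>x. of_real (cutoff j x)) x) \<le> C / 2 ^ j"
    if "is \<noteq> []" "length is \<le> k" for j "is" and x :: "real^'n"
  proof -
    have "partials is (\<lambda>x. of_real (cutoff j x)) x = of_real ((1 / 2 ^ j) ^ length is) * partials is ?g ((1 / 2 ^ j) *\<^sub>R x)"
      unfolding cutoff_def using partials_affine[OF sm, of "is" "1 / 2 ^ j" 0] by simp
    then have "norm (partials is (\<lambda>x. of_real (cutoff j x)) x) =
        norm (of_real ((1 / 2 ^ j) ^ length is) * partials is ?g ((1 / 2 ^ j) *\<^sub>R x))" by simp
    moreover have "\<bar>(1 / 2 ^ j :: real) ^ length is\<bar> = (1 / 2 ^ j) ^ length is" by simp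
    moreover have "(1 / 2 ^ j :: real) ^ length is \<le> (1 / 2 ^ j) ^ 1"
      using that(1) by (intro power_decreasing) (auto simp: Suc_le_eq)
    moreover have "norm (partials is ?g ((1 / 2 ^ j) *\<^sub>R x)) \<le> C"
      using norm_partials_le_jet[OF that(2)] C order_trans by blast
    ultimately have "norm (partials is (\<lambda>x. of_real (cutoff j x)) x) \<le> (1 / 2 ^ j) ^ 1 * C"
      using mult_mono[of "(1 / 2 ^ j) ^ length is" "(1 / 2 ^ j :: real) ^ 1"]
      unfolding norm_mult norm_of_real by simp
    then show ?thesis by simp
  qed
  moreover have "0 \<le> C" using order_trans[OF jet_nonneg C] by blast
  ultimately show ?thesis by blast
qed

lemma cutoff_smooth: "(\<lambda>x :: real^'n::finite. of_real (cutoff j x)) \<in> smooth_space"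
  and cutoff_B: "(\<lambda>x :: real^'n::finite. of_real (cutoff j x)) \<in> B_space"
  and cutoff_B_dot: "(\<lambda>x :: real^'n::finite. of_real (cutoff j x)) \<in> B_dot_space"
  using cutoff_Schwartz by (auto intro: Schwartz_smooth Schwartz_B_dot B_dot_B)

lemma jet_one_minus_cutoff:
  "\<exists>C\<ge>0. \<forall>j. \<forall>x :: real^'n::finite.
     jet k (\<lambda>x. 1 - of_real (cutoff j x)) x \<le> (1 - cutoff j x) + C / 2 ^ j"
proof -
  obtain C where C: "C \<ge> 0" "\<And>j is x. is \<noteq> [] \<Longrightarrow> length is \<le> k \<Longrightarrow>
    norm (partials is (\<lambda>x :: real^'n. of_real (cutoff j x)) x) \<le> C / 2 ^ j" using partials_cutoff_le by metis
  let ?n = "real (card {is :: 'n list. length is \<le> k})"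
  have "jet k (\<lambda>x. 1 - of_real (cutoff j x)) x \<le> (1 - cutoff j x) + ?n * C / 2 ^ j" for j and x :: "real^'n"
  proof -
    have "jet k (\<lambda>x. 1 - of_real (cutoff j x)) x \<le> norm (1 - of_real (cutoff j x) :: complex) + ?n * (C / 2 ^ j)"
      by (rule jet_le_value_plus) (use C in \<open>auto simp: partials_diff smooth_space_const cutoff_smooth partials_const\<close>)
    also have "norm (1 - of_real (cutoff j x) :: complex) = 1 - cutoff j x"
      using cutoff_le_1[of j x] norm_of_real[of "1 - cutoff j x", where 'a = complex] by simp
    finally show ?thesis by simp
  qed
  then show ?thesis using C(1) by (intro exI[of _ "?n * C"]) auto
qed

lemma jet_cutoff_diff:
  "\<exists>C\<ge>0. \<forall>i j. i \<le> j \<longrightarrow> (\<forall>x :: real^'n::finite.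
     jet k (\<lambda>x. of_real (cutoff j x) - of_real (cutoff i x)) x \<le> (cutoff j x - cutoff i x) + C / 2 ^ i)"
proof -
  obtain C where C: "C \<ge> 0" "\<And>j is x. is \<noteq> [] \<Longrightarrow> length is \<le> k \<Longrightarrow>
    norm (partials is (\<lambda>x :: real^'n. of_real (cutoff j x)) x) \<le> C / 2 ^ j" using partials_cutoff_le by metis
  let ?n = "real (card {is :: 'n list. length is \<le> k})"
  have "jet k (\<lambda>x. of_real (cutoff j x) - of_real (cutoff i x)) x \<le> (cutoff j x - cutoff i x) + ?n * (2 * C) / 2 ^ i"
    if "i \<le> j" for i j and x :: "real^'n"
  proof -
    have "C / 2 ^ j \<le> C / 2 ^ i" using C(1) that by (intro divide_left_mono power_increasing) auto
    moreover have "norm (partials is (\<lambda>x. of_real (cutoff j x) - of_real (cutoff i x)) x) \<le> C / 2 ^ j + C / 2 ^ i"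
      if "is \<noteq> []" "length is \<le> k" for "is" :: "'n list"
      using C(2)[OF that, of j x] C(2)[OF that, of i x]
        norm_triangle_ineq4[of "partials is (\<lambda>x. of_real (cutoff j x)) x" "partials is (\<lambda>x. of_real (cutoff i x)) x"]
      by (simp add: partials_diff cutoff_smooth)
    ultimately have "norm (partials is (\<lambda>x. of_real (cutoff j x) - of_real (cutoff i x)) x) \<le> 2 * C / 2 ^ i"
      if "is \<noteq> []" "length is \<le> k" for "is" :: "'n list"
      using that by (force simp: add_divide_distrib)
    then have "jet k (\<lambda>x. of_real (cutoff j x) - of_real (cutoff i x)) x \<le>
        norm (of_real (cutoff j x) - of_real (cutoff i x) :: complex) + ?n * (2 * C / 2 ^ i)"
      by (intro jet_le_value_plus) (use C(1) in auto)
    also have "norm (of_real (cutoff j x) - of_real (cutoff i x) :: complex) = cutoff j x - cutoff i x"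
      using cutoff_mono[OF that, of x] norm_of_real[of "cutoff j x - cutoff i x", where 'a = complex] by simp
    finally show ?thesis by simp
  qed
  then show ?thesis using C(1) by (intro exI[of _ "?n * (2 * C)"]) auto
qed

lemma jet_cutoff_bounded:
  "\<exists>C\<ge>0. \<forall>j. \<forall>x :: real^'n::finite. jet k (\<lambda>x. of_real (cutoff j x)) x \<le> C"
proof -
  obtain C where C: "C \<ge> 0" "\<And>j is x. is \<noteq> [] \<Longrightarrow> length is \<le> k \<Longrightarrow>
    norm (partials is (\<lambda>x :: real^'n. of_real (cutoff j x)) x) \<le> C / 2 ^ j" using partials_cutoff_le by metis
  let ?n = "real (card {is :: 'n list. length is \<le> k})"
  have "jet k (\<lambda>x. of_real (cutoff j x)) x \<le> 1 + ?n * C" for j and x :: "real^'n"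
  proof -
    have "C / 2 ^ j \<le> C / 1" using C(1) by (intro divide_left_mono) auto
    then have "norm (partials is (\<lambda>x. of_real (cutoff j x)) x) \<le> C"
      if "is \<noteq> []" "length is \<le> k" for "is" :: "'n list"
      using C(2)[OF that, of j x] by linarith
    then have "jet k (\<lambda>x. of_real (cutoff j x)) x \<le> norm (of_real (cutoff j x) :: complex) + ?n * C"
      by (rule jet_le_value_plus) (use C(1) in auto)
    then show ?thesis using cutoff_le_1[of j x] by simp
  qed
  then show ?thesis using C(1) by (intro exI[of _ "1 + ?n * C"]) auto
qed

section \<open>Continuity with respect to seminorms\<close>

lemma seminorm_topology_nbhd:
  assumes "openin (seminorm_topology V P) U" "\<phi> \<in> U"
    and tri: "\<And>p f g. p \<in> P \<Longrightarrow> f \<in> V \<Longrightarrow> g \<in> V \<Longrightarrow> p (\<lambda>x. f x + g x) \<le> p f + p g"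
    and diff: "\<And>f g. f \<in> V \<Longrightarrow> g \<in> V \<Longrightarrow> (\<lambda>x. f x - g x) \<in> V"
  shows "\<exists>F \<epsilon>. finite F \<and> F \<subseteq> P \<and> 0 < \<epsilon> \<and> {\<psi> \<in> V. \<forall>p\<in>F. p (\<lambda>x. \<psi> x - \<phi> x) < \<epsilon>} \<subseteq> U"
proof -
  have "generate_topology_on
     (insert V {{\<psi> \<in> V. p (\<lambda>x. \<psi> x - \<phi> x) < \<epsilon>} | p \<phi> \<epsilon>. p \<in> P \<and> \<phi> \<in> V \<and> 0 < \<epsilon>}) U"
    using assms(1) unfolding seminorm_topology_def openin_topology_generated_by_iff .
  then show ?thesis using assms(2)
  proof induction
    case Empty
    then show ?case by simp
  next
    case (Int a b)
    then obtain F \<epsilon> where F: "finite F" "F \<subseteq> P" "0 < \<epsilon>" "{\<psi> \<in> V. \<forall>p\<in>F. p (\<lambda>x. \<psi> x - \<phi> x) < \<epsilon>} \<subseteq> a"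
      by auto
    from Int obtain G \<delta> where G: "finite G" "G \<subseteq> P" "0 < \<delta>" "{\<psi> \<in> V. \<forall>p\<in>G. p (\<lambda>x. \<psi> x - \<phi> x) < \<delta>} \<subseteq> b"
      by auto
    from F G have "{\<psi> \<in> V. \<forall>p\<in>F \<union> G. p (\<lambda>x. \<psi> x - \<phi> x) < min \<epsilon> \<delta>} \<subseteq> a \<inter> b" by auto
    with F G show ?case
      by (intro exI[of _ "F \<union> G"] exI[of _ "min \<epsilon> \<delta>"]) simp
  next
    case (UN K)
    then show ?case by (meson Union_iff subset_iff)
  next
    case (Basis s)
    show ?case
    proof (cases "s = V")
      case True
      then show ?thesis by (intro exI[of _ "{}"] exI[of _ 1]) auto
    next
      case False
      then obtain p h \<epsilon> where s: "s = {\<psi> \<in> V. p (\<lambda>x. \<psi> x - h x) < \<epsilon>}" "p \<in> P" "h \<in> V" "0 < \<epsilon>"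
        using Basis by blast
      have \<phi>: "\<phi> \<in> V" "p (\<lambda>x. \<phi> x - h x) < \<epsilon>" using Basis s by auto
      have "p (\<lambda>x. \<psi> x - h x) \<le> p (\<lambda>x. \<psi> x - \<phi> x) + p (\<lambda>x. \<phi> x - h x)" if "\<psi> \<in> V" for \<psi>
        using tri[OF s(2) diff[OF that \<phi>(1)] diff[OF \<phi>(1) s(3)]] by simp
      then show ?thesis
        using s \<phi> by (intro exI[of _ "{p}"] exI[of _ "\<epsilon> - p (\<lambda>x. \<phi> x - h x)"]) force
    qed
  qed
qed

lemma linear_form_on_cmult: "linear_form_on V u \<Longrightarrow> f \<in> V \<Longrightarrow> u (\<lambda>x. c * f x) = c * u f"
  by (simp add: linear_form_on_def)

lemma linear_form_on_add: "linear_form_on V u \<Longrightarrow> f \<in> V \<Longrightarrow> g \<in> V \<Longrightarrow> u (\<lambda>x. f x + g x) = u f + u g"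
  by (simp add: linear_form_on_def)

lemma linear_form_on_diff:
  assumes "linear_form_on V u" "f \<in> V" "g \<in> V" "(\<lambda>x. (-1) * g x) \<in> V"
  shows "u (\<lambda>x. f x - g x) = u f - u g"
proof -
  have "u (\<lambda>x. f x + (-1) * g x) = u f + u (\<lambda>x. (-1) * g x)"
    by (rule linear_form_on_add[OF assms(1,2,4)])
  also have "u (\<lambda>x. (-1) * g x) = - u g" using linear_form_on_cmult[OF assms(1,3), of "-1"] by simp
  finally show ?thesis by simp
qed

lemma continuous_map_seminorm_topology:
  assumes lin: "linear_form_on V u" and sub: "\<And>f c. f \<in> V \<Longrightarrow> (\<lambda>x. c * f x) \<in> V"
    and diff: "\<And>f g. f \<in> V \<Longrightarrow> g \<in> V \<Longrightarrow> (\<lambda>x. f x - g x) \<in> V"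
    and p: "p \<in> P" "p (\<lambda>x. 0) = 0" and bd: "\<And>f. f \<in> V \<Longrightarrow> norm (u f) \<le> C * p f" and C: "0 \<le> C"
  shows "continuous_map (seminorm_topology V P) euclidean u"
  unfolding continuous_map_def
proof (intro conjI allI impI)
  show "u \<in> topspace (seminorm_topology V P) \<rightarrow> topspace euclidean" by simp
  fix U :: "complex set" assume "openin euclidean U"
  then have U: "open U" by simp
  show "openin (seminorm_topology V P) {x \<in> topspace (seminorm_topology V P). u x \<in> U}"
  proof (subst openin_subopen, intro ballI)
    fix f assume "f \<in> {x \<in> topspace (seminorm_topology V P). u x \<in> U}"
    then have f: "f \<in> V" "u f \<in> U" by auto
    then obtain e where e: "e > 0" "ball (u f) e \<subseteq> U" using U openE by blast
    let ?T = "{g \<in> V. p (\<lambda>x. g x - f x) < e / (C + 1)}"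
    have "openin (seminorm_topology V P) ?T"
      using p f e C by (intro openin_seminorm_topology_ball) auto
    moreover have "f \<in> ?T" using f e C p by simp
    moreover have "u g \<in> U" if "g \<in> ?T" for g
    proof -
      have g: "g \<in> V" "p (\<lambda>x. g x - f x) < e / (C + 1)" using that by auto
      have "norm (u g - u f) = norm (u (\<lambda>x. g x - f x))"
        using linear_form_on_diff[OF lin g(1) f(1) sub[OF f(1)]] by simp
      also have "\<dots> \<le> C * p (\<lambda>x. g x - f x)" by (rule bd[OF diff[OF g(1) f(1)]])
      also have "\<dots> \<le> C * (e / (C + 1))" using g C by (intro mult_left_mono) auto
      also have "\<dots> < e" using C e by (simp add: field_simps)
      finally show ?thesis using e by (auto simp: dist_norm norm_minus_commute)
    qed
    ultimately show "\<exists>T. openin (seminorm_topology V P) T \<and> f \<in> T \<and> T \<subseteq> {x \<in> topspace (seminorm_topology V P). u x \<in> U}"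
      by (intro exI[of _ ?T]) auto
  qed
qed

section \<open>Continuous forms on the space of smooth functions vanishing at infinity\<close>

text \<open>
  This says that \<open>l\<close> has norm at most \<open>A\<close> for the supremum of \<open>jet m\<close> as norm on \<open>B_dot_space\<close>. It is
  phrased with an arbitrary bound \<open>M\<close> of the jet, so that no supremum has to be formed.
\<close>

definition form_bound :: "nat \<Rightarrow> real \<Rightarrow> 'n::finite form \<Rightarrow> bool" where
  "form_bound m A l \<longleftrightarrow> linear_form_on B_dot_space l \<and> 0 \<le> A \<and>
     (\<forall>\<psi>\<in>B_dot_space. \<forall>M. (\<forall>x. jet m \<psi> x \<le> M) \<longrightarrow> norm (l \<psi>) \<le> A * M)"

lemma form_boundD: "form_bound m A l \<Longrightarrow> \<psi> \<in> B_dot_space \<Longrightarrow> (\<And>x. jet m \<psi> x \<le> M) \<Longrightarrow> norm (l \<psi>) \<le> A * M"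
  and form_bound_nonneg: "form_bound m A l \<Longrightarrow> 0 \<le> A"
  and form_add: "form_bound m A l \<Longrightarrow> f \<in> B_dot_space \<Longrightarrow> g \<in> B_dot_space \<Longrightarrow> l (\<lambda>x. f x + g x) = l f + l g"
  and form_cmult: "form_bound m A l \<Longrightarrow> f \<in> B_dot_space \<Longrightarrow> l (\<lambda>x. c * f x) = c * l f"
  by (auto simp: form_bound_def linear_form_on_def)

lemma form_diff:
  "form_bound m A l \<Longrightarrow> f \<in> B_dot_space \<Longrightarrow> g \<in> B_dot_space \<Longrightarrow> l (\<lambda>x. f x - g x) = l f - l g"
  by (rule linear_form_on_diff[of B_dot_space]) (auto simp: form_bound_def dest: B_dot_space_cmult[of _ "-1"])

lemma form_sum:
  assumes "form_bound m A l" "finite T" "\<And>t. t \<in> T \<Longrightarrow> f t \<in> B_dot_space"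
  shows "l (\<lambda>x. \<Sum>t\<in>T. f t x) = (\<Sum>t\<in>T. l (f t))"
  using assms(2,3)
proof (induction rule: finite_induct)
  case empty
  have "l (\<lambda>x. 0 * 0) = 0 * l (\<lambda>x. 0)"
    using form_cmult[OF assms(1), of "\<lambda>x. 0" 0] B_dot_space_sum[of "{}"] by simp
  then show ?case by simp
next
  case (insert t T)
  then show ?case by (simp add: form_add[OF assms(1)] B_dot_space_sum)
qed

lemma bdd_above_B_dot: "f \<in> B_dot_space \<Longrightarrow> bdd_above (range (\<lambda>x. norm (partials is f x)))"
  by (auto simp: B_dot_space_def B_space_def bounded_iff bdd_above_def)

lemma norm_partials_le_sup_seminorm:
  "f \<in> B_dot_space \<Longrightarrow> norm (partials is f x) \<le> sup_seminorm is f"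
  unfolding sup_seminorm_def by (rule cSUP_upper[OF _ bdd_above_B_dot]) auto

lemma sup_seminorm_add:
  assumes "f \<in> B_dot_space" "g \<in> B_dot_space"
  shows "sup_seminorm is (\<lambda>x. f x + g x) \<le> sup_seminorm is f + sup_seminorm is g"
  unfolding sup_seminorm_def[of _ "\<lambda>x. f x + g x"]
proof (rule cSUP_least)
  fix x
  have "norm (partials is (\<lambda>x. f x + g x) x) \<le> norm (partials is f x) + norm (partials is g x)"
    using assms by (simp add: partials_add B_dot_smooth norm_triangle_ineq)
  also have "\<dots> \<le> sup_seminorm is f + sup_seminorm is g"
    using assms by (intro add_mono norm_partials_le_sup_seminorm)
  finally show "norm (partials is (\<lambda>x. f x + g x) x) \<le> sup_seminorm is f + sup_seminorm is g" .
qed simp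

text \<open>
  A neighbourhood of \<open>0\<close> involves finitely many seminorms only; \<open>m\<close> is the largest order among them.
\<close>

lemma B_dot_dual_form_bound:
  fixes l :: "'n::finite form"
  assumes "l \<in> B_dot_dual"
  shows "\<exists>m A. form_bound m A l"
proof -
  have lin: "linear_form_on B_dot_space l" and cont: "continuous_map B_dot_topology euclidean l"
    using assms by (auto simp: B_dot_dual_def)
  have zero: "(\<lambda>x. 0) \<in> (B_dot_space :: (real^'n \<Rightarrow> complex) set)" using B_dot_space_sum[of "{}"] by simp
  from linear_form_on_cmult[OF lin this, of 0] have l0: "l (\<lambda>x. 0) = 0" by simp
  let ?U = "{x \<in> topspace B_dot_topology. l x \<in> ball 0 1}"
  have "openin euclidean (ball (0 :: complex) 1)" by simp
  with cont have "openin B_dot_topology ?U" unfolding continuous_map_def by blast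
  moreover have "(\<lambda>x. 0) \<in> ?U" using zero l0 by (simp add: B_dot_topology_def)
  ultimately have "\<exists>F \<epsilon>. finite F \<and> F \<subseteq> range sup_seminorm \<and> 0 < \<epsilon> \<and>
    {\<psi> \<in> B_dot_space. \<forall>p\<in>F. p (\<lambda>x. \<psi> x - 0) < \<epsilon>} \<subseteq> ?U"
    unfolding B_dot_topology_def
    by (rule seminorm_topology_nbhd) (auto intro: sup_seminorm_add B_dot_space_diff)
  then obtain F \<epsilon> where F: "finite F" "F \<subseteq> range sup_seminorm" "0 < \<epsilon>"
    "{\<psi> \<in> B_dot_space. \<forall>p\<in>F. p (\<lambda>x. \<psi> x - 0) < \<epsilon>} \<subseteq> ?U" by blast
  obtain I where I: "finite I" "F = sup_seminorm ` I"
    using finite_subset_image[OF F(1,2)] by blast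
  define m where "m = Max (insert 0 (length ` I))"
  have m: "length is \<le> m" if "is \<in> I" for "is" using I that by (simp add: m_def)
  have small: "norm (l \<psi>) < 1" if \<psi>: "\<psi> \<in> B_dot_space" and small_jet: "\<And>x. jet m \<psi> x \<le> \<epsilon> / 2" for \<psi>
  proof -
    have "sup_seminorm is \<psi> < \<epsilon>" if "is \<in> I" for "is"
    proof -
      have "sup_seminorm is \<psi> \<le> \<epsilon> / 2"
        unfolding sup_seminorm_def
        by (rule cSUP_least) (use order_trans[OF norm_partials_le_jet[OF m[OF that]] small_jet] in auto)
      then show ?thesis using F by simp
    qed
    then have "\<psi> \<in> ?U" using F(4) I \<psi> by auto
    then show ?thesis by simp
  qed
  have "norm (l \<psi>) \<le> 2 / \<epsilon> * M" if \<psi>: "\<psi> \<in> B_dot_space" and M: "\<And>x. jet m \<psi> x \<le> M" for \<psi> M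
  proof (rule field_le_epsilon)
    fix e :: real assume e: "e > 0"
    \<comment> \<open>\<open>M\<close> itself may be \<open>0\<close> and could not be divided by\<close>
    define M' where "M' = M + e * \<epsilon> / 2"
    have M': "M' > 0" "M \<le> M'" using order_trans[OF jet_nonneg M] e F by (auto simp: M'_def add_nonneg_pos)
    \<comment> \<open>the factor that scales \<open>\<psi>\<close> into the neighbourhood of \<open>0\<close>\<close>
    define t where "t = \<epsilon> / (2 * M')"
    have t: "t > 0" using M' F by (simp add: t_def)
    have "norm (l (\<lambda>x. of_real t * \<psi> x)) < 1"
    proof (rule small)
      show "(\<lambda>x. of_real t * \<psi> x) \<in> B_dot_space" by (rule B_dot_space_cmult[OF \<psi>])
      have "t * jet m \<psi> x \<le> t * M'" for x using M[of x] M' t by (intro mult_left_mono) auto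
      then show "jet m (\<lambda>x. of_real t * \<psi> x) x \<le> \<epsilon> / 2" for x
        using t M' by (simp only: jet_cmult[OF B_dot_smooth[OF \<psi>]] norm_of_real) (use F in \<open>simp add: t_def\<close>)
    qed
    moreover have "l (\<lambda>x. of_real t * \<psi> x) = of_real t * l \<psi>"
      by (rule linear_form_on_cmult[OF lin \<psi>])
    ultimately have "t * norm (l \<psi>) < 1" using t by (simp add: norm_mult)
    then have "norm (l \<psi>) < 2 / \<epsilon> * M'" using F M' by (simp add: t_def field_simps)
    also have "\<dots> = 2 / \<epsilon> * M + e" using F by (simp add: M'_def field_simps)
    finally show "norm (l \<psi>) \<le> 2 / \<epsilon> * M + e" by simp
  qed
  then show ?thesis
    using lin F unfolding form_bound_def by (intro exI[of _ m] exI[of _ "2 / \<epsilon>"]) auto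
qed

text \<open>
  Multiplying each function by a unimodular constant turns the sum of the absolute values into one value.
\<close>

lemma form_bound_sum_norm:
  assumes l: "form_bound m A l" and T: "finite T" "\<And>t. t \<in> T \<Longrightarrow> f t \<in> B_dot_space"
    and M: "\<And>x. (\<Sum>t\<in>T. jet m (f t) x) \<le> M"
  shows "(\<Sum>t\<in>T. norm (l (f t))) \<le> A * M"
proof -
  define c where "c t = cnj (sgn (l (f t)))" for t
  have c: "norm (c t) \<le> 1" "c t * l (f t) = of_real (norm (l (f t)))" for t
  proof -
    show "norm (c t) \<le> 1" by (simp add: c_def norm_sgn)
    have "cnj (sgn z) * z = of_real (norm z)" for z :: complex
    proof (cases "z = 0")
      case False
      have "cnj (sgn z) * z = (z * cnj z) / of_real (norm z)" by (simp add: sgn_eq)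
      also have "z * cnj z = of_real (norm z) * of_real (norm z)"
        by (simp add: complex_norm_square[symmetric] power2_eq_square)
      finally show ?thesis using False by simp
    qed simp
    then show "c t * l (f t) = of_real (norm (l (f t)))" by (simp add: c_def)
  qed
  have dot: "(\<lambda>x. c t * f t x) \<in> B_dot_space" if "t \<in> T" for t
    by (rule B_dot_space_cmult[OF T(2)[OF that]])
  have "of_real (\<Sum>t\<in>T. norm (l (f t))) = (\<Sum>t\<in>T. c t * l (f t))" by (simp add: c)
  also have "\<dots> = (\<Sum>t\<in>T. l (\<lambda>x. c t * f t x))"
    by (rule sum.cong) (auto simp: form_cmult[OF l T(2)])
  also have "\<dots> = l (\<lambda>x. \<Sum>t\<in>T. c t * f t x)"
    by (rule form_sum[OF l T(1) dot, symmetric])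
  finally have "of_real (\<Sum>t\<in>T. norm (l (f t))) = l (\<lambda>x. \<Sum>t\<in>T. c t * f t x)" .
  then have "\<bar>\<Sum>t\<in>T. norm (l (f t))\<bar> = norm (l (\<lambda>x. \<Sum>t\<in>T. c t * f t x))" by (metis norm_of_real)
  also have "\<dots> \<le> A * M"
  proof (rule form_boundD[OF l])
    show "(\<lambda>x. \<Sum>t\<in>T. c t * f t x) \<in> B_dot_space" by (rule B_dot_space_sum[OF T(1) dot])
    fix x
    have "jet m (\<lambda>x. \<Sum>t\<in>T. c t * f t x) x \<le> (\<Sum>t\<in>T. jet m (\<lambda>x. c t * f t x) x)"
      by (rule jet_sum[OF T(1) B_dot_smooth[OF dot]])
    also have "\<dots> \<le> (\<Sum>t\<in>T. jet m (f t) x)"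
      by (rule sum_mono) (use c(1) in \<open>auto simp: jet_cmult T B_dot_smooth intro: mult_left_le_one_le\<close>)
    finally show "jet m (\<lambda>x. \<Sum>t\<in>T. c t * f t x) x \<le> M" using M[of x] by linarith
  qed
  finally show ?thesis by linarith
qed

section \<open>Forms are concentrated on compact sets\<close>

text \<open>
  Outside a large ball the jet of \<open>\<psi>\<close> is small; inside it \<open>1 - cutoff k\<close> and its derivatives are.
\<close>

lemma jet_cutoff_approx:
  fixes \<psi> :: "real^'n::finite \<Rightarrow> complex"
  assumes \<psi>: "\<psi> \<in> B_dot_space" and e: "e > 0"
  shows "\<exists>K. \<forall>k\<ge>K. \<forall>x. jet m (\<lambda>x. (1 - of_real (cutoff k x)) * \<psi> x) x \<le> e"
proof -
  let ?L = "leibniz_const TYPE('n) m"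
  obtain C where C: "C \<ge> 0" "\<And>j x. jet m (\<lambda>x :: real^'n. 1 - of_real (cutoff j x)) x \<le> (1 - cutoff j x) + C / 2 ^ j"
    using jet_one_minus_cutoff[of m] by blast
  obtain D where D: "\<And>x. jet m \<psi> x \<le> D" using B_dot_B[OF \<psi>] unfolding B_space_iff by blast
  have D0: "D \<ge> 0" using order_trans[OF jet_nonneg D] .
  define \<delta> where "\<delta> = e / (?L * (1 + C) + 1)"
  have d: "\<delta> > 0" using e C by (simp add: \<delta>_def add_nonneg_pos)
  have "(jet m \<psi> \<longlongrightarrow> 0) at_infinity" using \<psi> by (simp add: B_dot_space_iff)
  from tendstoD[OF this d] obtain R where R: "\<And>x. norm x \<ge> R \<Longrightarrow> norm (jet m \<psi> x) < \<delta>"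
    unfolding eventually_at_infinity by auto
  have "(\<lambda>k. (?L * (R\<^sup>2 + C) * D) / 2 ^ k) \<longlonglongrightarrow> 0"
    by (rule LIMSEQ_divide_realpow_zero) simp
  from order_tendstoD(2)[OF this e] obtain K where K: "\<And>k. k \<ge> K \<Longrightarrow> (?L * (R\<^sup>2 + C) * D) / 2 ^ k < e"
    unfolding eventually_sequentially by blast
  have "jet m (\<lambda>x. (1 - of_real (cutoff k x)) * \<psi> x) x \<le> e" if k: "k \<ge> K" for k x
  proof -
    have "jet m (\<lambda>x. (1 - of_real (cutoff k x)) * \<psi> x) x \<le> ?L * (jet m (\<lambda>x. 1 - of_real (cutoff k x)) x * jet m \<psi> x)"
      by (intro jet_mult smooth_space_diff smooth_space_const cutoff_smooth B_dot_smooth[OF \<psi>])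
    also have "\<dots> \<le> ?L * (((1 - cutoff k x) + C / 2 ^ k) * jet m \<psi> x)"
      by (intro mult_left_mono mult_right_mono C) auto
    also have "\<dots> \<le> e"
    proof (cases "norm x \<ge> R")
      case True
      have "C / 2 ^ k \<le> C / 1" using C by (intro divide_left_mono) auto
      then have "(1 - cutoff k x) + C / 2 ^ k \<le> 1 + C" using cutoff_nonneg[of k x] by (simp del: cutoff_nonneg)
      then have "((1 - cutoff k x) + C / 2 ^ k) * jet m \<psi> x \<le> (1 + C) * \<delta>"
        using R[OF True] C by (intro mult_mono) auto
      then have "?L * (((1 - cutoff k x) + C / 2 ^ k) * jet m \<psi> x) \<le> ?L * ((1 + C) * \<delta>)"
        by (intro mult_left_mono) auto
      also have "\<dots> = (?L * (1 + C)) * \<delta>" by simp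
      also have "\<dots> \<le> (?L * (1 + C) + 1) * \<delta>" using d by (intro mult_right_mono) auto
      also have "\<dots> = e"
      proof -
        have "?L * (1 + C) + 1 \<noteq> 0"
          using C leibniz_const_nonneg[of "TYPE('n)" m] mult_nonneg_nonneg[of ?L "1 + C"] by linarith
        then show ?thesis by (simp add: \<delta>_def)
      qed
      finally show ?thesis .
    next
      case False
      then have "(norm x)\<^sup>2 \<le> R\<^sup>2" by (intro power_mono) auto
      then have "(norm x)\<^sup>2 / 2 ^ k \<le> R\<^sup>2 / 2 ^ k" by (intro divide_right_mono) auto
      then have "(1 - cutoff k x) + C / 2 ^ k \<le> (R\<^sup>2 + C) / 2 ^ k"
        using one_minus_cutoff_le[of k x] by (simp add: add_divide_distrib)
      then have "((1 - cutoff k x) + C / 2 ^ k) * jet m \<psi> x \<le> ((R\<^sup>2 + C) / 2 ^ k) * D"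
        using C D[of x] by (intro mult_mono) auto
      then have "?L * (((1 - cutoff k x) + C / 2 ^ k) * jet m \<psi> x) \<le> ?L * (((R\<^sup>2 + C) / 2 ^ k) * D)"
        by (intro mult_left_mono) auto
      also have "\<dots> = (?L * (R\<^sup>2 + C) * D) / 2 ^ k" by simp
      also have "\<dots> \<le> e" using K[OF k] by simp
      finally show ?thesis .
    qed
    finally show ?thesis .
  qed
  then show ?thesis by blast
qed

lemma cutoff_mult_B_dot: "\<phi> \<in> B_space \<Longrightarrow> (\<lambda>x. of_real (cutoff j x) * \<phi> x) \<in> B_dot_space"
  using B_dot_space_mult[OF _ cutoff_B_dot, of \<phi> j] by (simp add: mult.commute)

lemma one_minus_cutoff_mult_B_dot:
  "\<psi> \<in> B_dot_space \<Longrightarrow> (\<lambda>x. (1 - of_real (cutoff j x)) * \<psi> x) \<in> B_dot_space"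
  by (intro B_dot_space_mult B_space_diff B_space_const cutoff_B)

lemma form_cutoff_tendsto:
  assumes l: "form_bound m A l" and \<psi>: "\<psi> \<in> B_dot_space"
  shows "(\<lambda>k. l (\<lambda>x. of_real (cutoff k x) * \<psi> x)) \<longlonglongrightarrow> l \<psi>"
proof (rule LIMSEQ_I)
  fix r :: real assume r: "r > 0"
  have A: "0 \<le> A" by (rule form_bound_nonneg[OF l])
  obtain K where K: "\<And>k x. k \<ge> K \<Longrightarrow> jet m (\<lambda>x. (1 - of_real (cutoff k x)) * \<psi> x) x \<le> r / (A + 1)"
    using jet_cutoff_approx[OF \<psi>, of "r / (A + 1)" m] r A by auto
  have "norm (l (\<lambda>x. of_real (cutoff k x) * \<psi> x) - l \<psi>) < r" if "k \<ge> K" for k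
  proof -
    have "l \<psi> - l (\<lambda>x. of_real (cutoff k x) * \<psi> x) = l (\<lambda>x. \<psi> x - of_real (cutoff k x) * \<psi> x)"
      by (rule form_diff[OF l \<psi> cutoff_mult_B_dot[OF B_dot_B[OF \<psi>]], symmetric])
    also have "(\<lambda>x. \<psi> x - of_real (cutoff k x) * \<psi> x) = (\<lambda>x. (1 - of_real (cutoff k x)) * \<psi> x)"
      by (simp add: algebra_simps)
    finally have "norm (l \<psi> - l (\<lambda>x. of_real (cutoff k x) * \<psi> x)) \<le> A * (r / (A + 1))"
      using form_boundD[OF l one_minus_cutoff_mult_B_dot[OF \<psi>] K[OF that]] by simp
    also have "\<dots> < r" using A r by (simp add: field_simps)
    finally show ?thesis by (simp add: norm_minus_commute)
  qed
  then show "\<exists>no. \<forall>n\<ge>no. norm (l (\<lambda>x. of_real (cutoff n x) * \<psi> x) - l \<psi>) < r" by blast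
qed

text \<open>
  The humps \<open>(cutoff (b i) - cutoff (a i)) \<cdot> \<psi> i\<close> live on successive shells. Although they overlap,
  the jets of all of them together add up to a bounded function, because the differences telescope
  and their derivatives form a geometric series. So the values of \<open>l\<close> on them are summable.
\<close>

lemma form_gliding_hump_bound:
  fixes l :: "'n::finite form"
  assumes l: "form_bound m A l"
  shows "\<exists>C. \<forall>N a b \<psi>. (\<forall>i. i \<le> a i \<and> a i \<le> b i \<and> b i \<le> a (Suc i)) \<and>
      (\<forall>i. \<psi> i \<in> B_dot_space \<and> (\<forall>x. jet m (\<psi> i) x \<le> 1)) \<longrightarrow>
      (\<Sum>i<N. norm (l (\<lambda>x. (of_real (cutoff (b i) x) - of_real (cutoff (a i) x)) * \<psi> i x))) \<le> C"
proof -
  let ?L = "leibniz_const TYPE('n) m"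
  obtain C where C: "C \<ge> 0" "\<And>i j x. i \<le> j \<Longrightarrow>
     jet m (\<lambda>x :: real^'n. of_real (cutoff j x) - of_real (cutoff i x)) x \<le> (cutoff j x - cutoff i x) + C / 2 ^ i"
    using jet_cutoff_diff[of m] by blast
  have "(\<Sum>i<N. norm (l (\<lambda>x. (of_real (cutoff (b i) x) - of_real (cutoff (a i) x)) * \<psi> i x))) \<le> A * (?L * (1 + 2 * C))"
    if ab: "\<And>i :: nat. i \<le> a i \<and> a i \<le> b i \<and> b i \<le> a (Suc i)"
      and \<psi>: "\<And>i. \<psi> i \<in> B_dot_space" "\<And>i x. jet m (\<psi> i) x \<le> 1" for N a b \<psi>
  proof (rule form_bound_sum_norm[OF l])
    let ?D = "\<lambda>i x. of_real (cutoff (b i) x) - of_real (cutoff (a i) x) :: complex"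
    show "(\<lambda>x. ?D i x * \<psi> i x) \<in> B_dot_space" for i
      by (intro B_dot_space_mult B_space_diff cutoff_B \<psi>)
    fix x :: "real^'n"
    have tele: "(\<Sum>i<N. cutoff (b i) x - cutoff (a i) x) \<le> cutoff (a N) x"
    proof (induction N)
      case (Suc N)
      then show ?case using cutoff_mono[of "b N" "a (Suc N)" x] ab[of N] by simp
    qed simp
    have geo: "(\<Sum>i<N. C / 2 ^ a i) \<le> 2 * C"
    proof -
      have "(\<Sum>i<N. C / 2 ^ a i) \<le> (\<Sum>i<N. C * (1 / 2) ^ i)"
      proof (rule sum_mono)
        fix i
        have "C / 2 ^ a i \<le> C / 2 ^ i" using C ab[of i] by (intro divide_left_mono power_increasing) auto
        then show "C / 2 ^ a i \<le> C * (1 / 2) ^ i" by (simp add: power_divide)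
      qed
      also have "\<dots> = C * (\<Sum>i<N. (1 / 2) ^ i)" by (simp add: sum_distrib_left)
      also have "\<dots> \<le> C * 2"
      proof (rule mult_left_mono[OF _ C(1)])
        have "(\<Sum>i<N. (1 / 2 :: real) ^ i) = 2 - 2 * (1 / 2) ^ N" by (induction N) auto
        then show "(\<Sum>i<N. (1 / 2 :: real) ^ i) \<le> 2" by simp
      qed
      finally show ?thesis by simp
    qed
    have "(\<Sum>i<N. jet m (\<lambda>x. ?D i x * \<psi> i x) x) \<le> (\<Sum>i<N. ?L * ((cutoff (b i) x - cutoff (a i) x) + C / 2 ^ a i))"
    proof (rule sum_mono)
      fix i
      have "jet m (\<lambda>x. ?D i x * \<psi> i x) x \<le> ?L * (jet m (?D i) x * jet m (\<psi> i) x)"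
        by (intro jet_mult smooth_space_diff cutoff_smooth B_dot_smooth \<psi>)
      also have "\<dots> \<le> ?L * (jet m (?D i) x * 1)" by (intro mult_left_mono \<psi>) auto
      also have "\<dots> \<le> ?L * ((cutoff (b i) x - cutoff (a i) x) + C / 2 ^ a i)"
        using C(2)[of "a i" "b i" x] ab[of i] by (intro mult_left_mono) auto
      finally show "jet m (\<lambda>x. ?D i x * \<psi> i x) x \<le> ?L * ((cutoff (b i) x - cutoff (a i) x) + C / 2 ^ a i)" .
    qed
    also have "\<dots> = ?L * ((\<Sum>i<N. cutoff (b i) x - cutoff (a i) x) + (\<Sum>i<N. C / 2 ^ a i))"
      unfolding sum.distrib[symmetric] sum_distrib_left ..
    also have "\<dots> \<le> ?L * (1 + 2 * C)"
      using tele geo cutoff_le_1[of "a N" x] by (intro mult_left_mono) auto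
    finally show "(\<Sum>i<N. jet m (\<lambda>x. ?D i x * \<psi> i x) x) \<le> ?L * (1 + 2 * C)" .
  qed auto
  then show ?thesis by (intro exI[of _ "A * (?L * (1 + 2 * C))"]) auto
qed

text \<open>
  The tails \<open>\<psi> \<mapsto> l ((1 - cutoff j) \<cdot> \<psi>)\<close> tend to \<open>0\<close> in norm. Otherwise there would be, arbitrarily far
  out, normalised functions on which a tail is larger than \<open>\<epsilon>\<close>; cutting them off once more gives
  infinitely many humps on which \<open>l\<close> is larger than \<open>\<epsilon>\<close>, against the preceding lemma. This property
  distinguishes the dual of \<open>B_dot_space\<close>; it fails for forms on \<open>B_space\<close> that are merely bounded by
  suprema of derivatives.
\<close>

lemma form_tail:
  fixes l :: "'n::finite form"
  assumes l: "form_bound m A l" and \<epsilon>: "\<epsilon> > 0"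
  shows "\<exists>J. \<forall>j\<ge>J. form_bound m \<epsilon> (\<lambda>\<psi>. l (\<lambda>x. (1 - of_real (cutoff j x)) * \<psi> x))"
proof (rule ccontr)
  assume neg: "\<not> ?thesis"
  let ?L = "leibniz_const TYPE('n) m"
  have A: "0 \<le> A" by (rule form_bound_nonneg[OF l])
  have hump: "\<exists>j k \<psi>. J \<le> j \<and> j \<le> k \<and> \<psi> \<in> B_dot_space \<and> (\<forall>x. jet m \<psi> x \<le> 1) \<and>
    \<epsilon> < norm (l (\<lambda>x. (of_real (cutoff k x) - of_real (cutoff j x)) * \<psi> x))" for J
  proof -
    obtain j where j: "J \<le> j" "\<not> form_bound m \<epsilon> (\<lambda>\<psi>. l (\<lambda>x. (1 - of_real (cutoff j x)) * \<psi> x))"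
      using neg by blast
    let ?c = "\<lambda>x :: real^'n. 1 - of_real (cutoff j x) :: complex"
    have "linear_form_on B_dot_space (\<lambda>\<psi>. l (\<lambda>x. ?c x * \<psi> x))"
      unfolding linear_form_on_def
    proof (intro conjI ballI allI)
      fix f g :: "real^'n \<Rightarrow> complex" and c assume f: "f \<in> B_dot_space"
      show "l (\<lambda>x. ?c x * (c * f x)) = c * l (\<lambda>x. ?c x * f x)"
        using form_cmult[OF l one_minus_cutoff_mult_B_dot[OF f, of j], of c] by (simp add: mult_ac)
      assume g: "g \<in> B_dot_space"
      show "l (\<lambda>x. ?c x * (f x + g x)) = l (\<lambda>x. ?c x * f x) + l (\<lambda>x. ?c x * g x)"
        using form_add[OF l one_minus_cutoff_mult_B_dot[OF f, of j] one_minus_cutoff_mult_B_dot[OF g, of j]]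
        by (simp add: distrib_left)
    qed
    then obtain \<psi> M where \<psi>: "\<psi> \<in> B_dot_space" "\<And>x. jet m \<psi> x \<le> M" "\<epsilon> * M < norm (l (\<lambda>x. ?c x * \<psi> x))"
      using j(2) \<epsilon> unfolding form_bound_def by (auto simp: not_le)
    have c\<psi>: "(\<lambda>x. ?c x * \<psi> x) \<in> B_dot_space" by (rule one_minus_cutoff_mult_B_dot[OF \<psi>(1)])
    have "M \<noteq> 0"
    proof
      assume M0: "M = 0"
      have "jet m (\<lambda>x. ?c x * \<psi> x) x \<le> 0" for x
      proof -
        have "jet m (\<lambda>x. ?c x * \<psi> x) x \<le> ?L * (jet m ?c x * jet m \<psi> x)"
          by (intro jet_mult smooth_space_diff smooth_space_const cutoff_smooth B_dot_smooth \<psi>)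
        moreover have "jet m \<psi> x = 0" using \<psi>(2)[of x] M0 by (intro antisym) auto
        ultimately show ?thesis by simp
      qed
      from form_boundD[OF l c\<psi> this] \<psi>(3) M0 show False by simp
    qed
    then have M: "M > 0" using order_trans[OF jet_nonneg \<psi>(2)] by (simp add: order_less_le)
    define \<omega> where "\<omega> x = of_real (1 / M) * \<psi> x" for x
    have \<omega>: "\<omega> \<in> B_dot_space" unfolding \<omega>_def by (rule B_dot_space_cmult[OF \<psi>(1)])
    have \<omega>1: "jet m \<omega> x \<le> 1" for x
      unfolding \<omega>_def using M \<psi>(2)[of x] by (simp only: jet_cmult[OF B_dot_smooth[OF \<psi>(1)]] norm_of_real) simp
    have "l (\<lambda>x. ?c x * \<omega> x) = of_real (1 / M) * l (\<lambda>x. ?c x * \<psi> x)"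
      using form_cmult[OF l c\<psi>, of "of_real (1 / M)"] by (simp add: \<omega>_def mult_ac)
    then have "norm (l (\<lambda>x. ?c x * \<omega> x)) = norm (l (\<lambda>x. ?c x * \<psi> x)) / M"
      using M by (simp add: norm_mult norm_divide)
    then have big: "\<epsilon> < norm (l (\<lambda>x. ?c x * \<omega> x))"
      using \<psi>(3) by (simp only: pos_less_divide_eq[OF M])
    have c\<omega>: "(\<lambda>x. ?c x * \<omega> x) \<in> B_dot_space" by (rule one_minus_cutoff_mult_B_dot[OF \<omega>])
    let ?d = "\<lambda>k x. (of_real (cutoff k x) - of_real (cutoff j x)) * \<omega> x"
    have "(\<lambda>k. l (\<lambda>x. of_real (cutoff k x) * \<omega> x) - l (\<lambda>x. of_real (cutoff j x) * \<omega> x)) \<longlonglongrightarrow> l \<omega> - l (\<lambda>x. of_real (cutoff j x) * \<omega> x)"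
      by (intro tendsto_diff form_cutoff_tendsto[OF l \<omega>] tendsto_const)
    moreover have "l (\<lambda>x. of_real (cutoff k x) * \<omega> x) - l (\<lambda>x. of_real (cutoff j x) * \<omega> x) = l (?d k)" for k
      using form_diff[OF l cutoff_mult_B_dot[OF B_dot_B[OF \<omega>], of k] cutoff_mult_B_dot[OF B_dot_B[OF \<omega>], of j]]
      by (simp add: left_diff_distrib)
    moreover have "l \<omega> - l (\<lambda>x. of_real (cutoff j x) * \<omega> x) = l (\<lambda>x. ?c x * \<omega> x)"
      using form_diff[OF l \<omega> cutoff_mult_B_dot[OF B_dot_B[OF \<omega>], of j]] by (simp add: left_diff_distrib)
    ultimately have "(\<lambda>k. norm (l (?d k))) \<longlonglongrightarrow> norm (l (\<lambda>x. ?c x * \<omega> x))" by (simp add: tendsto_norm)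
    then have "\<forall>\<^sub>F k in sequentially. \<epsilon> < norm (l (?d k))" using big by (rule order_tendstoD(1))
    then have "\<forall>\<^sub>F k in sequentially. \<epsilon> < norm (l (?d k)) \<and> j \<le> k"
      using eventually_ge_at_top[of j] by (rule eventually_conj)
    then obtain k where "\<epsilon> < norm (l (?d k))" "j \<le> k"
      by (metis (mono_tags, lifting) eventually_happens trivial_limit_sequentially)
    then show ?thesis using j(1) \<omega> \<omega>1 by blast
  qed
  define H where "H J j k \<psi> \<longleftrightarrow> J \<le> j \<and> j \<le> k \<and> \<psi> \<in> B_dot_space \<and> (\<forall>x. jet m \<psi> x \<le> 1) \<and>
    \<epsilon> < norm (l (\<lambda>x. (of_real (cutoff k x) - of_real (cutoff j x)) * \<psi> x))" for J j k \<psi>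
  have "\<forall>J. \<exists>j k \<psi>. H J j k \<psi>" unfolding H_def using hump by blast
  then obtain p q \<psi> where H: "\<And>J. H J (p J) (q J) (\<psi> J)" by metis
  have pq: "J \<le> p J" "p J \<le> q J" "\<psi> J \<in> B_dot_space" "jet m (\<psi> J) x \<le> 1"
    "\<epsilon> < norm (l (\<lambda>x. (of_real (cutoff (q J) x) - of_real (cutoff (p J) x)) * \<psi> J x))" for J x
    using H[of J] by (simp_all add: H_def)
  \<comment> \<open>start the next hump beyond the end of the current one\<close>
  define s where "s = rec_nat 0 (\<lambda>i t. max (Suc i) (q t))"
  have s: "s 0 = 0" "\<And>i. s (Suc i) = max (Suc i) (q (s i))" by (auto simp: s_def)
  have si: "i \<le> s i" for i by (cases i) (auto simp: s)
  obtain C where C: "\<And>N a b \<psi>. (\<And>i. i \<le> a i \<and> a i \<le> b i \<and> b i \<le> a (Suc i)) \<Longrightarrow>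
      (\<And>i. \<psi> i \<in> B_dot_space \<and> (\<forall>x. jet m (\<psi> i) x \<le> 1)) \<Longrightarrow>
      (\<Sum>i<N. norm (l (\<lambda>x. (of_real (cutoff (b i) x) - of_real (cutoff (a i) x)) * \<psi> i x))) \<le> C"
    using form_gliding_hump_bound[OF l] by blast
  have le: "(\<Sum>i<N. norm (l (\<lambda>x. (of_real (cutoff (q (s i)) x) - of_real (cutoff (p (s i)) x)) * \<psi> (s i) x))) \<le> C" for N
  proof (rule C)
    fix i
    have "q (s i) \<le> p (s (Suc i))" using pq(1)[of "s (Suc i)"] by (simp add: s)
    then show "i \<le> p (s i) \<and> p (s i) \<le> q (s i) \<and> q (s i) \<le> p (s (Suc i))"
      using si[of i] pq(1)[of "s i"] pq(2)[of "s i"] by linarith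
  qed (use pq in auto)
  obtain N :: nat where N: "C / \<epsilon> < N" using reals_Archimedean2 by blast
  have "(\<Sum>i<N. \<epsilon>) \<le> (\<Sum>i<N. norm (l (\<lambda>x. (of_real (cutoff (q (s i)) x) - of_real (cutoff (p (s i)) x)) * \<psi> (s i) x)))"
    by (rule sum_mono) (use pq(5) in \<open>simp add: less_imp_le\<close>)
  then have "real N * \<epsilon> \<le> C" using le[of N] by simp
  with N \<epsilon> show False by (simp add: field_simps)
qed

text \<open>
  Hence \<open>l (cutoff j \<cdot> \<phi>)\<close> converges for every bounded smooth \<open>\<phi>\<close>, at a rate that depends on the bounds
  of \<open>\<phi>\<close> only. The limit is the extension of \<open>l\<close> to \<open>B_space\<close>.
\<close>

definition form_extension :: "'n::finite form \<Rightarrow> 'n form" where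
  "form_extension l \<phi> = lim (\<lambda>j. l (\<lambda>x. of_real (cutoff j x) * \<phi> x))"

text \<open>
  The tail estimate applies to functions of \<open>B_dot_space\<close> only. It is used for \<open>cutoff k \<cdot> \<phi>\<close>, whose jets are
  bounded uniformly in \<open>k\<close>, and then \<open>k\<close> tends to infinity.
\<close>

lemma form_cutoff_Cauchy:
  fixes l :: "'n::finite form"
  assumes l: "form_bound m A l" and \<epsilon>: "\<epsilon> > 0"
  shows "\<exists>J. \<forall>i\<ge>J. \<forall>j\<ge>J. \<forall>\<phi>\<in>B_space. \<forall>M. (\<forall>x. jet m \<phi> x \<le> M) \<longrightarrow>
    norm (l (\<lambda>x. of_real (cutoff i x) * \<phi> x) - l (\<lambda>x. of_real (cutoff j x) * \<phi> x)) \<le> \<epsilon> * M"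
proof -
  let ?L = "leibniz_const TYPE('n) m"
  obtain C where C: "C \<ge> 0" "\<And>j x. jet m (\<lambda>x :: real^'n. of_real (cutoff j x)) x \<le> C"
    using jet_cutoff_bounded[of m] by blast
  define \<delta> where "\<delta> = \<epsilon> / (2 * (?L * C + 1))"
  have pos: "?L * C + 1 > 0" using C by (simp add: add_nonneg_pos)
  then have d: "\<delta> > 0" using \<epsilon> by (simp add: \<delta>_def)
  obtain J where J: "\<And>j. j \<ge> J \<Longrightarrow> form_bound m \<delta> (\<lambda>\<psi>. l (\<lambda>x. (1 - of_real (cutoff j x)) * \<psi> x))"
    using form_tail[OF l d] by blast
  have "norm (l (\<lambda>x. of_real (cutoff i x) * \<phi> x) - l (\<lambda>x. of_real (cutoff j x) * \<phi> x)) \<le> \<epsilon> * M"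
    if ij: "i \<ge> J" "j \<ge> J" and \<phi>: "\<phi> \<in> B_space" "\<And>x. jet m \<phi> x \<le> M" for i j \<phi> M
  proof -
    have M: "0 \<le> M" using order_trans[OF jet_nonneg \<phi>(2)] .
    have c\<phi>: "(\<lambda>x. of_real (cutoff j x) * \<phi> x) \<in> B_dot_space" for j by (rule cutoff_mult_B_dot[OF \<phi>(1)])
    let ?p = "\<lambda>k x. of_real (cutoff k x) * \<phi> x"
    have near: "norm (l (?p k) - l (\<lambda>x. of_real (cutoff i x) * ?p k x)) \<le> \<delta> * (?L * C * M)" if "i \<ge> J" for i k
    proof -
      have "norm (l (\<lambda>x. (1 - of_real (cutoff i x)) * ?p k x)) \<le> \<delta> * (?L * C * M)"
      proof (rule form_boundD[OF J[OF that] c\<phi>])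
        fix x
        have "jet m (?p k) x \<le> ?L * (jet m (\<lambda>x. of_real (cutoff k x)) x * jet m \<phi> x)"
          by (intro jet_mult cutoff_smooth B_smooth \<phi>)
        also have "\<dots> \<le> ?L * (C * M)" by (intro mult_left_mono mult_mono C \<phi>) auto
        finally show "jet m (?p k) x \<le> ?L * C * M" by simp
      qed
      moreover have "l (?p k) - l (\<lambda>x. of_real (cutoff i x) * ?p k x) = l (\<lambda>x. (1 - of_real (cutoff i x)) * ?p k x)"
        using form_diff[OF l c\<phi> cutoff_mult_B_dot[OF B_dot_B[OF c\<phi>]], of k i k] by (simp add: algebra_simps)
      ultimately show ?thesis by simp
    qed
    have lim: "(\<lambda>k. l (\<lambda>x. of_real (cutoff i x) * ?p k x)) \<longlonglongrightarrow> l (?p i)" for i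
      using form_cutoff_tendsto[OF l c\<phi>[of i]] by (simp add: mult_ac)
    have "norm (l (?p i) - l (?p j)) \<le> 2 * (\<delta> * (?L * C * M))"
    proof (rule LIMSEQ_le_const2)
      show "(\<lambda>k. norm (l (\<lambda>x. of_real (cutoff i x) * ?p k x) - l (\<lambda>x. of_real (cutoff j x) * ?p k x))) \<longlonglongrightarrow> norm (l (?p i) - l (?p j))"
        by (intro tendsto_norm tendsto_diff lim)
      have "norm (l (\<lambda>x. of_real (cutoff i x) * ?p k x) - l (\<lambda>x. of_real (cutoff j x) * ?p k x)) \<le> 2 * (\<delta> * (?L * C * M))" for k
        using near[OF ij(1), of k] near[OF ij(2), of k]
          norm_triangle_ineq4[of "l (?p k) - l (\<lambda>x. of_real (cutoff j x) * ?p k x)" "l (?p k) - l (\<lambda>x. of_real (cutoff i x) * ?p k x)"]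
        by simp
      then show "\<exists>N. \<forall>k\<ge>N. norm (l (\<lambda>x. of_real (cutoff i x) * ?p k x) - l (\<lambda>x. of_real (cutoff j x) * ?p k x)) \<le> 2 * (\<delta> * (?L * C * M))"
        by blast
    qed
    also have "\<dots> = (2 * \<delta> * (?L * C)) * M" by simp
    also have "2 * \<delta> * (?L * C) \<le> 2 * \<delta> * (?L * C + 1)" using d by (intro mult_left_mono) auto
    also have "\<dots> = \<epsilon>" using pos by (simp add: \<delta>_def field_simps)
    finally show ?thesis using M by (simp add: mult_right_mono)
  qed
  then show ?thesis by blast
qed

lemma form_extension_limit:
  fixes l :: "'n::finite form"
  assumes l: "form_bound m A l" and \<phi>: "\<phi> \<in> B_space"
  shows "(\<lambda>j. l (\<lambda>x. of_real (cutoff j x) * \<phi> x)) \<longlonglongrightarrow> form_extension l \<phi>"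
proof -
  obtain M where M: "\<And>x. jet m \<phi> x \<le> M" using \<phi> unfolding B_space_iff by blast
  have M0: "0 \<le> M" using order_trans[OF jet_nonneg M] .
  have "Cauchy (\<lambda>j. l (\<lambda>x. of_real (cutoff j x) * \<phi> x))"
  proof (rule CauchyI)
    fix e :: real assume e: "e > 0"
    obtain J where J: "\<And>i j. i \<ge> J \<Longrightarrow> j \<ge> J \<Longrightarrow>
        norm (l (\<lambda>x. of_real (cutoff i x) * \<phi> x) - l (\<lambda>x. of_real (cutoff j x) * \<phi> x)) \<le> (e / (M + 1)) * M"
    proof -
      have "e / (M + 1) > 0" using e M0 by simp
      from form_cutoff_Cauchy[OF l this] show ?thesis using \<phi> M that by blast
    qed
    have "(e / (M + 1)) * M < e" using e M0 by (simp add: field_simps)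
    then show "\<exists>J. \<forall>i\<ge>J. \<forall>j\<ge>J. norm (l (\<lambda>x. of_real (cutoff i x) * \<phi> x) - l (\<lambda>x. of_real (cutoff j x) * \<phi> x)) < e"
      using J by (meson le_less_trans)
  qed
  then show ?thesis
    unfolding form_extension_def Cauchy_convergent_iff convergent_LIMSEQ_iff .
qed

lemma form_extension_approx:
  fixes l :: "'n::finite form"
  assumes l: "form_bound m A l" and \<epsilon>: "\<epsilon> > 0"
  shows "\<exists>J. \<forall>j\<ge>J. \<forall>\<phi>\<in>B_space. \<forall>M. (\<forall>x. jet m \<phi> x \<le> M) \<longrightarrow>
    norm (form_extension l \<phi> - l (\<lambda>x. of_real (cutoff j x) * \<phi> x)) \<le> \<epsilon> * M"
proof -
  obtain J where J: "\<And>i j \<phi> M. i \<ge> J \<Longrightarrow> j \<ge> J \<Longrightarrow> \<phi> \<in> B_space \<Longrightarrow> (\<And>x. jet m \<phi> x \<le> M) \<Longrightarrow>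
    norm (l (\<lambda>x. of_real (cutoff i x) * \<phi> x) - l (\<lambda>x. of_real (cutoff j x) * \<phi> x)) \<le> \<epsilon> * M"
    using form_cutoff_Cauchy[OF l \<epsilon>] by blast
  have "norm (form_extension l \<phi> - l (\<lambda>x. of_real (cutoff j x) * \<phi> x)) \<le> \<epsilon> * M"
    if "j \<ge> J" "\<phi> \<in> B_space" "\<And>x. jet m \<phi> x \<le> M" for j \<phi> M
  proof (rule LIMSEQ_le_const2)
    show "(\<lambda>i. norm (l (\<lambda>x. of_real (cutoff i x) * \<phi> x) - l (\<lambda>x. of_real (cutoff j x) * \<phi> x)))
        \<longlonglongrightarrow> norm (form_extension l \<phi> - l (\<lambda>x. of_real (cutoff j x) * \<phi> x))"
      by (intro tendsto_norm tendsto_diff form_extension_limit[OF l that(2)] tendsto_const)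
    show "\<exists>N. \<forall>i\<ge>N. norm (l (\<lambda>x. of_real (cutoff i x) * \<phi> x) - l (\<lambda>x. of_real (cutoff j x) * \<phi> x)) \<le> \<epsilon> * M"
      using J that by blast
  qed
  then show ?thesis by blast
qed

section \<open>Integrating a form over a parameter\<close>

text \<open>
  On the ball of radius \<open>k + 1\<close> the measure grows like \<open>(k + 1)\<^sup>n\<close>, which leaves \<open>\<Sum> 1 / (k + 1)\<^sup>2\<close>.
\<close>

lemma integrable_inverse_power_norm:
  "integrable lborel (\<lambda>x :: real^'n::finite. 1 / (1 + norm x) ^ (CARD('n) + 2))"
proof (rule integrableI_nonneg)
  let ?n = "CARD('n)"
  let ?V = "unit_ball_vol (real ?n)"
  show "(\<lambda>x :: real^'n. 1 / (1 + norm x) ^ (?n + 2)) \<in> borel_measurable lborel" by simp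
  have pos: "0 < 1 + norm x" for x :: "real^'n" by (simp add: add_pos_nonneg)
  then show "AE x in lborel. 0 \<le> 1 / (1 + norm (x :: real^'n)) ^ (?n + 2)"
    by (simp add: less_imp_le)
  let ?g = "\<lambda>k x :: real^'n. ennreal (1 / (1 + real k) ^ (?n + 2)) * indicator (cball 0 (1 + real k)) x"
  have "(\<integral>\<^sup>+x. ennreal (1 / (1 + norm (x :: real^'n)) ^ (?n + 2)) \<partial>lborel) \<le> (\<integral>\<^sup>+x. (\<Sum>k. ?g k x) \<partial>lborel)"
  proof (rule nn_integral_mono)
    fix x :: "real^'n"
    define k where "k = nat \<lfloor>norm x\<rfloor>"
    have k: "real k \<le> norm x" "norm x \<le> 1 + real k" by (auto simp: k_def) linarith
    have "ennreal (1 / (1 + norm x) ^ (?n + 2)) \<le> ennreal (1 / (1 + real k) ^ (?n + 2))"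
      using k by (intro ennreal_leI divide_left_mono power_mono mult_pos_pos zero_less_power pos) auto
    also have "\<dots> = ?g k x" using k by simp
    also have "\<dots> = (\<Sum>j\<in>{k}. ?g j x)"
      by (simp only: sum.insert finite.emptyI empty_iff not_False_eq_True sum.empty add.right_neutral)
    also have "\<dots> \<le> (\<Sum>k. ?g k x)" by (rule sum_le_suminf) auto
    finally show "ennreal (1 / (1 + norm x) ^ (?n + 2)) \<le> (\<Sum>k. ?g k x)" .
  qed
  also have "\<dots> = (\<Sum>k. \<integral>\<^sup>+x. ?g k x \<partial>lborel)"
  proof (rule nn_integral_suminf)
    fix k :: nat
    have [measurable]: "cball (0 :: real^'n) (1 + real k) \<in> sets borel" by (simp add: borel_closed)
    show "?g k \<in> borel_measurable lborel" by measurable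
  qed
  also have "\<dots> = (\<Sum>k. ennreal (?V * (1 / (1 + real k)\<^sup>2)))"
  proof (rule suminf_cong)
    fix k
    have "(\<integral>\<^sup>+x. ?g k x \<partial>lborel) = ennreal (1 / (1 + real k) ^ (?n + 2)) * emeasure lborel (cball (0 :: real^'n) (1 + real k))"
      by (subst nn_integral_cmult_indicator) auto
    also have "\<dots> = ennreal (1 / (1 + real k) ^ (?n + 2)) * ennreal (?V * (1 + real k) ^ ?n)"
      by (subst emeasure_cball) auto
    also have "\<dots> = ennreal (1 / (1 + real k) ^ (?n + 2) * (?V * (1 + real k) ^ ?n))"
      by (rule ennreal_mult[symmetric]) auto
    also have "1 / (1 + real k) ^ (?n + 2) * (?V * (1 + real k) ^ ?n) = ?V * (1 / (1 + real k)\<^sup>2)"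
    proof -
      have "1 / a ^ (?n + 2) * (?V * a ^ ?n) = ?V * (1 / a\<^sup>2)" if "a \<noteq> 0" for a :: real
        using that by (simp add: power_add power2_eq_square)
      then show ?thesis by (simp add: add_nonneg_eq_0_iff)
    qed
    finally show "(\<integral>\<^sup>+x. ?g k x \<partial>lborel) = ennreal (?V * (1 / (1 + real k)\<^sup>2))" .
  qed
  also have "\<dots> < \<infinity>"
  proof -
    have "summable (\<lambda>k. inverse (real (Suc k) ^ 2))"
      by (subst summable_Suc_iff) (rule inverse_power_summable, simp)
    then have "summable (\<lambda>k. ?V * (1 / (1 + real k)\<^sup>2))"
      by (intro summable_mult) (simp add: divide_inverse add.commute)
    then have "(\<Sum>k. ennreal (?V * (1 / (1 + real k)\<^sup>2))) = ennreal (\<Sum>k. ?V * (1 / (1 + real k)\<^sup>2))"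
      by (intro suminf_ennreal2) auto
    then show ?thesis by simp
  qed
  finally show "(\<integral>\<^sup>+x. ennreal (1 / (1 + norm (x :: real^'n)) ^ (?n + 2)) \<partial>lborel) < \<infinity>" .
qed

text \<open>
  Continuity of \<open>\<Phi>\<close> as a map into the space of bounded smooth functions with all its seminorms.
\<close>

definition jet_continuous :: "(real^'d::finite \<Rightarrow> real^'n::finite \<Rightarrow> complex) \<Rightarrow> bool" where
  "jet_continuous \<Phi> \<longleftrightarrow> (\<forall>k z. \<forall>e>0. \<exists>d>0. \<forall>z'. dist z' z < d \<longrightarrow>
     (\<forall>x. jet k (\<lambda>x. \<Phi> z' x - \<Phi> z x) x \<le> e))"

definition tagged_partition :: "'a::topological_space set \<Rightarrow> 'a set \<Rightarrow> ('a \<Rightarrow> 'a set) \<Rightarrow> bool" where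
  "tagged_partition K T Q \<longleftrightarrow> finite T \<and> T \<subseteq> K \<and> (\<forall>t\<in>T. Q t \<in> sets borel) \<and>
     disjoint_family_on Q T \<and> (\<Union>t\<in>T. Q t) = K"

lemma finite_disjointification:
  assumes "finite T" "\<And>t. t \<in> T \<Longrightarrow> B t \<in> sets M"
  shows "\<exists>Q. (\<forall>t\<in>T. Q t \<in> sets M \<and> Q t \<subseteq> B t) \<and> disjoint_family_on Q T \<and> (\<Union>t\<in>T. Q t) = (\<Union>t\<in>T. B t)"
  using assms
proof (induction rule: finite_induct)
  case empty
  then show ?case by (auto simp: disjoint_family_on_def)
next
  case (insert a T)
  then obtain Q where Q: "\<And>t. t \<in> T \<Longrightarrow> Q t \<in> sets M" "\<And>t. t \<in> T \<Longrightarrow> Q t \<subseteq> B t"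
    "disjoint_family_on Q T" "(\<Union>t\<in>T. Q t) = (\<Union>t\<in>T. B t)" by auto
  define R where "R = Q(a := B a - (\<Union>t\<in>T. B t))"
  have R: "R a = B a - (\<Union>t\<in>T. B t)" "\<And>t. t \<in> T \<Longrightarrow> R t = Q t" using insert by (auto simp: R_def)
  have "\<forall>t\<in>insert a T. R t \<in> sets M \<and> R t \<subseteq> B t"
    using R Q insert by (auto intro!: sets.Diff sets.finite_UN)
  moreover have "disjoint_family_on R (insert a T)"
    unfolding disjoint_family_on_def
  proof (intro ballI impI)
    fix s t assume st: "s \<in> insert a T" "t \<in> insert a T" "s \<noteq> t"
    have "R u \<subseteq> (\<Union>t\<in>T. B t)" if "u \<in> T" for u using that R Q by auto
    moreover have "R s \<inter> R t = {}" if "s \<in> T" "t \<in> T"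
      using Q(3) st(3) that R unfolding disjoint_family_on_def by auto
    ultimately show "R s \<inter> R t = {}" using st R(1) by blast
  qed
  moreover have "(\<Union>t\<in>insert a T. R t) = (\<Union>t\<in>insert a T. B t)" using R Q(4) by auto
  ultimately show ?case by blast
qed

lemma jet_continuous_partition:
  assumes \<Phi>: "jet_continuous \<Phi>" and K: "compact K" and e: "e > 0"
  shows "\<exists>T Q. tagged_partition K T Q \<and>
    (\<forall>t\<in>T. \<forall>z\<in>Q t. \<forall>x. jet k (\<lambda>x. \<Phi> z x - \<Phi> t x) x \<le> e)"
proof -
  have "\<forall>z. \<exists>d>0. \<forall>z'. dist z' z < d \<longrightarrow> (\<forall>x. jet k (\<lambda>x. \<Phi> z' x - \<Phi> z x) x \<le> e)"
    using \<Phi> e unfolding jet_continuous_def by blast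
  then obtain d where d: "\<And>z. d z > 0" "\<And>z z' x. dist z' z < d z \<Longrightarrow> jet k (\<lambda>x. \<Phi> z' x - \<Phi> z x) x \<le> e"
    unfolding choice_iff by blast
  have "K \<subseteq> (\<Union>z\<in>K. ball z (d z))" using d by auto
  from compactE_image[OF K _ this] obtain T where T: "T \<subseteq> K" "finite T" "K \<subseteq> (\<Union>z\<in>T. ball z (d z))"
    by auto
  have "\<exists>Q. (\<forall>t\<in>T. Q t \<in> sets borel \<and> Q t \<subseteq> K \<inter> ball t (d t)) \<and> disjoint_family_on Q T \<and>
     (\<Union>t\<in>T. Q t) = (\<Union>t\<in>T. K \<inter> ball t (d t))"
    by (rule finite_disjointification[OF T(2)]) (intro sets.Int borel_compact K borel_open open_ball)
  then obtain Q where Q: "\<And>t. t \<in> T \<Longrightarrow> Q t \<in> sets borel" "\<And>t. t \<in> T \<Longrightarrow> Q t \<subseteq> K \<inter> ball t (d t)"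
    "disjoint_family_on Q T" "(\<Union>t\<in>T. Q t) = (\<Union>t\<in>T. K \<inter> ball t (d t))" by auto
  have "(\<Union>t\<in>T. K \<inter> ball t (d t)) = K" using T by auto
  then have "tagged_partition K T Q" using T Q by (simp add: tagged_partition_def)
  moreover have "jet k (\<lambda>x. \<Phi> z x - \<Phi> t x) x \<le> e" if "t \<in> T" "z \<in> Q t" for t z x
    using Q(2)[OF that(1)] that(2) by (intro d) (auto simp: dist_commute)
  ultimately show ?thesis by blast
qed

lemma partition_sum_approx:
  fixes F :: "'a::euclidean_space \<Rightarrow> 'b::{banach, second_countable_topology}"
  assumes P: "tagged_partition K T Q" and K: "compact K"
    and F: "integrable lborel F" and h: "integrable lborel h" "\<And>z. norm (F z) \<le> h z"
    and osc: "\<And>t z. t \<in> T \<Longrightarrow> z \<in> Q t \<Longrightarrow> norm (F z - F t) \<le> e" and e: "0 \<le> e"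
  shows "norm ((\<integral>z. F z \<partial>lborel) - (\<Sum>t\<in>T. measure lborel (Q t) *\<^sub>R F t)) \<le>
    e * measure lborel K + (\<integral>z. indicator (- K) z * h z \<partial>lborel)"
proof -
  have T: "finite T" "\<And>t. t \<in> T \<Longrightarrow> Q t \<in> sets borel" "disjoint_family_on Q T" "(\<Union>t\<in>T. Q t) = K"
    using P by (auto simp: tagged_partition_def)
  have Kb: "K \<in> sets borel" using K by (simp add: borel_compact)
  have Kfin: "emeasure lborel K < \<infinity>" using emeasure_compact_finite[OF K] by simp
  have Qfin: "emeasure lborel (Q t) < \<infinity>" if "t \<in> T" for t
  proof -
    have "emeasure lborel (Q t) \<le> emeasure lborel K"
      using that T Kb by (intro emeasure_mono) auto
    then show ?thesis using Kfin by (rule le_less_trans)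
  qed
  define S where "S z = (\<Sum>t\<in>T. indicator (Q t) z *\<^sub>R F t)" for z
  have Sint: "integrable lborel (\<lambda>z. indicator (Q t) z *\<^sub>R F t)" if "t \<in> T" for t
    using that T Qfin by (intro integrable_scaleR_left integrable_real_indicator) auto
  have "integrable lborel S"
    unfolding S_def by (rule Bochner_Integration.integrable_sum) (rule Sint)
  have "(\<integral>z. S z \<partial>lborel) = (\<Sum>t\<in>T. \<integral>z. indicator (Q t) z *\<^sub>R F t \<partial>lborel)"
    unfolding S_def by (rule Bochner_Integration.integral_sum) (rule Sint)
  also have "\<dots> = (\<Sum>t\<in>T. measure lborel (Q t) *\<^sub>R F t)"
  proof (rule sum.cong)
    fix t assume t: "t \<in> T"
    have "integrable lborel (indicator (Q t) :: 'a \<Rightarrow> real)"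
      using t T Qfin by (intro integrable_real_indicator) auto
    then show "(\<integral>z. indicator (Q t) z *\<^sub>R F t \<partial>lborel) = measure lborel (Q t) *\<^sub>R F t"
      by (subst integral_scaleR_left) auto
  qed simp
  finally have "(\<integral>z. F z \<partial>lborel) - (\<Sum>t\<in>T. measure lborel (Q t) *\<^sub>R F t) = (\<integral>z. F z - S z \<partial>lborel)"
    using F \<open>integrable lborel S\<close> by simp
  also have "norm \<dots> \<le> (\<integral>z. norm (F z - S z) \<partial>lborel)" by (rule integral_norm_bound)
  also have "\<dots> \<le> (\<integral>z. e * indicator K z + indicator (- K) z * h z \<partial>lborel)"
  proof (rule integral_mono)
    show "integrable lborel (\<lambda>z. norm (F z - S z))"
      using F \<open>integrable lborel S\<close> by (intro integrable_norm) auto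
    have "integrable lborel (\<lambda>z. indicator (- K) z * h z)"
      using integrable_mult_indicator[of "- K" lborel h] Kb h by simp
    then show "integrable lborel (\<lambda>z. e * indicator K z + indicator (- K) z * h z)"
      using Kb Kfin by (intro Bochner_Integration.integrable_add integrable_mult_right integrable_real_indicator) auto
    fix z
    show "norm (F z - S z) \<le> e * indicator K z + indicator (- K) z * h z"
    proof (cases "z \<in> K")
      case True
      then obtain t where t: "t \<in> T" "z \<in> Q t" using T(4) by auto
      have "z \<notin> Q s" if "s \<in> T - {t}" for s
        using T(3) t that unfolding disjoint_family_on_def by blast
      then have "S z = F t" unfolding S_def using T(1) t by (subst sum.remove[of _ t]) auto
      then show ?thesis using osc[OF t] True by simp
    next
      case False
      then have "S z = 0" unfolding S_def using T(4) by (intro sum.neutral) auto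
      then show ?thesis using False h(2) by simp
    qed
  qed
  also have "\<dots> = e * measure lborel K + (\<integral>z. indicator (- K) z * h z \<partial>lborel)"
  proof -
    have "integrable lborel (\<lambda>z. indicator (- K) z * h z)"
      using integrable_mult_indicator[of "- K" lborel h] Kb h by simp
    then show ?thesis using Kb Kfin by simp
  qed
  finally show ?thesis .
qed

lemma integral_outside_ball_tendsto:
  fixes h :: "'a::euclidean_space \<Rightarrow> real"
  assumes h: "integrable lborel h"
  shows "(\<lambda>N. \<integral>z. indicator (- cball 0 (real N)) z * h z \<partial>lborel) \<longlonglongrightarrow> 0"
proof -
  have "(\<lambda>N. \<integral>z. indicator (- cball 0 (real N)) z * h z \<partial>lborel) \<longlonglongrightarrow> (\<integral>z. (0 :: real) \<partial>(lborel :: 'a measure))"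
  proof (rule integral_dominated_convergence[where w = "\<lambda>z. \<bar>h z\<bar>"])
    show "(\<lambda>z. indicator (- cball 0 (real N)) z * h z) \<in> borel_measurable lborel" for N
      using h by (intro borel_measurable_times borel_measurable_indicator) auto
    show "AE z in lborel. (\<lambda>N. indicator (- cball 0 (real N)) z * h z) \<longlonglongrightarrow> 0"
    proof (rule AE_I2)
      fix z :: 'a
      obtain N0 where N0: "norm z \<le> real N0" using real_arch_simple by blast
      have "\<forall>\<^sub>F N in sequentially. indicator (- cball 0 (real N)) z * h z = 0"
        using eventually_ge_at_top[of N0] by eventually_elim (use N0 in auto)
      then show "(\<lambda>N. indicator (- cball 0 (real N)) z * h z) \<longlonglongrightarrow> 0" by (rule tendsto_eventually)
    qed
    show "AE z in lborel. norm (indicator (- cball 0 (real N)) z * h z) \<le> \<bar>h z\<bar>" for N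
      by (intro AE_I2) (auto simp: indicator_def)
  qed (use h in auto)
  then show ?thesis by simp
qed

lemma jet_diff_abs:
  assumes "f \<in> smooth_space" "g \<in> smooth_space"
  shows "\<bar>jet k f x - jet k g x\<bar> \<le> jet k (\<lambda>x. f x - g x) x"
proof -
  have "jet k f x \<le> jet k (\<lambda>x. f x - g x) x + jet k g x" "jet k g x \<le> jet k (\<lambda>x. g x - f x) x + jet k f x"
    using jet_add[OF smooth_space_diff[OF assms] assms(2), of k x]
      jet_add[OF smooth_space_diff[OF assms(2,1)] assms(1), of k x] by auto
  then show ?thesis using jet_diff_commute[OF assms, of k x] by linarith
qed

lemma jet_continuous_form:
  assumes l: "form_bound m A l" and \<Phi>: "jet_continuous \<Phi>" "\<And>z. \<Phi> z \<in> B_dot_space"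
  shows "continuous_on UNIV (\<lambda>z. l (\<Phi> z))"
proof (subst continuous_on_iff, intro ballI allI impI)
  fix z e :: "_" assume e: "(e::real) > 0"
  have A: "0 \<le> A" by (rule form_bound_nonneg[OF l])
  have "e / (A + 1) > 0" using A e by simp
  with \<Phi>(1) have "\<exists>d>0. \<forall>z'. dist z' z < d \<longrightarrow> (\<forall>x. jet m (\<lambda>x. \<Phi> z' x - \<Phi> z x) x \<le> e / (A + 1))"
    unfolding jet_continuous_def by blast
  then obtain d where d: "d > 0" "\<And>z' x. dist z' z < d \<Longrightarrow> jet m (\<lambda>x. \<Phi> z' x - \<Phi> z x) x \<le> e / (A + 1)"
    by blast
  have "dist (l (\<Phi> z')) (l (\<Phi> z)) < e" if "dist z' z < d" for z'
  proof -
    have "norm (l (\<Phi> z') - l (\<Phi> z)) \<le> A * (e / (A + 1))"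
      using form_boundD[OF l B_dot_space_diff[OF \<Phi>(2)[of z'] \<Phi>(2)[of z]] d(2)[OF that]] form_diff[OF l \<Phi>(2)[of z'] \<Phi>(2)[of z]]
      by simp
    also have "\<dots> < e" using A e by (simp add: field_simps)
    finally show ?thesis by (simp add: dist_norm)
  qed
  then show "\<exists>d>0. \<forall>z'\<in>UNIV. dist z' z < d \<longrightarrow> dist (l (\<Phi> z')) (l (\<Phi> z)) < e" using d(1) by blast
qed

lemma jet_continuous_partials:
  assumes \<Phi>: "jet_continuous \<Phi>" "\<And>z. \<Phi> z \<in> smooth_space"
  shows "continuous_on UNIV (\<lambda>z. partials is (\<Phi> z) x)"
proof (subst continuous_on_iff, intro ballI allI impI)
  fix z e :: "_" assume e: "(e::real) > 0"
  then have "e / 2 > 0" by simp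
  with \<Phi>(1) have "\<exists>d>0. \<forall>z'. dist z' z < d \<longrightarrow> (\<forall>x. jet (length is) (\<lambda>x. \<Phi> z' x - \<Phi> z x) x \<le> e / 2)"
    unfolding jet_continuous_def by blast
  then obtain d where d: "d > 0" "\<And>z' x. dist z' z < d \<Longrightarrow> jet (length is) (\<lambda>x. \<Phi> z' x - \<Phi> z x) x \<le> e / 2"
    by blast
  have "dist (partials is (\<Phi> z') x) (partials is (\<Phi> z) x) < e" if "dist z' z < d" for z'
    using norm_partials_le_jet[OF order_refl, of "is" "\<lambda>x. \<Phi> z' x - \<Phi> z x" x] d(2)[OF that, of x] e
    by (simp add: dist_norm partials_diff \<Phi>)
  then show "\<exists>d>0. \<forall>z'\<in>UNIV. dist z' z < d \<longrightarrow> dist (partials is (\<Phi> z') x) (partials is (\<Phi> z) x) < e" using d(1) by blast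
qed

lemma integrable_indicator_compact:
  fixes F :: "'a::euclidean_space \<Rightarrow> real"
  assumes "compact K" "continuous_on UNIV F"
  shows "integrable lborel (\<lambda>z. indicator K z * F z)"
  using borel_integrable_compact[OF assms(1) continuous_on_subset[OF assms(2)]] by (simp add: mult.commute)

lemma nn_integral_le_of_tendsto:
  assumes "\<And>k :: nat. u k \<in> borel_measurable M" "\<And>k. (\<integral>\<^sup>+x. u k x \<partial>M) \<le> C"
    and "\<And>x. (\<lambda>k. u k x) \<longlonglongrightarrow> (f x :: ennreal)"
  shows "(\<integral>\<^sup>+x. f x \<partial>M) \<le> C"
proof -
  have "(\<integral>\<^sup>+x. f x \<partial>M) = (\<integral>\<^sup>+x. liminf (\<lambda>k. u k x) \<partial>M)"
    using lim_imp_Liminf[OF trivial_limit_sequentially assms(3)] by simp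
  also have "\<dots> \<le> liminf (\<lambda>k. \<integral>\<^sup>+x. u k x \<partial>M)" by (rule nn_integral_liminf[OF assms(1)])
  also have "\<dots> \<le> liminf (\<lambda>k :: nat. C)" by (rule Liminf_mono) (use assms(2) in auto)
  also have "\<dots> = C" by (simp add: Liminf_const)
  finally show ?thesis .
qed

text \<open>
  An inequality of Minkowski type. Discretising the integral reduces it to \<open>form_bound_sum_norm\<close>.
\<close>

lemma form_nn_integral_le:
  fixes \<Phi> :: "real^'d::finite \<Rightarrow> real^'n::finite \<Rightarrow> complex"
  assumes l: "form_bound m A l" and \<Phi>: "jet_continuous \<Phi>" "\<And>z. \<Phi> z \<in> B_dot_space"
    and M: "\<And>x. (\<integral>\<^sup>+z. ennreal (jet m (\<Phi> z) x) \<partial>lborel) \<le> ennreal M" "0 \<le> M"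
  shows "(\<integral>\<^sup>+z. ennreal (norm (l (\<Phi> z))) \<partial>lborel) \<le> ennreal (A * M)"
proof -
  have A: "0 \<le> A" by (rule form_bound_nonneg[OF l])
  have sm: "\<Phi> z \<in> smooth_space" for z by (rule B_dot_smooth[OF \<Phi>(2)])
  have cl: "continuous_on UNIV (\<lambda>z. norm (l (\<Phi> z)))"
    by (intro continuous_on_norm jet_continuous_form[OF l \<Phi>])
  have cj: "continuous_on UNIV (\<lambda>z. jet m (\<Phi> z) x)" for x
    unfolding jet_def by (intro continuous_on_sum continuous_on_norm jet_continuous_partials[OF \<Phi>(1) sm])
  \<comment> \<open>partitions exist for compact sets only; the whole space is exhausted by balls at the end\<close>
  have le: "(\<integral>z. indicator K z * norm (l (\<Phi> z)) \<partial>lborel) \<le> A * M" if K: "compact K" for K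
  proof (rule field_le_epsilon)
    fix \<epsilon> :: real assume \<epsilon>: "\<epsilon> > 0"
    define V where "V = measure lborel K"
    have V: "V \<ge> 0" by (simp add: V_def)
    define e where "e = \<epsilon> / (2 * A * V + 1)"
    have pos: "2 * A * V + 1 > 0" using A V by (simp add: add_nonneg_pos)
    have e: "e > 0" using \<epsilon> pos by (simp add: e_def)
    obtain T Q where P: "tagged_partition K T Q" "\<And>t z x. t \<in> T \<Longrightarrow> z \<in> Q t \<Longrightarrow> jet m (\<lambda>x. \<Phi> z x - \<Phi> t x) x \<le> e"
      using jet_continuous_partition[OF \<Phi>(1) K e, of m] by blast
    have TK: "finite T" "\<And>t. t \<in> T \<Longrightarrow> t \<in> K" "\<And>t z. t \<in> T \<Longrightarrow> z \<in> Q t \<Longrightarrow> z \<in> K"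
      using P(1) by (auto simp: tagged_partition_def)
    have *: "\<bar>(\<integral>z. indicator K z * F z \<partial>lborel) - (\<Sum>t\<in>T. measure lborel (Q t) * F t)\<bar> \<le> d * V"
      if F: "continuous_on UNIV F" "\<And>z. 0 \<le> F z" "\<And>t z. t \<in> T \<Longrightarrow> z \<in> Q t \<Longrightarrow> \<bar>F z - F t\<bar> \<le> d" and "d \<ge> 0"
      for F :: "real^'d \<Rightarrow> real" and d
    proof -
      let ?F = "\<lambda>z. indicator K z * F z"
      have "norm ((\<integral>z. ?F z \<partial>lborel) - (\<Sum>t\<in>T. measure lborel (Q t) *\<^sub>R ?F t)) \<le>
          d * measure lborel K + (\<integral>z. indicator (- K) z * ?F z \<partial>lborel)"
      proof (rule partition_sum_approx[OF P(1) K])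
        show "norm (?F z - ?F t) \<le> d" if "t \<in> T" "z \<in> Q t" for t z
          using F(3)[OF that] TK that by simp
      qed (use integrable_indicator_compact[OF K F(1)] F(2) \<open>d \<ge> 0\<close> in auto)
      moreover have "(\<lambda>z. indicator (- K) z * ?F z) = (\<lambda>z. 0)" by (auto simp: indicator_def)
      moreover have "(\<Sum>t\<in>T. measure lborel (Q t) *\<^sub>R ?F t) = (\<Sum>t\<in>T. measure lborel (Q t) * F t)"
        by (rule sum.cong) (use TK in auto)
      ultimately show ?thesis by (simp add: V_def)
    qed
    have jets: "(\<Sum>t\<in>T. jet m (\<lambda>x. of_real (measure lborel (Q t)) * \<Phi> t x) x) \<le> M + e * V" for x
    proof -
      have "(\<Sum>t\<in>T. jet m (\<lambda>x. of_real (measure lborel (Q t)) * \<Phi> t x) x) = (\<Sum>t\<in>T. measure lborel (Q t) * jet m (\<Phi> t) x)"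
        by (simp add: jet_cmult sm)
      also have "\<dots> \<le> (\<integral>z. indicator K z * jet m (\<Phi> z) x \<partial>lborel) + e * V"
      proof -
        have "\<bar>jet m (\<Phi> z) x - jet m (\<Phi> t) x\<bar> \<le> e" if "t \<in> T" "z \<in> Q t" for t z
          using jet_diff_abs[OF sm sm] P(2)[OF that] by (rule order_trans)
        then have "\<bar>(\<integral>z. indicator K z * jet m (\<Phi> z) x \<partial>lborel) - (\<Sum>t\<in>T. measure lborel (Q t) * jet m (\<Phi> t) x)\<bar> \<le> e * V"
          using e by (intro *[OF cj]) auto
        then show ?thesis by linarith
      qed
      also have "(\<integral>z. indicator K z * jet m (\<Phi> z) x \<partial>lborel) \<le> M"
      proof -
        have "ennreal (\<integral>z. indicator K z * jet m (\<Phi> z) x \<partial>lborel) = (\<integral>\<^sup>+z. ennreal (indicator K z * jet m (\<Phi> z) x) \<partial>lborel)"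
          by (rule nn_integral_eq_integral[symmetric]) (use integrable_indicator_compact[OF K cj] in auto)
        also have "\<dots> \<le> (\<integral>\<^sup>+z. ennreal (jet m (\<Phi> z) x) \<partial>lborel)"
          by (intro nn_integral_mono ennreal_leI) (auto simp: indicator_def)
        also have "\<dots> \<le> ennreal M" by (rule M)
        finally show ?thesis using M(2) by simp
      qed
      finally show ?thesis by simp
    qed
    have "(\<integral>z. indicator K z * norm (l (\<Phi> z)) \<partial>lborel) \<le> (\<Sum>t\<in>T. measure lborel (Q t) * norm (l (\<Phi> t))) + A * e * V"
    proof -
      have "\<bar>norm (l (\<Phi> z)) - norm (l (\<Phi> t))\<bar> \<le> A * e" if "t \<in> T" "z \<in> Q t" for t z
      proof -
        have "\<bar>norm (l (\<Phi> z)) - norm (l (\<Phi> t))\<bar> \<le> norm (l (\<Phi> z) - l (\<Phi> t))" by (rule norm_triangle_ineq3)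
        also have "\<dots> = norm (l (\<lambda>x. \<Phi> z x - \<Phi> t x))" using form_diff[OF l \<Phi>(2) \<Phi>(2)] by simp
        also have "\<dots> \<le> A * e" by (rule form_boundD[OF l B_dot_space_diff[OF \<Phi>(2) \<Phi>(2)] P(2)[OF that]])
        finally show ?thesis .
      qed
      then have "\<bar>(\<integral>z. indicator K z * norm (l (\<Phi> z)) \<partial>lborel) - (\<Sum>t\<in>T. measure lborel (Q t) * norm (l (\<Phi> t)))\<bar> \<le> (A * e) * V"
        using A e by (intro *[OF cl]) auto
      then show ?thesis by linarith
    qed
    also have "(\<Sum>t\<in>T. measure lborel (Q t) * norm (l (\<Phi> t))) = (\<Sum>t\<in>T. norm (l (\<lambda>x. of_real (measure lborel (Q t)) * \<Phi> t x)))"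
      by (simp add: form_cmult[OF l \<Phi>(2)] norm_mult)
    also have "\<dots> \<le> A * (M + e * V)"
      by (rule form_bound_sum_norm[OF l TK(1) B_dot_space_cmult[OF \<Phi>(2)] jets])
    also have "A * (M + e * V) + A * e * V = A * M + e * (2 * A * V)" by (simp add: algebra_simps)
    also have "e * (2 * A * V) \<le> e * (2 * A * V + 1)" using e by (intro mult_left_mono) auto
    also have "\<dots> = \<epsilon>" using pos by (simp add: e_def)
    finally show "(\<integral>z. indicator K z * norm (l (\<Phi> z)) \<partial>lborel) \<le> A * M + \<epsilon>" by simp
  qed
  show ?thesis
  proof (rule nn_integral_le_of_tendsto)
    fix k :: nat
    let ?u = "\<lambda>z. indicator (cball 0 (real k)) z * norm (l (\<Phi> z))"
    have int: "integrable lborel ?u" by (rule integrable_indicator_compact[OF compact_cball cl])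
    then show "(\<lambda>z. ennreal (?u z)) \<in> borel_measurable lborel" by measurable
    have "(\<integral>\<^sup>+z. ennreal (?u z) \<partial>lborel) = ennreal (\<integral>z. ?u z \<partial>lborel)"
      by (rule nn_integral_eq_integral[OF int]) auto
    then show "(\<integral>\<^sup>+z. ennreal (?u z) \<partial>lborel) \<le> ennreal (A * M)"
      using le[OF compact_cball] by (simp add: ennreal_leI)
  next
    fix z :: "real^'d"
    obtain K where K: "norm z \<le> real K" using real_arch_simple by blast
    have "\<forall>\<^sub>F k in sequentially. indicator (cball 0 (real k)) z * norm (l (\<Phi> z)) = norm (l (\<Phi> z))"
      using eventually_ge_at_top[of K] by eventually_elim (use K in auto)
    then show "(\<lambda>k. ennreal (indicator (cball 0 (real k)) z * norm (l (\<Phi> z)))) \<longlonglongrightarrow> ennreal (norm (l (\<Phi> z)))"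
      by (intro tendsto_ennrealI tendsto_eventually)
  qed
qed

text \<open>
  Completeness in the topology of uniform convergence of all derivatives: \<open>G is\<close> is the uniform limit
  of the derivatives \<open>is\<close> and turns out to be the derivative \<open>is\<close> of \<open>G []\<close>.
\<close>

lemma smooth_uniform_limit:
  fixes S :: "nat \<Rightarrow> real^'n::finite \<Rightarrow> complex"
  assumes S: "\<And>N. S N \<in> smooth_space"
    and lim: "\<And>is e. e > 0 \<Longrightarrow> \<exists>N0. \<forall>N\<ge>N0. \<forall>x. norm (partials is (S N) x - G is x) \<le> e"
  shows "G [] \<in> smooth_space" "partials is (G []) = G is"
proof -
  have pointwise: "(\<lambda>N. partials is (S N) x) \<longlonglongrightarrow> G is x" for "is" x
  proof (rule LIMSEQ_I)
    fix r :: real assume "r > 0"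
    then obtain N0 where "\<forall>N\<ge>N0. \<forall>x. norm (partials is (S N) x - G is x) \<le> r / 2" using lim[of "r / 2"] by auto
    then have "norm (partials is (S N) x - G is x) < r" if "N \<ge> N0" for N
      using that \<open>r > 0\<close> half_gt_zero[of r] field_sum_of_halves[of r] by (smt (verit, best))
    then show "\<exists>N0. \<forall>N\<ge>N0. norm (partials is (S N) x - G is x) < r" by blast
  qed
  have D: "(G is has_derivative (\<lambda>h. \<Sum>i\<in>UNIV. of_real (h $ i) * G (i # is) x)) (at x)" for "is" x
  proof -
    have "\<exists>g. \<forall>x\<in>UNIV. (\<lambda>N. partials is (S N) x) \<longlonglongrightarrow> g x \<and>
        (g has_derivative (\<lambda>h. \<Sum>i\<in>UNIV. of_real (h $ i) * G (i # is) x)) (at x within UNIV)"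
    proof (rule has_derivative_sequence[OF convex_UNIV _ _ UNIV_I])
      show "(\<lambda>N. partials is (S N) 0) \<longlonglongrightarrow> G is 0" by (rule pointwise)
      show "(partials is (S N) has_derivative (\<lambda>h. \<Sum>i\<in>UNIV. of_real (h $ i) * partial i (partials is (S N)) x)) (at x within UNIV)" for N x
        using has_derivative_partials[OF smooth_spaceD[OF S]] by simp
      fix e :: real assume e: "e > 0"
      define e' where "e' = e / real CARD('n)"
      have e': "e' > 0" using e by (simp add: e'_def)
      have "\<forall>i. \<exists>N0. \<forall>N\<ge>N0. \<forall>x. norm (partials (i # is) (S N) x - G (i # is) x) \<le> e'"
        using lim[OF e'] by blast
      then obtain N0 where N0: "\<And>i N x. N \<ge> N0 i \<Longrightarrow> norm (partials (i # is) (S N) x - G (i # is) x) \<le> e'" by metis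
      have "norm ((\<Sum>i\<in>UNIV. of_real (h $ i) * partial i (partials is (S N)) x) - (\<Sum>i\<in>UNIV. of_real (h $ i) * G (i # is) x)) \<le> e * norm h"
        if N: "N \<ge> Max (range N0)" for N x h
      proof -
        have "N \<ge> N0 i" for i using N Max_ge[of "range N0" "N0 i"] by simp
        then have "norm (partial i (partials is (S N)) x - G (i # is) x) \<le> e'" for i
          using N0[of i N x] by simp
        from norm_partial_sum_le[OF this, of h] show ?thesis
          by (simp add: e'_def right_diff_distrib sum_subtractf)
      qed
      then show "\<forall>\<^sub>F N in sequentially. \<forall>x\<in>UNIV. \<forall>h. norm ((\<Sum>i\<in>UNIV. of_real (h $ i) * partial i (partials is (S N)) x) - (\<Sum>i\<in>UNIV. of_real (h $ i) * G (i # is) x)) \<le> e * norm h"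
        unfolding eventually_sequentially by blast
    qed
    then obtain g where g: "\<And>x. (\<lambda>N. partials is (S N) x) \<longlonglongrightarrow> g x"
      "\<And>x. (g has_derivative (\<lambda>h. \<Sum>i\<in>UNIV. of_real (h $ i) * G (i # is) x)) (at x)" by auto
    have "g = G is" using LIMSEQ_unique[OF g(1) pointwise] by blast
    with g(2) show ?thesis by simp
  qed
  have "partial i (G is) = G (i # is)" for i "is"
  proof
    fix x
    have "partial i (G is) x = (\<Sum>j\<in>UNIV. of_real (axis i 1 $ j) * G (j # is) x)" by (rule partial_eq_derivative[OF D])
    also have "\<dots> = (\<Sum>j\<in>UNIV. if j = i then G (i # is) x else 0)"
      by (rule sum.cong) (auto simp: axis_def)
    finally show "partial i (G is) x = G (i # is) x" by simp
  qed
  then have *: "partials is (G []) = G is" for "is" by (induction "is") auto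
  then show "partials is (G []) = G is" .
  show "G [] \<in> smooth_space"
    unfolding smooth_space_def using D by (auto simp: * differentiable_def)
qed

text \<open>
  Fubini's theorem for a form. The partition sums of \<open>\<integral> \<Phi> z dz\<close> converge uniformly together with all
  derivatives, which shows at once that the integral is in \<open>B_dot_space\<close>, that derivatives may be
  taken under the integral sign, and that \<open>l\<close> commutes with the integral.
\<close>

theorem form_integral:
  fixes \<Phi> :: "real^'d::finite \<Rightarrow> real^'n::finite \<Rightarrow> complex"
  assumes l: "form_bound m A l" and \<Phi>: "jet_continuous \<Phi>" "\<And>z. \<Phi> z \<in> B_dot_space"
    and dom: "\<And>k. \<exists>h. integrable lborel h \<and> (\<forall>z x. jet k (\<Phi> z) x \<le> h z)"
  shows "(\<lambda>x. \<integral>z. \<Phi> z x \<partial>lborel) \<in> B_dot_space" "integrable lborel (\<lambda>z. l (\<Phi> z))"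
    "l (\<lambda>x. \<integral>z. \<Phi> z x \<partial>lborel) = (\<integral>z. l (\<Phi> z) \<partial>lborel)"
proof -
  have A: "0 \<le> A" by (rule form_bound_nonneg[OF l])
  have sm: "\<Phi> z \<in> smooth_space" for z by (rule B_dot_smooth[OF \<Phi>(2)])
  obtain h where h: "\<And>k. integrable lborel (h k)" "\<And>k z x. jet k (\<Phi> z) x \<le> h k z" using dom by metis
  have h0: "0 \<le> h k z" for k z using order_trans[OF jet_nonneg h(2)] .
  have l_le: "norm (l (\<Phi> z)) \<le> A * h m z" for z by (rule form_boundD[OF l \<Phi>(2) h(2)])
  show l_int: "integrable lborel (\<lambda>z. l (\<Phi> z))"
  proof (rule Bochner_Integration.integrable_bound)
    show "integrable lborel (\<lambda>z. A * h m z)" using h(1) by simp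
    show "(\<lambda>z. l (\<Phi> z)) \<in> borel_measurable lborel"
      using borel_measurable_continuous_onI[OF jet_continuous_form[OF l \<Phi>]] by simp
    show "AE z in lborel. norm (l (\<Phi> z)) \<le> norm (A * h m z)"
      using l_le A h0 by simp
  qed
  have d_le: "norm (partials is (\<Phi> z) x) \<le> h (length is) z" for "is" z x
    using norm_partials_le_jet[OF order_refl] h(2) by (rule order_trans)
  have d_int: "integrable lborel (\<lambda>z. partials is (\<Phi> z) x)" for "is" x
  proof (rule Bochner_Integration.integrable_bound)
    show "integrable lborel (h (length is))" using h(1) by simp
    show "(\<lambda>z. partials is (\<Phi> z) x) \<in> borel_measurable lborel"
      using borel_measurable_continuous_onI[OF jet_continuous_partials[OF \<Phi>(1) sm]] by simp
    show "AE z in lborel. norm (partials is (\<Phi> z) x) \<le> norm (h (length is) z)"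
      using d_le h0 by simp
  qed
  define K where "K N = cball (0 :: real^'d) (real N)" for N
  define V where "V N = measure lborel (K N)" for N
  have V: "V N \<ge> 0" for N by (simp add: V_def)
  \<comment> \<open>the oscillation has to be small compared with the volume \<open>V N\<close> of the ball\<close>
  define e where "e N = 1 / ((1 + V N) * (1 + real N))" for N
  have e: "e N > 0" and eV: "e N * V N \<le> 1 / (1 + real N)" for N
  proof -
    show "e N > 0" using V[of N] by (simp add: e_def add_pos_nonneg)
    have "V N / (1 + V N) \<le> 1" using V[of N] by simp
    then have "V N / (1 + V N) * (1 / (1 + real N)) \<le> 1 * (1 / (1 + real N))" by (intro mult_right_mono) auto
    then show "e N * V N \<le> 1 / (1 + real N)" by (simp add: e_def)
  qed
  have "\<exists>T Q. tagged_partition (K N) T Q \<and> (\<forall>t\<in>T. \<forall>z\<in>Q t. \<forall>x. jet N (\<lambda>x. \<Phi> z x - \<Phi> t x) x \<le> e N)" for N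
    by (rule jet_continuous_partition[OF \<Phi>(1) _ e]) (simp add: K_def)
  then have "\<forall>N. \<exists>T Q. tagged_partition (K N) T Q \<and> (\<forall>t\<in>T. \<forall>z\<in>Q t. \<forall>x. jet N (\<lambda>x. \<Phi> z x - \<Phi> t x) x \<le> e N)" by blast
  then obtain T Q where TQ: "\<And>N. tagged_partition (K N) (T N) (Q N)"
    "\<And>N t z x. t \<in> T N \<Longrightarrow> z \<in> Q N t \<Longrightarrow> jet N (\<lambda>x. \<Phi> z x - \<Phi> t x) x \<le> e N"
    unfolding choice_iff by blast
  have fin: "finite (T N)" for N using TQ(1)[of N] by (simp add: tagged_partition_def)
  define r where "r k N = 1 / (1 + real N) + (\<integral>z. indicator (- K N) z * h k z \<partial>lborel)" for k N
  have r_lim: "r k \<longlonglongrightarrow> 0" for k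
  proof -
    have "(\<lambda>N. \<integral>z. indicator (- K N) z * h k z \<partial>lborel) \<longlonglongrightarrow> 0"
      unfolding K_def by (rule integral_outside_ball_tendsto[OF h(1)])
    moreover have "(\<lambda>N. 1 / (1 + real N)) \<longlonglongrightarrow> 0"
      using LIMSEQ_inverse_real_of_nat by (simp add: inverse_eq_divide add.commute)
    ultimately show ?thesis unfolding r_def[abs_def] using tendsto_add by fastforce
  qed
  define S where "S N x = (\<Sum>t\<in>T N. of_real (measure lborel (Q N t)) * \<Phi> t x)" for N x
  have S_dot: "S N \<in> B_dot_space" for N
    unfolding S_def by (intro B_dot_space_sum fin B_dot_space_cmult \<Phi>(2))
  have S_partials: "partials is (S N) x = (\<Sum>t\<in>T N. measure lborel (Q N t) *\<^sub>R partials is (\<Phi> t) x)" for "is" N x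
    unfolding S_def
    by (simp add: partials_sum fin partials_cmult smooth_space_cmult sm scaleR_conv_of_real)
  define G where "G is x = (\<integral>z. partials is (\<Phi> z) x \<partial>lborel)" for "is" x
  have approx: "norm (G is x - partials is (S N) x) \<le> r (length is) N" if "N \<ge> length is" for "is" N x
  proof -
    have "norm (G is x - partials is (S N) x) \<le> e N * measure lborel (K N) + (\<integral>z. indicator (- K N) z * h (length is) z \<partial>lborel)"
      unfolding G_def S_partials
    proof (rule partition_sum_approx[OF TQ(1) _ d_int h(1) d_le])
      show "norm (partials is (\<Phi> z) x - partials is (\<Phi> t) x) \<le> e N" if "t \<in> T N" "z \<in> Q N t" for t z
        using norm_partials_le_jet[OF \<open>N \<ge> length is\<close>, of "\<lambda>x. \<Phi> z x - \<Phi> t x" x] TQ(2)[OF that, of x]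
        by (simp add: partials_diff sm)
    qed (use e less_imp_le in \<open>auto simp: K_def\<close>)
    then show ?thesis using eV[of N] by (simp add: r_def V_def)
  qed
  have unif: "\<exists>N0. \<forall>N\<ge>N0. \<forall>x. norm (partials is (S N) x - G is x) \<le> \<epsilon>" if \<epsilon>: "\<epsilon> > 0" for "is" \<epsilon>
  proof -
    obtain N0 where N0: "\<And>N. N \<ge> N0 \<Longrightarrow> r (length is) N < \<epsilon>"
      using order_tendstoD(2)[OF r_lim \<epsilon>] unfolding eventually_sequentially by blast
    have "norm (partials is (S N) x - G is x) \<le> \<epsilon>" if "N \<ge> max N0 (length is)" for N x
      using approx[of "is" N x] N0[of N] that by (simp add: norm_minus_commute)
    then show ?thesis by blast
  qed
  let ?\<Psi> = "\<lambda>x. \<integral>z. \<Phi> z x \<partial>lborel"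
  have G0: "G [] = ?\<Psi>" by (simp add: G_def fun_eq_iff)
  have \<Psi>_sm: "?\<Psi> \<in> smooth_space" and \<Psi>_partials: "partials is ?\<Psi> = G is" for "is"
    using smooth_uniform_limit[OF B_dot_smooth[OF S_dot] unif] unfolding G0 by auto
  have jets: "\<exists>N0. \<forall>N\<ge>N0. \<forall>x. jet k (\<lambda>x. S N x - ?\<Psi> x) x \<le> \<epsilon>" if \<epsilon>: "\<epsilon> > 0" for k \<epsilon>
  proof -
    let ?L = "{is :: 'n list. length is \<le> k}"
    have c: "card ?L > 0" by (subst card_gt_0_iff) (auto intro: exI[of _ "[]"])
    have "\<forall>is. \<exists>N0. \<forall>N\<ge>N0. \<forall>x. norm (partials is (S N) x - G is x) \<le> \<epsilon> / card ?L"
      using unif[of "\<epsilon> / card ?L"] \<epsilon> c by simp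
    then obtain N0 where N0: "\<And>is N x. N \<ge> N0 is \<Longrightarrow> norm (partials is (S N) x - G is x) \<le> \<epsilon> / card ?L" by metis
    have "jet k (\<lambda>x. S N x - ?\<Psi> x) x \<le> \<epsilon>" if N: "N \<ge> Max (N0 ` ?L)" for N x
    proof -
      have "jet k (\<lambda>x. S N x - ?\<Psi> x) x \<le> (\<Sum>is\<in>?L. \<epsilon> / card ?L)"
        unfolding jet_def
      proof (rule sum_mono)
        fix "is" assume "is \<in> ?L"
        then have "N0 is \<le> Max (N0 ` ?L)" by (intro Max_ge) auto
        then have "N \<ge> N0 is" using N by linarith
        from N0[OF this] show "norm (partials is (\<lambda>x. S N x - ?\<Psi> x) x) \<le> \<epsilon> / card ?L"
          by (simp only: partials_diff[OF B_dot_smooth[OF S_dot] \<Psi>_sm] \<Psi>_partials)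
      qed
      also have "\<dots> = \<epsilon>" unfolding sum_constant using c by (auto dest: spec[of _ "[]"])
      finally show ?thesis .
    qed
    then show ?thesis by blast
  qed
  show \<Psi>_dot: "?\<Psi> \<in> B_dot_space"
  proof (rule B_dot_spaceI[OF \<Psi>_sm])
    fix k
    show "(jet k ?\<Psi> \<longlongrightarrow> 0) at_infinity"
    proof (rule tendstoI)
      fix \<epsilon> :: real assume \<epsilon>: "\<epsilon> > 0"
      then obtain N where N: "\<And>x. jet k (\<lambda>x. S N x - ?\<Psi> x) x \<le> \<epsilon> / 2" using jets[of "\<epsilon> / 2" k] by auto
      have "(jet k (S N) \<longlongrightarrow> 0) at_infinity" using S_dot[of N] by (simp add: B_dot_space_iff)
      from tendstoD[OF this, of "\<epsilon> / 2"] \<epsilon> have "\<forall>\<^sub>F x in at_infinity. dist (jet k (S N) x) 0 < \<epsilon> / 2" by simp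
      then show "\<forall>\<^sub>F x in at_infinity. dist (jet k ?\<Psi> x) 0 < \<epsilon>"
      proof eventually_elim
        case (elim x)
        have "\<bar>jet k (S N) x - jet k ?\<Psi> x\<bar> \<le> \<epsilon> / 2"
          using jet_diff_abs[OF B_dot_smooth[OF S_dot] \<Psi>_sm] N by (rule order_trans)
        moreover have "jet k (S N) x < \<epsilon> / 2" using elim by simp
        ultimately have "jet k ?\<Psi> x < \<epsilon>" by linarith
        then show ?case by simp
      qed
    qed
  qed
  have "(\<lambda>N. l (S N)) \<longlonglongrightarrow> l ?\<Psi>"
  proof (rule LIMSEQ_I)
    fix \<epsilon> :: real assume \<epsilon>: "\<epsilon> > 0"
    have "\<epsilon> / (A + 1) > 0" using \<epsilon> A by simp
    then obtain N0 where N0: "\<And>N x. N \<ge> N0 \<Longrightarrow> jet m (\<lambda>x. S N x - ?\<Psi> x) x \<le> \<epsilon> / (A + 1)" using jets by meson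
    have "norm (l (S N) - l ?\<Psi>) < \<epsilon>" if "N \<ge> N0" for N
    proof -
      have "norm (l (S N) - l ?\<Psi>) = norm (l (\<lambda>x. S N x - ?\<Psi> x))" using form_diff[OF l S_dot \<Psi>_dot] by simp
      also have "\<dots> \<le> A * (\<epsilon> / (A + 1))" by (rule form_boundD[OF l B_dot_space_diff[OF S_dot \<Psi>_dot] N0[OF that]])
      also have "\<dots> < \<epsilon>" using A \<epsilon> by (simp add: field_simps)
      finally show ?thesis .
    qed
    then show "\<exists>N0. \<forall>N\<ge>N0. norm (l (S N) - l ?\<Psi>) < \<epsilon>" by blast
  qed
  moreover have "(\<lambda>N. l (S N)) \<longlonglongrightarrow> (\<integral>z. l (\<Phi> z) \<partial>lborel)"
  proof -
    have "norm ((\<integral>z. l (\<Phi> z) \<partial>lborel) - l (S N)) \<le> A * r m N" if N: "N \<ge> m" for N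
    proof -
      have "l (S N) = (\<Sum>t\<in>T N. l (\<lambda>x. of_real (measure lborel (Q N t)) * \<Phi> t x))"
        unfolding S_def by (rule form_sum[OF l fin B_dot_space_cmult[OF \<Phi>(2)]])
      also have "\<dots> = (\<Sum>t\<in>T N. measure lborel (Q N t) *\<^sub>R l (\<Phi> t))"
        by (simp add: form_cmult[OF l \<Phi>(2)] scaleR_conv_of_real)
      finally have "norm ((\<integral>z. l (\<Phi> z) \<partial>lborel) - l (S N)) \<le>
         (A * e N) * measure lborel (K N) + (\<integral>z. indicator (- K N) z * (A * h m z) \<partial>lborel)"
      proof (elim ssubst, intro partition_sum_approx[OF TQ(1) _ l_int _ l_le])
        show "norm (l (\<Phi> z) - l (\<Phi> t)) \<le> A * e N" if "t \<in> T N" "z \<in> Q N t" for t z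
        proof -
          have "norm (l (\<Phi> z) - l (\<Phi> t)) = norm (l (\<lambda>x. \<Phi> z x - \<Phi> t x))" using form_diff[OF l \<Phi>(2) \<Phi>(2)] by simp
          also have "\<dots> \<le> A * e N"
            using order_trans[OF jet_mono[OF N] TQ(2)[OF that]] by (intro form_boundD[OF l B_dot_space_diff[OF \<Phi>(2) \<Phi>(2)]])
          finally show ?thesis .
        qed
      qed (use h A e[of N] in \<open>auto simp: K_def\<close>)
      also have "(\<lambda>z. indicator (- K N) z * (A * h m z)) = (\<lambda>z. A * (indicator (- K N) z * h m z))" by (simp add: mult_ac)
      also have "(\<integral>z. A * (indicator (- K N) z * h m z) \<partial>lborel) = A * (\<integral>z. indicator (- K N) z * h m z \<partial>lborel)" by simp
      also have "(A * e N) * measure lborel (K N) + A * (\<integral>z. indicator (- K N) z * h m z \<partial>lborel) =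
         A * (e N * V N + (\<integral>z. indicator (- K N) z * h m z \<partial>lborel))" by (simp add: V_def algebra_simps)
      also have "\<dots> \<le> A * r m N"
        unfolding r_def using eV[of N] A by (intro mult_left_mono add_mono) auto
      finally show ?thesis .
    qed
    then have "\<forall>\<^sub>F N in sequentially. norm (l (S N) - (\<integral>z. l (\<Phi> z) \<partial>lborel)) \<le> A * r m N"
      unfolding eventually_sequentially by (intro exI[of _ m]) (simp add: norm_minus_commute)
    moreover have "(\<lambda>N. A * r m N) \<longlonglongrightarrow> 0" by (rule tendsto_mult_right_zero[OF r_lim])
    ultimately have "(\<lambda>N. l (S N) - (\<integral>z. l (\<Phi> z) \<partial>lborel)) \<longlonglongrightarrow> 0" by (rule Lim_null_comparison)
    then show ?thesis by (simp add: LIM_zero_iff)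
  qed
  ultimately show "l ?\<Psi> = (\<integral>z. l (\<Phi> z) \<partial>lborel)" by (rule LIMSEQ_unique)
qed

text \<open>
  The families to which \<open>form_nn_integral_le\<close> and \<open>form_integral\<close> are applied are of this form.
\<close>

lemma jet_continuous_product_translate:
  fixes b k :: "real^'n::finite \<Rightarrow> complex" and a :: "real^'n \<Rightarrow> complex"
  assumes a: "continuous_on UNIV a" and b: "b \<in> B_space" and k: "k \<in> B_space"
  shows "jet_continuous (\<lambda>z x. a z * (b x * k (x + s *\<^sub>R z)))"
  unfolding jet_continuous_def
proof (intro allI impI)
  fix q z and e :: real assume e: "e > 0"
  let ?L = "leibniz_const TYPE('n) q"
  let ?n = "real (card {is :: 'n list. length is \<le> q})"
  obtain B where B: "\<And>x. jet q b x \<le> B" using b unfolding B_space_iff by blast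
  obtain C where C: "\<And>x. jet q k x \<le> C" using k unfolding B_space_iff by blast
  obtain D where D: "\<And>x. jet (Suc q) k x \<le> D" using k unfolding B_space_iff by blast
  have B0: "0 \<le> B" using order_trans[OF jet_nonneg B] .
  have sm: "b \<in> smooth_space" "k \<in> smooth_space" using b k by (auto simp: B_smooth)
  let ?k = "\<lambda>z x. k (x + s *\<^sub>R z)"
  have smk: "?k z \<in> smooth_space" for z by (rule smooth_space_translate[OF sm(2)])
  let ?E = "\<lambda>z'. norm (a z' - a z) * (?L * (B * C)) + norm (a z) * (?L * (B * (?n * (real CARD('n) * D * norm (s *\<^sub>R z' - s *\<^sub>R z)))))"
  have main: "jet q (\<lambda>x. a z' * (b x * ?k z' x) - a z * (b x * ?k z x)) x \<le> ?E z'" for z' x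
  proof -
    let ?f = "\<lambda>x. (a z' - a z) * (b x * ?k z' x)" and ?g = "\<lambda>x. a z * (b x * (?k z' x - ?k z x))"
    have sfg: "(\<lambda>x. b x * ?k z' x) \<in> smooth_space" "(\<lambda>x. b x * (?k z' x - ?k z x)) \<in> smooth_space"
      by (intro smooth_space_mult smooth_space_diff sm smk)+
    have "(\<lambda>x. a z' * (b x * ?k z' x) - a z * (b x * ?k z x)) = (\<lambda>x. ?f x + ?g x)" by (simp add: algebra_simps)
    then have "jet q (\<lambda>x. a z' * (b x * ?k z' x) - a z * (b x * ?k z x)) x \<le> jet q ?f x + jet q ?g x"
      using jet_add[OF smooth_space_cmult[OF sfg(1)] smooth_space_cmult[OF sfg(2)]] by simp
    also have "jet q ?f x = norm (a z' - a z) * jet q (\<lambda>x. b x * ?k z' x) x" by (rule jet_cmult[OF sfg(1)])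
    also have "jet q ?g x = norm (a z) * jet q (\<lambda>x. b x * (?k z' x - ?k z x)) x" by (rule jet_cmult[OF sfg(2)])
    also have "jet q (\<lambda>x. b x * ?k z' x) x \<le> ?L * (B * C)"
    proof (rule order_trans[OF jet_mult[OF sm(1) smk]])
      show "?L * (jet q b x * jet q (?k z') x) \<le> ?L * (B * C)"
        by (intro mult_left_mono mult_mono B B0) (auto simp: jet_translate[OF sm(2)] C)
    qed
    also have "jet q (\<lambda>x. b x * (?k z' x - ?k z x)) x \<le> ?L * (B * (?n * (real CARD('n) * D * norm (s *\<^sub>R z' - s *\<^sub>R z))))"
    proof (rule order_trans[OF jet_mult[OF sm(1) smooth_space_diff[OF smk smk]]])
      show "?L * (jet q b x * jet q (\<lambda>x. ?k z' x - ?k z x) x) \<le> ?L * (B * (?n * (real CARD('n) * D * norm (s *\<^sub>R z' - s *\<^sub>R z))))"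
        by (intro mult_left_mono mult_mono B B0 jet_Lipschitz[OF sm(2) D]) auto
    qed
    finally show ?thesis by (simp add: mult_left_mono add_mono)
  qed
  have "((\<lambda>z'. ?E z') \<longlongrightarrow> norm (a z - a z) * (?L * (B * C)) + norm (a z) * (?L * (B * (?n * (real CARD('n) * D * norm (s *\<^sub>R z - s *\<^sub>R z)))))) (at z)"
    using a by (intro tendsto_intros) (auto simp: continuous_on_def)
  then have "(?E \<longlongrightarrow> 0) (at z)" by simp
  from tendstoD[OF this e] obtain d where d: "d > 0" "\<And>z'. z' \<noteq> z \<Longrightarrow> dist z' z < d \<Longrightarrow> dist (?E z') 0 < e"
    unfolding eventually_at by auto
  have "?E z' \<le> e" if "dist z' z < d" for z'
    using d(2)[of z'] that e by (cases "z' = z") auto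
  then show "\<exists>d>0. \<forall>z'. dist z' z < d \<longrightarrow> (\<forall>x. jet q (\<lambda>x. a z' * (b x * ?k z' x) - a z * (b x * ?k z x)) x \<le> e)"
    using d(1) main order_trans by (intro exI[of _ d]) blast
qed

section \<open>Integrable functions as elements of the dual\<close>

lemma integrable_mult_B:
  fixes g :: "real^'n::finite \<Rightarrow> complex"
  assumes g: "integrable lborel g" and \<phi>: "\<phi> \<in> B_space"
  shows "integrable lborel (\<lambda>x. g x * \<phi> x)"
proof -
  obtain C where C: "\<And>x. jet 0 \<phi> x \<le> C" using \<phi> unfolding B_space_iff by blast
  have C': "norm (\<phi> x) \<le> C" for x using norm_le_jet C by (rule order_trans)
  have m: "\<phi> \<in> borel_measurable lborel"
    using borel_measurable_continuous_onI[OF smooth_space_continuous[OF B_smooth[OF \<phi>], of "[]"]] by simp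
  show ?thesis
  proof (rule Bochner_Integration.integrable_bound)
    show "integrable lborel (\<lambda>x. C * norm (g x))" using g by simp
    show "(\<lambda>x. g x * \<phi> x) \<in> borel_measurable lborel" using g m by (intro borel_measurable_times) auto
    show "AE x in lborel. norm (g x * \<phi> x) \<le> norm (C * norm (g x))"
    proof (rule AE_I2)
      fix x
      have "norm (g x) * norm (\<phi> x) \<le> norm (g x) * C" by (intro mult_left_mono C') auto
      also have "\<dots> \<le> \<bar>C * norm (g x)\<bar>" by (simp add: mult.commute)
      finally show "norm (g x * \<phi> x) \<le> norm (C * norm (g x))" by (simp add: norm_mult)
    qed
  qed
qed

lemma fun_dist_linear:
  assumes "integrable lborel g"
  shows "linear_form_on B_space (fun_dist g)"
  unfolding linear_form_on_def fun_dist_def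
proof (intro conjI ballI allI)
  fix \<phi> \<psi> :: "real^'a \<Rightarrow> complex" and c
  assume \<phi>: "\<phi> \<in> B_space"
  show "(\<integral>x. g x * (c * \<phi> x) \<partial>lborel) = c * (\<integral>x. g x * \<phi> x \<partial>lborel)"
    by (simp add: mult.left_commute[of _ c])
  assume "\<psi> \<in> B_space"
  then show "(\<integral>x. g x * (\<phi> x + \<psi> x) \<partial>lborel) = (\<integral>x. g x * \<phi> x \<partial>lborel) + (\<integral>x. g x * \<psi> x \<partial>lborel)"
    using integrable_mult_B[OF assms] \<phi> by (simp add: distrib_left)
qed

lemma B_space_cmult: "\<phi> \<in> B_space \<Longrightarrow> (\<lambda>x. c * \<phi> x) \<in> B_space"
  by (rule B_space_mult[OF B_space_const])

lemma norm_fun_dist_le: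
  assumes g: "integrable lborel g" and \<phi>: "\<phi> \<in> B_space" and C: "\<And>x. norm (\<phi> x) \<le> C"
  shows "norm (fun_dist g \<phi>) \<le> (\<integral>x. norm (g x) \<partial>lborel) * C"
proof -
  have "norm (fun_dist g \<phi>) \<le> (\<integral>x. norm (g x * \<phi> x) \<partial>lborel)"
    unfolding fun_dist_def by (rule integral_norm_bound)
  also have "\<dots> \<le> (\<integral>x. norm (g x) * C \<partial>lborel)"
    using integrable_mult_B[OF g \<phi>] g
    by (intro integral_mono integrable_norm) (auto simp: norm_mult intro!: mult_left_mono C)
  finally show ?thesis by simp
qed

lemma integrable_in_DL1:
  fixes g :: "real^'n::finite \<Rightarrow> complex"
  assumes g: "integrable lborel g" and u: "\<And>\<phi>. \<phi> \<in> Schwartz_space \<Longrightarrow> u \<phi> = fun_dist g \<phi>"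
  shows "u \<in> DL1"
proof -
  have lin: "linear_form_on B_dot_space (fun_dist g)"
    using fun_dist_linear[OF g] B_dot_B unfolding linear_form_on_def by blast
  have "continuous_map B_dot_topology euclidean (fun_dist g)"
    unfolding B_dot_topology_def
  proof (rule continuous_map_seminorm_topology[OF lin B_dot_space_cmult B_dot_space_diff])
    show "sup_seminorm [] \<in> range sup_seminorm" by simp
    show "sup_seminorm [] (\<lambda>x :: real^'n. 0) = 0" by (simp add: sup_seminorm_def)
    show "norm (fun_dist g \<phi>) \<le> (\<integral>x. norm (g x) \<partial>lborel) * sup_seminorm [] \<phi>" if "\<phi> \<in> B_dot_space" for \<phi>
      using norm_partials_le_sup_seminorm[OF that, of "[]"] by (intro norm_fun_dist_le[OF g B_dot_B[OF that]]) simp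
  qed auto
  then have "fun_dist g \<in> B_dot_dual" using lin by (simp add: B_dot_dual_def)
  then show ?thesis unfolding DL1_def using u by blast
qed

lemma seminorm_topology_mono:
  assumes "P \<subseteq> P'" "openin (seminorm_topology V P) U"
  shows "openin (seminorm_topology V P') U"
proof -
  have "generate_topology_on
     (insert V {{\<psi> \<in> V. p (\<lambda>x. \<psi> x - \<phi> x) < \<epsilon>} | p \<phi> \<epsilon>. p \<in> P \<and> \<phi> \<in> V \<and> 0 < \<epsilon>}) U"
    using assms(2) unfolding seminorm_topology_def openin_topology_generated_by_iff .
  then have "generate_topology_on
     (insert V {{\<psi> \<in> V. p (\<lambda>x. \<psi> x - \<phi> x) < \<epsilon>} | p \<phi> \<epsilon>. p \<in> P' \<and> \<phi> \<in> V \<and> 0 < \<epsilon>}) U"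
  proof induction
    case (Basis s)
    then show ?case using assms(1) by (intro generate_topology_on.Basis) auto
  qed (auto intro: generate_topology_on.intros)
  then show ?thesis unfolding seminorm_topology_def openin_topology_generated_by_iff .
qed

lemma norm_le_local_seminorm:
  assumes "\<phi> \<in> smooth_space" "norm x \<le> real k"
  shows "norm (partials is \<phi> x) \<le> local_seminorm k is \<phi>"
  unfolding local_seminorm_def by (rule cSUP_upper[OF _ bdd_above_local]) (use assms in auto)

lemma B_bounded_uniform:
  assumes "B_bounded A"
  shows "\<exists>C. \<forall>\<phi>\<in>A. \<forall>x. norm (\<phi> x) \<le> C"
proof -
  have A: "A \<subseteq> B_space" using assms by (simp add: B_bounded_def)
  obtain C where C: "\<And>\<phi>. \<phi> \<in> A \<Longrightarrow> sup_seminorm [] \<phi> \<le> C" using assms unfolding B_bounded_def by blast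
  have "norm (\<phi> x) \<le> C" if "\<phi> \<in> A" for \<phi> x
  proof -
    have "bounded (range (partials [] \<phi>))" using A that unfolding B_space_def by blast
    then have "bdd_above (range (\<lambda>x. norm (partials [] \<phi> x)))" by (auto simp: bounded_iff bdd_above_def)
    then have "norm (partials [] \<phi> x) \<le> sup_seminorm [] \<phi>" unfolding sup_seminorm_def by (rule cSUP_upper[OF UNIV_I])
    then show ?thesis using C[OF that] by simp
  qed
  then show ?thesis by blast
qed

text \<open>
  Where \<open>\<phi>\<close> is only known to be bounded by \<open>C\<close>, outside a large ball, the integral of \<open>|g|\<close> is small.
\<close>

lemma fun_dist_small:
  fixes g :: "real^'n::finite \<Rightarrow> complex"
  assumes g: "integrable lborel g" and e: "e > 0"
  shows "\<exists>k d. d > 0 \<and> (\<forall>\<phi>\<in>B_space. (\<forall>x. norm (\<phi> x) \<le> C) \<longrightarrow> local_seminorm k [] \<phi> < d \<longrightarrow> norm (fun_dist g \<phi>) < e)"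
proof -
  define C' where "C' = \<bar>C\<bar> + 1"
  have C': "C' > 0" "C \<le> C'" by (auto simp: C'_def)
  let ?I = "\<integral>x. norm (g x) \<partial>lborel"
  have I: "?I \<ge> 0" by (rule integral_nonneg_AE) simp
  have "(\<lambda>k. \<integral>x. indicator (- cball 0 (real k)) x * norm (g x) \<partial>lborel) \<longlonglongrightarrow> 0"
    using g by (intro integral_outside_ball_tendsto integrable_norm)
  from order_tendstoD(2)[OF this, of "e / (2 * C')"] e C' obtain k
    where k: "(\<integral>x. indicator (- cball 0 (real k)) x * norm (g x) \<partial>lborel) < e / (2 * C')"
    by (auto simp: eventually_sequentially)
  define d where "d = e / (2 * (?I + 1))"
  have d: "d > 0" unfolding d_def using e I by (intro divide_pos_pos mult_pos_pos add_nonneg_pos) auto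
  have "norm (fun_dist g \<phi>) < e" if \<phi>: "\<phi> \<in> B_space" "\<And>x. norm (\<phi> x) \<le> C" "local_seminorm k [] \<phi> < d" for \<phi>
  proof -
    have ind: "integrable lborel (\<lambda>x. indicator (- cball 0 (real k)) x * norm (g x))"
      using integrable_mult_indicator[of "- cball 0 (real k)" lborel "\<lambda>x. norm (g x)"] g by simp
    have "norm (fun_dist g \<phi>) \<le> (\<integral>x. norm (g x * \<phi> x) \<partial>lborel)"
      unfolding fun_dist_def by (rule integral_norm_bound)
    also have "\<dots> \<le> (\<integral>x. d * norm (g x) + C' * (indicator (- cball 0 (real k)) x * norm (g x)) \<partial>lborel)"
    proof (rule integral_mono)
      show "integrable lborel (\<lambda>x. norm (g x * \<phi> x))" using integrable_mult_B[OF g \<phi>(1)] by simp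
      show "integrable lborel (\<lambda>x. d * norm (g x) + C' * (indicator (- cball 0 (real k)) x * norm (g x)))"
        using g ind by (intro Bochner_Integration.integrable_add integrable_mult_right) auto
      fix x
      show "norm (g x * \<phi> x) \<le> d * norm (g x) + C' * (indicator (- cball 0 (real k)) x * norm (g x))"
      proof (cases "norm x \<le> real k")
        case True
        have "norm (\<phi> x) \<le> d"
          using norm_le_local_seminorm[OF B_smooth[OF \<phi>(1)] True, of "[]"] \<phi>(3) by simp
        then have "norm (\<phi> x) * norm (g x) \<le> d * norm (g x)" by (rule mult_right_mono) simp
        then show ?thesis using True by (simp add: norm_mult mult.commute)
      next
        case False
        have "norm (\<phi> x) \<le> C'" using \<phi>(2)[of x] C' by linarith
        then have "norm (g x) * norm (\<phi> x) \<le> C' * norm (g x)" by (subst mult.commute) (rule mult_right_mono, auto)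
        moreover have "0 \<le> d * norm (g x)" using d by simp
        ultimately show ?thesis using False by (simp add: norm_mult)
      qed
    qed
    also have "\<dots> = d * ?I + C' * (\<integral>x. indicator (- cball 0 (real k)) x * norm (g x) \<partial>lborel)"
      using g ind by simp
    also have "\<dots> < e"
    proof -
      have "d * ?I \<le> d * (?I + 1)" using d by (intro mult_left_mono) auto
      also have "d * (?I + 1) = e / 2"
      proof -
        have "e / (2 * (t + 1)) * (t + 1) = e / 2" if "t \<ge> 0" for t :: real using that by (simp add: field_simps)
        then show ?thesis using I by (simp add: d_def)
      qed
      moreover have "C' * (\<integral>x. indicator (- cball 0 (real k)) x * norm (g x) \<partial>lborel) < C' * (e / (2 * C'))"
        using C' k by (intro mult_strict_left_mono) auto
      moreover have "C' * (e / (2 * C')) = e / 2" using C' by simp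
      ultimately show ?thesis by linarith
    qed
    finally show ?thesis .
  qed
  then show ?thesis using d by blast
qed

text \<open>
  Adding the seminorm \<open>|fun_dist g|\<close> to the local seminorms gives an admissible family, because on a
  bounded set the integral over the complement of a large ball is uniformly small. So this seminorm
  is one of those that generate the topology of \<open>Bc_topology\<close>.
\<close>

lemma fun_dist_Bc_continuous:
  fixes g :: "real^'n::finite \<Rightarrow> complex"
  assumes g: "integrable lborel g"
  shows "continuous_map Bc_topology euclidean (fun_dist g)"
proof -
  let ?q = "\<lambda>\<phi>. norm (fun_dist g \<phi>)"
  let ?locals = "{local_seminorm k is | k (is :: 'n list). True}"
  let ?P = "insert ?q ?locals"
  note lin = fun_dist_linear[OF g]
  have q: "seminorm_on B_space ?q"
    unfolding seminorm_on_def
    by (auto simp: linear_form_on_add[OF lin] linear_form_on_cmult[OF lin] norm_triangle_ineq norm_mult)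
  have "Bc_admissible ?P"
    unfolding Bc_admissible_def
  proof (intro conjI ballI allI impI)
    fix p assume "p \<in> ?P"
    then show "seminorm_on B_space p"
      using q Bc_admissible_local unfolding Bc_admissible_def by blast
  next
    fix A :: "(real^'n \<Rightarrow> complex) set" assume A: "B_bounded A"
    have AB: "A \<subseteq> B_space" using A by (simp add: B_bounded_def)
    have AS: "A \<subseteq> smooth_space" using AB B_space_subset by blast
    have eq0: "subtopology (seminorm_topology B_space ?locals) A = subtopology smooth_topology A"
      using Bc_admissible_local[unfolded Bc_admissible_def, THEN conjunct2, rule_format, OF A] .
    obtain C where C: "\<And>\<phi> x. \<phi> \<in> A \<Longrightarrow> norm (\<phi> x) \<le> C" using B_bounded_uniform[OF A] by blast
    show "subtopology (seminorm_topology B_space ?P) A = subtopology smooth_topology A"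
    proof (rule subtopology_eqI)
      fix U assume U: "openin (seminorm_topology B_space ?P) U"
      show "openin (subtopology smooth_topology A) (A \<inter> U)"
      proof (rule openin_seminorm_topology_subset[OF U])
        show "A \<subseteq> topspace smooth_topology" "A \<subseteq> B_space" using AS AB by (simp_all add: smooth_topology_def)
        fix p and \<phi> :: "real^'n \<Rightarrow> complex" and \<epsilon> :: real assume p: "p \<in> ?P" "\<phi> \<in> B_space" "0 < \<epsilon>"
        show "openin (subtopology smooth_topology A) (A \<inter> {\<psi> \<in> B_space. p (\<lambda>x. \<psi> x - \<phi> x) < \<epsilon>})"
        proof (cases "p \<in> ?locals")
          case True
          then have "openin (seminorm_topology B_space ?locals) {\<psi> \<in> B_space. p (\<lambda>x. \<psi> x - \<phi> x) < \<epsilon>}"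
            using p by (intro openin_seminorm_topology_ball)
          then show ?thesis unfolding eq0[symmetric] by (rule openin_subtopology_Int2)
        next
          case False
          then have pq: "p = ?q" using p by blast
          show ?thesis
          proof (subst openin_subopen, intro ballI)
            fix \<psi> assume \<psi>: "\<psi> \<in> A \<inter> {\<psi> \<in> B_space. p (\<lambda>x. \<psi> x - \<phi> x) < \<epsilon>}"
            define \<delta> where "\<delta> = \<epsilon> - ?q (\<lambda>x. \<psi> x - \<phi> x)"
            have \<delta>: "\<delta> > 0" using \<psi> pq by (simp add: \<delta>_def)
            obtain k d where kd: "d > 0" "\<And>\<omega>. \<omega> \<in> B_space \<Longrightarrow> (\<And>x. norm (\<omega> x) \<le> 2 * C) \<Longrightarrow>
                local_seminorm k [] \<omega> < d \<Longrightarrow> norm (fun_dist g \<omega>) < \<delta>"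
              using fun_dist_small[OF g \<delta>, of "2 * C"] by blast
            let ?T = "{\<omega> \<in> smooth_space. local_seminorm k [] (\<lambda>x. \<omega> x - \<psi> x) < d}"
            have "openin smooth_topology ?T"
              unfolding smooth_topology_def using \<psi> AS kd(1) by (intro openin_seminorm_topology_ball) auto
            then have "openin (subtopology smooth_topology A) (A \<inter> ?T)" by (rule openin_subtopology_Int2)
            moreover have "\<psi> \<in> A \<inter> ?T"
            proof -
              have "local_seminorm k [] (\<lambda>x. \<psi> x - \<psi> x) = 0" by (simp add: local_seminorm_def)
              then show ?thesis using \<psi> AS kd(1) by auto
            qed
            moreover have "A \<inter> ?T \<subseteq> A \<inter> {\<psi> \<in> B_space. p (\<lambda>x. \<psi> x - \<phi> x) < \<epsilon>}"
            proof
              fix \<omega> assume \<omega>: "\<omega> \<in> A \<inter> ?T"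
              have bd: "\<omega> \<in> B_space" "\<psi> \<in> B_space" using \<omega> \<psi> AB by auto
              have "norm (\<omega> x - \<psi> x) \<le> 2 * C" for x
                using norm_triangle_ineq4[of "\<omega> x" "\<psi> x"] C[of \<omega> x] C[of \<psi> x] \<omega> \<psi> by auto
              then have "norm (fun_dist g (\<lambda>x. \<omega> x - \<psi> x)) < \<delta>"
                using \<omega> by (intro kd(2) B_space_diff bd) auto
              moreover have "fun_dist g (\<lambda>x. \<omega> x - \<phi> x) = fun_dist g (\<lambda>x. \<omega> x - \<psi> x) + fun_dist g (\<lambda>x. \<psi> x - \<phi> x)"
                using linear_form_on_add[OF lin B_space_diff[OF bd] B_space_diff[OF bd(2) p(2)]] by simp
              ultimately have "?q (\<lambda>x. \<omega> x - \<phi> x) < \<epsilon>"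
                using norm_triangle_ineq[of "fun_dist g (\<lambda>x. \<omega> x - \<psi> x)" "fun_dist g (\<lambda>x. \<psi> x - \<phi> x)"]
                by (simp add: \<delta>_def)
              then show "\<omega> \<in> A \<inter> {\<psi> \<in> B_space. p (\<lambda>x. \<psi> x - \<phi> x) < \<epsilon>}" using \<omega> bd pq by simp
            qed
            ultimately show "\<exists>T. openin (subtopology smooth_topology A) T \<and> \<psi> \<in> T \<and>
                T \<subseteq> A \<inter> {\<psi> \<in> B_space. p (\<lambda>x. \<psi> x - \<phi> x) < \<epsilon>}" by blast
          qed
        qed
      qed
    next
      fix U :: "(real^'n \<Rightarrow> complex) set" assume U: "openin smooth_topology U"
      have "openin (subtopology (seminorm_topology B_space ?locals) A) (A \<inter> U)"
        unfolding eq0 using U by (rule openin_subtopology_Int2)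
      then obtain T where T: "openin (seminorm_topology B_space ?locals) T" "A \<inter> U = T \<inter> A"
        unfolding openin_subtopology by blast
      have "openin (seminorm_topology B_space ?P) T"
        using T(1) by (rule seminorm_topology_mono[rotated]) blast
      then show "openin (subtopology (seminorm_topology B_space ?P) A) (A \<inter> U)"
        unfolding openin_subtopology T(2) by blast
    qed
  qed
  then have mem: "?q \<in> Bc_seminorms" unfolding Bc_seminorms_def by blast
  show ?thesis
    unfolding Bc_topology_def
  proof (rule continuous_map_seminorm_topology[OF lin B_space_cmult B_space_diff])
    show "?q \<in> Bc_seminorms" by (rule mem)
    show "?q (\<lambda>x. 0) = 0" by (simp add: fun_dist_def)
    show "norm (fun_dist g \<phi>) \<le> 1 * ?q \<phi>" for \<phi> by simp
  qed auto
qed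

lemma cutoff_mult_Schwartz:
  assumes "\<phi> \<in> B_space"
  shows "(\<lambda>x. of_real (cutoff j x) * \<phi> x) \<in> Schwartz_space"
proof -
  have "\<exists>C N. \<forall>x. jet k \<phi> x \<le> C * (1 + norm x) ^ N" for k
  proof -
    obtain C where "\<And>x. jet k \<phi> x \<le> C" using assms unfolding B_space_iff by blast
    then show ?thesis by (intro exI[of _ C] exI[of _ 0]) simp
  qed
  from Schwartz_space_mult[OF B_smooth[OF assms] this cutoff_Schwartz] show ?thesis
    by (simp add: mult.commute)
qed

text \<open>
  The functions \<open>cutoff j \<cdot> \<phi>\<close> stay in a bounded set, on which \<open>Bc_topology\<close> is the topology of local uniform
  convergence of all derivatives. So a continuous form on \<open>B_space\<close> is determined by its values on
  \<open>Schwartz_space\<close>.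
\<close>

lemma Bc_continuous_cutoff_tendsto:
  fixes L :: "'n::finite form"
  assumes L: "continuous_map Bc_topology euclidean L" and \<phi>: "\<phi> \<in> B_space"
  shows "(\<lambda>j. L (\<lambda>x. of_real (cutoff j x) * \<phi> x)) \<longlonglongrightarrow> L \<phi>"
proof (rule topological_tendstoI)
  fix U assume U: "open U" "L \<phi> \<in> U"
  let ?p = "\<lambda>j x. of_real (cutoff j x) * \<phi> x"
  let ?A = "insert \<phi> (range ?p)"
  have pB: "?p j \<in> B_space" for j by (intro B_space_mult cutoff_B \<phi>)
  have psm: "?p j \<in> smooth_space" "\<phi> \<in> smooth_space" for j using pB \<phi> by (auto simp: B_smooth)
  have "\<exists>C. \<forall>\<psi>\<in>?A. sup_seminorm is \<psi> \<le> C" for "is"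
  proof -
    let ?k = "length is" and ?L = "leibniz_const TYPE('n) (length is)"
    obtain C where C: "C \<ge> 0" "\<And>j x. jet ?k (\<lambda>x :: real^'n. of_real (cutoff j x)) x \<le> C"
      using jet_cutoff_bounded by blast
    obtain M where M: "\<And>x. jet ?k \<phi> x \<le> M" using \<phi> unfolding B_space_iff by blast
    have "jet ?k (?p j) x \<le> ?L * (C * M)" for j x
      by (rule order_trans[OF jet_mult[OF cutoff_smooth psm(2)]]) (intro mult_left_mono mult_mono C M, auto simp: C)
    then have "norm (partials is \<psi> x) \<le> max M (?L * (C * M))" if "\<psi> \<in> ?A" for \<psi> x
      using norm_partials_le_jet[OF order_refl, of "is" \<psi> x] M[of x] that by (auto intro: order_trans max.coboundedI1 max.coboundedI2)
    then show ?thesis unfolding sup_seminorm_def by (intro exI ballI cSUP_least) auto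
  qed
  then have A: "B_bounded ?A" using pB \<phi> by (auto simp: B_bounded_def)
  let ?V = "{x \<in> topspace Bc_topology. L x \<in> U}"
  have "openin Bc_topology ?V" using L U(1) unfolding continuous_map_def by simp
  then have "openin (subtopology Bc_topology ?A) (?A \<inter> ?V)" by (rule openin_subtopology_Int2)
  also have "subtopology Bc_topology ?A = subtopology smooth_topology ?A"
    using Bc_topology_admissible A unfolding Bc_admissible_def Bc_topology_def by blast
  finally obtain W where W: "openin smooth_topology W" "?A \<inter> ?V = W \<inter> ?A"
    unfolding openin_subtopology by blast
  have "topspace Bc_topology = (B_space :: (real^'n \<Rightarrow> complex) set)" by (simp add: Bc_topology_def)
  then have "\<phi> \<in> W" using W(2) \<phi> U(2) by blast
  with W(1) have "\<exists>F \<epsilon>. finite F \<and> F \<subseteq> {local_seminorm k is | k (is :: 'n list). True} \<and> 0 < \<epsilon> \<and>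
      {\<psi> \<in> smooth_space. \<forall>p\<in>F. p (\<lambda>x. \<psi> x - \<phi> x) < \<epsilon>} \<subseteq> W"
    unfolding smooth_topology_def
    by (rule seminorm_topology_nbhd) (auto intro: smooth_space_diff seminorm_on_add[OF seminorm_on_local])
  then obtain F \<epsilon> where F: "finite F" "F \<subseteq> {local_seminorm k is | k (is :: 'n list). True}" "0 < \<epsilon>"
      "{\<psi> \<in> smooth_space. \<forall>p\<in>F. p (\<lambda>x. \<psi> x - \<phi> x) < \<epsilon>} \<subseteq> W" by blast
  have "\<forall>\<^sub>F j in sequentially. p (\<lambda>x. ?p j x - \<phi> x) < \<epsilon>" if pF: "p \<in> F" for p
  proof -
    obtain k "is" where p: "p = local_seminorm k (is :: 'n list)" using pF F(2) by blast
    let ?k = "length is" and ?L = "leibniz_const TYPE('n) (length is)"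
    obtain C where C: "C \<ge> 0" "\<And>j x. jet ?k (\<lambda>x :: real^'n. 1 - of_real (cutoff j x)) x \<le> (1 - cutoff j x) + C / 2 ^ j"
      using jet_one_minus_cutoff by blast
    obtain M where M: "\<And>x. jet ?k \<phi> x \<le> M" using \<phi> unfolding B_space_iff by blast
    have le: "local_seminorm k is (\<lambda>x. ?p j x - \<phi> x) \<le> (?L * (((real k)\<^sup>2 + C) * M)) / 2 ^ j" for j
      unfolding local_seminorm_def
    proof (rule cSUP_least)
      fix x :: "real^'n" assume x: "x \<in> cball 0 (real k)"
      have "norm (partials is (\<lambda>x. ?p j x - \<phi> x) x) \<le> jet ?k (\<lambda>x. ?p j x - \<phi> x) x"
        by (rule norm_partials_le_jet) simp
      also have "\<dots> = jet ?k (\<lambda>x. (1 - of_real (cutoff j x)) * \<phi> x) x"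
        using jet_diff_commute[OF psm, of ?k j x] by (simp add: algebra_simps)
      also have "\<dots> \<le> ?L * (jet ?k (\<lambda>x. 1 - of_real (cutoff j x)) x * jet ?k \<phi> x)"
        by (intro jet_mult smooth_space_diff smooth_space_const cutoff_smooth psm)
      also have "\<dots> \<le> ?L * ((((real k)\<^sup>2 + C) / 2 ^ j) * M)"
      proof (intro mult_left_mono mult_mono M)
        have "(norm x)\<^sup>2 \<le> (real k)\<^sup>2" using x by (intro power_mono) auto
        then have "(norm x)\<^sup>2 / 2 ^ j \<le> (real k)\<^sup>2 / 2 ^ j" by (intro divide_right_mono) auto
        then show "jet ?k (\<lambda>x. 1 - of_real (cutoff j x)) x \<le> ((real k)\<^sup>2 + C) / 2 ^ j"
          using C(2)[of j x] one_minus_cutoff_le[of j x] by (simp add: add_divide_distrib)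
      qed (use C in auto)
      finally show "norm (partials is (\<lambda>x. ?p j x - \<phi> x) x) \<le> (?L * (((real k)\<^sup>2 + C) * M)) / 2 ^ j" by simp
    qed simp
    have "(\<lambda>j. (?L * (((real k)\<^sup>2 + C) * M)) / 2 ^ j) \<longlonglongrightarrow> 0" by (rule LIMSEQ_divide_realpow_zero) simp
    from order_tendstoD(2)[OF this F(3)] show ?thesis
      unfolding p by eventually_elim (use le le_less_trans in blast)
  qed
  then have "\<forall>\<^sub>F j in sequentially. \<forall>p\<in>F. p (\<lambda>x. ?p j x - \<phi> x) < \<epsilon>"
    using F(1) by (simp add: eventually_ball_finite)
  then show "\<forall>\<^sub>F j in sequentially. L (?p j) \<in> U"
  proof eventually_elim
    case (elim j)
    then have "?p j \<in> W" using F(4) psm by auto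
    then show ?case using W(2) by blast
  qed
qed

theorem DL1_pairing_integrable:
  fixes g :: "real^'n::finite \<Rightarrow> complex"
  assumes g: "integrable lborel g" and u: "\<And>\<psi>. \<psi> \<in> Schwartz_space \<Longrightarrow> u \<psi> = fun_dist g \<psi>"
    and \<phi>: "\<phi> \<in> B_space"
  shows "DL1_pairing u \<phi> = fun_dist g \<phi>"
  unfolding DL1_pairing_def
proof (rule the_equality)
  show "\<exists>L. linear_form_on B_space L \<and> continuous_map Bc_topology euclidean L \<and>
      (\<forall>\<psi>\<in>Schwartz_space. L \<psi> = u \<psi>) \<and> L \<phi> = fun_dist g \<phi>"
    using fun_dist_linear[OF g] fun_dist_Bc_continuous[OF g] u by (intro exI[of _ "fun_dist g"]) auto
next
  fix c assume "\<exists>L. linear_form_on B_space L \<and> continuous_map Bc_topology euclidean L \<and>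
      (\<forall>\<psi>\<in>Schwartz_space. L \<psi> = u \<psi>) \<and> L \<phi> = c"
  then obtain L where L: "continuous_map Bc_topology euclidean L"
     "\<And>\<psi>. \<psi> \<in> Schwartz_space \<Longrightarrow> L \<psi> = u \<psi>" "L \<phi> = c" by blast
  have eq: "L (\<lambda>x. of_real (cutoff j x) * \<phi> x) = fun_dist g (\<lambda>x. of_real (cutoff j x) * \<phi> x)" for j
    using L(2) u cutoff_mult_Schwartz[OF \<phi>] by simp
  have "(\<lambda>j. fun_dist g (\<lambda>x. of_real (cutoff j x) * \<phi> x)) \<longlonglongrightarrow> L \<phi>"
    using Bc_continuous_cutoff_tendsto[OF L(1) \<phi>] unfolding eq .
  from LIMSEQ_unique[OF this Bc_continuous_cutoff_tendsto[OF fun_dist_Bc_continuous[OF g] \<phi>]]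
  show "c = fun_dist g \<phi>" using L(3) by simp
qed

section \<open>A continuous function is determined by its distribution\<close>

text \<open>
  Test with Gaussians of width \<open>1 / N\<close> at a point \<open>a\<close> where \<open>d\<close> does not vanish. On a ball of radius
  \<open>\<rho> / 2\<close> the Gaussian is at least \<open>exp (- N\<^sup>2 \<rho>\<^sup>2 / 4)\<close>, while outside the ball of radius \<open>\<rho>\<close> it is at most
  \<open>exp (- (N\<^sup>2 - 1) \<rho>\<^sup>2)\<close> times the Gaussian of width \<open>1\<close>, against which \<open>d\<close> is integrable.
\<close>

lemma continuous_zero_distribution:
  fixes d :: "real^'n::finite \<Rightarrow> complex"
  assumes d: "continuous_on UNIV d"
    and int: "\<And>\<phi>. \<phi> \<in> Schwartz_space \<Longrightarrow> integrable lborel (\<lambda>x. d x * \<phi> x)"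
    and zero: "\<And>\<phi>. \<phi> \<in> Schwartz_space \<Longrightarrow> (\<integral>x. d x * \<phi> x \<partial>lborel) = 0"
  shows "d a = 0"
proof (rule ccontr)
  assume nz: "d a \<noteq> 0"
  define \<gamma> where "\<gamma> N x = exp (- (real N * norm (x - a))\<^sup>2)" for N and x :: "real^'n"
  have \<gamma>_S: "(\<lambda>x. of_real (\<gamma> N x)) \<in> Schwartz_space" if "N > 0" for N
    using Schwartz_translate[OF Schwartz_dilate[OF gaussian_Schwartz, of "real N"], of "- a"] that
    by (simp add: \<gamma>_def)
  \<comment> \<open>rotated so that it is positive near \<open>a\<close>\<close>
  define e where "e x = Re (cnj (d a) * d x)" for x
  have int_e: "integrable lborel (\<lambda>x. e x * \<gamma> N x)" and zero_e: "(\<integral>x. e x * \<gamma> N x \<partial>lborel) = 0" if "N > 0" for N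
  proof -
    have i: "integrable lborel (\<lambda>x. cnj (d a) * (d x * of_real (\<gamma> N x)))"
      using int[OF \<gamma>_S[OF that]] by simp
    have eq: "Re (cnj (d a) * (d x * of_real (\<gamma> N x))) = e x * \<gamma> N x" for x
    proof -
      have "cnj (d a) * (d x * of_real (\<gamma> N x)) = (cnj (d a) * d x) * of_real (\<gamma> N x)" by (simp add: mult_ac)
      moreover have "Re (z * of_real t) = Re z * t" for z t by simp
      ultimately show ?thesis unfolding e_def by metis
    qed
    from integrable_Re[OF i] show "integrable lborel (\<lambda>x. e x * \<gamma> N x)" unfolding eq .
    from integral_Re[OF i] show "(\<integral>x. e x * \<gamma> N x \<partial>lborel) = 0"
      unfolding eq using zero[OF \<gamma>_S[OF that]] by simp
  qed
  define c where "c = e a / 2"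
  have "e a = (norm (d a))\<^sup>2" unfolding e_def cmod_power2 by (simp add: power2_eq_square)
  then have c: "c > 0" "e a = 2 * c" using nz by (simp_all add: c_def)
  have ce: "continuous_on UNIV e" unfolding e_def by (intro continuous_intros d)
  then have "\<exists>\<rho>>0. \<forall>x\<in>UNIV. dist x a < \<rho> \<longrightarrow> dist (e x) (e a) < c"
    using c(1) unfolding continuous_on_iff by blast
  then obtain \<rho> where \<rho>: "\<rho> > 0" "\<And>x. dist x a < \<rho> \<Longrightarrow> dist (e x) (e a) < c" by blast
  have e_ge: "e x \<ge> c" if "norm (x - a) < \<rho>" for x
    using \<rho>(2)[of x] that c(2) by (auto simp: dist_norm)
  define v where "v = measure lborel (ball a (\<rho> / 2))"
  have v: "v > 0" unfolding v_def using \<rho>(1) by (simp add: content_ball_pos)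
  define I where "I = (\<integral>x. \<bar>e x * \<gamma> 1 x\<bar> \<partial>lborel)"
  have *: "c * v \<le> exp (- ((3 / 4 * real N ^ 2 - 1) * \<rho>\<^sup>2)) * I" if N: "N > 0" for N
  proof -
    let ?E = "exp (- (real N ^ 2 * \<rho>\<^sup>2 / 4))" and ?F = "exp (- ((real N ^ 2 - 1) * \<rho>\<^sup>2))"
    have ball: "integrable lborel (indicator (ball a (\<rho> / 2)) :: real^'n \<Rightarrow> real)"
      by (rule integrable_real_indicator) (use emeasure_bounded_finite[OF bounded_ball, of a "\<rho> / 2"] in auto)
    have "c * ?E * v - ?F * I = (\<integral>x. c * ?E * indicator (ball a (\<rho> / 2)) x - ?F * \<bar>e x * \<gamma> 1 x\<bar> \<partial>lborel)"
      using int_e[of 1] ball by (subst Bochner_Integration.integral_diff) (auto simp: v_def I_def)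
    also have "\<dots> \<le> (\<integral>x. e x * \<gamma> N x \<partial>lborel)"
    proof (rule integral_mono)
      show "integrable lborel (\<lambda>x. c * ?E * indicator (ball a (\<rho> / 2)) x - ?F * \<bar>e x * \<gamma> 1 x\<bar>)"
        using int_e[of 1] ball by (intro Bochner_Integration.integrable_diff integrable_mult_right integrable_abs) auto
      show "integrable lborel (\<lambda>x. e x * \<gamma> N x)" by (rule int_e[OF N])
      fix x
      show "c * ?E * indicator (ball a (\<rho> / 2)) x - ?F * \<bar>e x * \<gamma> 1 x\<bar> \<le> e x * \<gamma> N x"
      proof (cases "norm (x - a) < \<rho>")
        case True
        have ex: "e x \<ge> c" by (rule e_ge[OF True])
        have F: "0 \<le> ?F * \<bar>e x * \<gamma> 1 x\<bar>" by simp
        show ?thesis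
        proof (cases "x \<in> ball a (\<rho> / 2)")
          case True
          then have "norm (x - a) \<le> \<rho> / 2" by (simp add: dist_norm norm_minus_commute)
          then have "(real N * norm (x - a))\<^sup>2 \<le> (real N * (\<rho> / 2))\<^sup>2" by (intro power_mono mult_left_mono) auto
          then have "?E \<le> \<gamma> N x" by (simp add: \<gamma>_def power_mult_distrib power_divide)
          then have "c * ?E \<le> e x * \<gamma> N x" using ex c by (intro mult_mono) auto
          moreover have ind: "indicator (ball a (\<rho> / 2)) x = (1 :: real)" using True by simp
          ultimately show ?thesis unfolding ind using F by linarith
        next
          case False
          have "0 \<le> e x * \<gamma> N x" using ex c by (simp add: \<gamma>_def)
          moreover have ind: "indicator (ball a (\<rho> / 2)) x = (0 :: real)" using False by simp
          ultimately show ?thesis unfolding ind using F by linarith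
        qed
      next
        case False
        then have "x \<notin> ball a (\<rho> / 2)" using \<rho>(1) by (simp add: dist_norm norm_minus_commute)
        moreover have "\<gamma> N x \<le> ?F * \<gamma> 1 x"
        proof -
          have "\<rho>\<^sup>2 \<le> (norm (x - a))\<^sup>2" using False \<rho>(1) by (intro power_mono) auto
          moreover have "real N ^ 2 - 1 \<ge> 0" using N by simp
          ultimately have "(real N ^ 2 - 1) * \<rho>\<^sup>2 \<le> (real N ^ 2 - 1) * (norm (x - a))\<^sup>2" by (rule mult_left_mono)
          then show ?thesis by (simp add: \<gamma>_def exp_add[symmetric] power_mult_distrib left_diff_distrib)
        qed
        then have "\<bar>e x\<bar> * \<gamma> N x \<le> \<bar>e x\<bar> * (?F * \<gamma> 1 x)" by (rule mult_left_mono) simp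
        moreover have "\<bar>e x * \<gamma> 1 x\<bar> = \<bar>e x\<bar> * \<gamma> 1 x" by (simp add: abs_mult \<gamma>_def)
        moreover have "- (\<bar>e x\<bar> * \<gamma> N x) \<le> e x * \<gamma> N x"
          using mult_right_mono[of "- \<bar>e x\<bar>" "e x" "\<gamma> N x"] by (simp add: \<gamma>_def)
        ultimately show ?thesis by (simp add: mult_ac)
      qed
    qed
    also have "\<dots> = 0" by (rule zero_e[OF N])
    finally have le: "c * ?E * v \<le> ?F * I" by simp
    have "?E * exp (- ((3 / 4 * real N ^ 2 - 1) * \<rho>\<^sup>2)) = ?F" by (simp add: exp_add[symmetric] algebra_simps)
    with le have "?E * (c * v) \<le> ?E * (exp (- ((3 / 4 * real N ^ 2 - 1) * \<rho>\<^sup>2)) * I)" by (simp add: mult_ac)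
    then show ?thesis by simp
  qed
  have bound: "c * v \<le> exp (- (\<rho>\<^sup>2 / 2)) ^ N * I" if N: "N \<ge> 2" for N
  proof -
    have two: "2 \<le> real N" using N by simp
    then have "2 * real N \<le> real N * real N" by (rule mult_right_mono) simp
    then have "real N / 2 \<le> 3 / 4 * real N ^ 2 - 1" using two unfolding power2_eq_square by linarith
    then have "real N / 2 * \<rho>\<^sup>2 \<le> (3 / 4 * real N ^ 2 - 1) * \<rho>\<^sup>2" by (rule mult_right_mono) simp
    then have "exp (- ((3 / 4 * real N ^ 2 - 1) * \<rho>\<^sup>2)) \<le> exp (real N * - (\<rho>\<^sup>2 / 2))" by simp
    also have "\<dots> = exp (- (\<rho>\<^sup>2 / 2)) ^ N" by (rule exp_of_nat_mult)
    finally have "exp (- ((3 / 4 * real N ^ 2 - 1) * \<rho>\<^sup>2)) * I \<le> exp (- (\<rho>\<^sup>2 / 2)) ^ N * I"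
      by (rule mult_right_mono) (simp add: I_def)
    moreover have "c * v \<le> exp (- ((3 / 4 * real N ^ 2 - 1) * \<rho>\<^sup>2)) * I" by (rule *) (use N in simp)
    ultimately show ?thesis by linarith
  qed
  have "(\<lambda>N. exp (- (\<rho>\<^sup>2 / 2)) ^ N * I) \<longlonglongrightarrow> 0"
    using \<rho>(1) by (intro tendsto_mult_left_zero LIMSEQ_realpow_zero) auto
  then have "c * v \<le> 0"
    by (rule LIMSEQ_le_const) (use bound in blast)
  then show False using c v by (simp add: mult_le_0_iff)
qed

lemma continuous_is_function_unique:
  assumes "continuous_on UNIV g" "is_function T g" "continuous_on UNIV h" "is_function T h"
  shows "g = h"
proof
  fix a
  have "g a - h a = 0"
  proof (rule continuous_zero_distribution)
    show "continuous_on UNIV (\<lambda>x. g x - h x)" by (intro continuous_intros assms)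
    fix \<phi> :: "real^'a \<Rightarrow> complex" assume "\<phi> \<in> Schwartz_space"
    then have "integrable lborel (\<lambda>x. g x * \<phi> x)" "integrable lborel (\<lambda>x. h x * \<phi> x)"
      "(\<integral>x. g x * \<phi> x \<partial>lborel) = (\<integral>x. h x * \<phi> x \<partial>lborel)"
      using assms(2,4) by (auto simp: is_function_def fun_dist_def)
    then show "integrable lborel (\<lambda>x. (g x - h x) * \<phi> x)" "(\<integral>x. (g x - h x) * \<phi> x \<partial>lborel) = 0"
      by (simp_all add: left_diff_distrib)
  qed
  then show "g a = h a" by simp
qed

section \<open>The weight and the Poisson kernel\<close>

abbreviation cweight :: "real \<Rightarrow> real^'n::finite \<Rightarrow> complex" where
  "cweight \<alpha> x \<equiv> complex_of_real (weight \<alpha> x)"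

abbreviation ckernel :: "real \<Rightarrow> real \<Rightarrow> real^'n::finite \<Rightarrow> complex" where
  "ckernel \<alpha> y x \<equiv> complex_of_real (poisson_kernel \<alpha> y x)"

lemma weight_pos [simp]: "0 < weight \<alpha> x"
proof -
  have "0 < 1 + (norm x)\<^sup>2" by (simp add: add_pos_nonneg)
  then show ?thesis by (simp add: weight_def)
qed

lemma weight_nonneg [simp]: "0 \<le> weight \<alpha> x"
  using weight_pos[of \<alpha> x] by (simp add: less_imp_le del: weight_pos)

lemma weight_nonzero [simp]: "weight \<alpha> x \<noteq> 0"
  using weight_pos[of \<alpha> x] by (metis less_irrefl)

lemma cweight_smooth: "(cweight \<alpha> :: real^'n::finite \<Rightarrow> complex) \<in> smooth_space"
  unfolding weight_def using radial_power_smooth[of 1] by simp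

lemma jet_weight: "\<exists>C\<ge>0. \<forall>x :: real^'n::finite. jet k (cweight \<alpha>) x \<le> C * weight \<alpha> x"
  unfolding weight_def by (rule jet_weight_power)

lemma cweight_mult_Schwartz:
  "\<phi> \<in> Schwartz_space \<Longrightarrow> (\<lambda>x :: real^'n::finite. cweight \<alpha> x * \<phi> x) \<in> Schwartz_space"
  unfolding weight_def by (rule weight_power_mult_Schwartz)

lemma weight_polynomial_bound: "\<exists>N. \<forall>x :: real^'n::finite. weight \<alpha> x \<le> (1 + norm x) ^ N"
  unfolding weight_def by (rule radial_power_polynomial_bound)

lemma weight_continuous: "continuous_on UNIV (weight \<alpha> :: real^'n::finite \<Rightarrow> real)"
proof -
  have "1 + (norm x)\<^sup>2 \<noteq> 0" for x :: "real^'n"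
    using add_pos_nonneg[of 1 "(norm x)\<^sup>2"] by simp
  then show ?thesis unfolding weight_def[abs_def] by (intro continuous_intros) auto
qed

lemma poisson_kernel_eq:
  fixes x :: "real^'n::finite"
  shows "poisson_kernel \<alpha> y x =
    (Gamma ((\<alpha> + real CARD('n) + 1) / 2) / (Gamma ((\<alpha> + 1) / 2) * pi powr (real CARD('n) / 2)) * y powr (\<alpha> + 1)) *
      (y\<^sup>2 + (norm x)\<^sup>2) powr (- ((\<alpha> + real CARD('n) + 1) / 2))"
proof -
  have "(norm x)\<^sup>2 + y\<^sup>2 = y\<^sup>2 + (norm x)\<^sup>2" by simp
  then show ?thesis unfolding poisson_kernel_def powr_minus by (simp only: divide_inverse mult.assoc)
qed

lemma ckernel_smooth:
  assumes "y > 0"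
  shows "(ckernel \<alpha> y :: real^'n::finite \<Rightarrow> complex) \<in> smooth_space"
  unfolding poisson_kernel_eq of_real_mult[of "_ * y powr (\<alpha> + 1)"]
  by (rule smooth_space_cmult[OF radial_power_smooth]) (use assms in simp)

lemma jet_kernel:
  "\<exists>C\<ge>0. \<forall>y>0. \<forall>x :: real^'n::finite. jet k (ckernel \<alpha> y) x \<le>
     C * (y powr (\<alpha> + 1) * (y\<^sup>2 + (norm x)\<^sup>2) powr (- ((\<alpha> + real CARD('n) + 1) / 2)) * (1 + 1 / y) ^ k)"
proof -
  let ?s = "- ((\<alpha> + real CARD('n) + 1) / 2)"
  let ?c = "Gamma ((\<alpha> + real CARD('n) + 1) / 2) / (Gamma ((\<alpha> + 1) / 2) * pi powr (real CARD('n) / 2))"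
  obtain C where C: "C \<ge> 0" "\<And>y x. y > 0 \<Longrightarrow>
     jet k (\<lambda>x :: real^'n. of_real ((y\<^sup>2 + (norm x)\<^sup>2) powr ?s)) x \<le> C * ((y\<^sup>2 + (norm x)\<^sup>2) powr ?s * (1 + 1 / y) ^ k)"
    using jet_radial_power[of k ?s] by blast
  have "jet k (ckernel \<alpha> y) x \<le> (\<bar>?c\<bar> * C) * (y powr (\<alpha> + 1) * (y\<^sup>2 + (norm x)\<^sup>2) powr ?s * (1 + 1 / y) ^ k)"
    if y: "y > 0" for y and x :: "real^'n"
  proof -
    have "(\<lambda>x :: real^'n. ckernel \<alpha> y x) = (\<lambda>x. of_real (?c * y powr (\<alpha> + 1)) * of_real ((y\<^sup>2 + (norm x)\<^sup>2) powr ?s))"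
      by (simp only: poisson_kernel_eq of_real_mult)
    then have "jet k (ckernel \<alpha> y) x = \<bar>?c * y powr (\<alpha> + 1)\<bar> * jet k (\<lambda>x. of_real ((y\<^sup>2 + (norm x)\<^sup>2) powr ?s)) x"
      using jet_cmult[OF radial_power_smooth[of "y\<^sup>2" ?s], of k "of_real (?c * y powr (\<alpha> + 1))" x] y
      by (simp only: norm_of_real) simp
    also have "\<dots> \<le> \<bar>?c * y powr (\<alpha> + 1)\<bar> * (C * ((y\<^sup>2 + (norm x)\<^sup>2) powr ?s * (1 + 1 / y) ^ k))"
      by (intro mult_left_mono C y) simp
    also have "\<dots> = (\<bar>?c\<bar> * C) * (y powr (\<alpha> + 1) * (y\<^sup>2 + (norm x)\<^sup>2) powr ?s * (1 + 1 / y) ^ k)"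
      by (simp add: abs_mult mult_ac)
    finally show ?thesis .
  qed
  then show ?thesis using C(1) by (intro exI[of _ "\<bar>?c\<bar> * C"]) auto
qed

lemma kernel_even: "poisson_kernel \<alpha> y (x - z) = poisson_kernel \<alpha> y (z - x)"
  by (simp add: poisson_kernel_def norm_minus_commute)

lemma ckernel_B:
  assumes y: "y > 0" and \<alpha>: "\<alpha> > -1"
  shows "(ckernel \<alpha> y :: real^'n::finite \<Rightarrow> complex) \<in> B_space"
  unfolding B_space_iff
proof (intro conjI allI)
  show "(ckernel \<alpha> y :: real^'n \<Rightarrow> complex) \<in> smooth_space" by (rule ckernel_smooth[OF y])
  fix k
  let ?s = "- ((\<alpha> + real CARD('n) + 1) / 2)"
  obtain C where C: "C \<ge> 0" "\<And>x :: real^'n. jet k (ckernel \<alpha> y) x \<le>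
     C * (y powr (\<alpha> + 1) * (y\<^sup>2 + (norm x)\<^sup>2) powr ?s * (1 + 1 / y) ^ k)"
    using jet_kernel[of k \<alpha>] y by blast
  have "jet k (ckernel \<alpha> y) x \<le> C * (y powr (\<alpha> + 1) * (y\<^sup>2) powr ?s * (1 + 1 / y) ^ k)" for x :: "real^'n"
  proof (rule order_trans[OF C(2)])
    have "(y\<^sup>2 + (norm x)\<^sup>2) powr ?s \<le> (y\<^sup>2) powr ?s"
      using y \<alpha> by (intro powr_mono2') auto
    then show "C * (y powr (\<alpha> + 1) * (y\<^sup>2 + (norm x)\<^sup>2) powr ?s * (1 + 1 / y) ^ k) \<le> C * (y powr (\<alpha> + 1) * (y\<^sup>2) powr ?s * (1 + 1 / y) ^ k)"
      using C(1) y by (intro mult_left_mono mult_right_mono) auto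
  qed
  then show "\<exists>C. \<forall>x :: real^'n. jet k (ckernel \<alpha> y) x \<le> C" by blast
qed

lemma ckernel_translate_B: "y > 0 \<Longrightarrow> \<alpha> > -1 \<Longrightarrow> (\<lambda>\<eta> :: real^'n::finite. ckernel \<alpha> y (\<eta> - z)) \<in> B_space"
  using B_space_translate[OF ckernel_B, of y \<alpha> "- z"] by simp

text \<open>The function \<open>w\<^sub>\<alpha> \<tau>\<^sub>z \<K>\<^sub>\<alpha>\<^sub>,\<^sub>y\<close> on which the extended form is evaluated.\<close>

definition weighted_kernel :: "real \<Rightarrow> real \<Rightarrow> real^'n::finite \<Rightarrow> real^'n \<Rightarrow> complex" where
  "weighted_kernel \<alpha> y z \<eta> = cweight \<alpha> \<eta> * ckernel \<alpha> y (\<eta> - z)"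

lemma weighted_kernel_smooth: "y > 0 \<Longrightarrow> weighted_kernel \<alpha> y z \<in> smooth_space"
  unfolding weighted_kernel_def[abs_def]
  using smooth_space_mult[OF cweight_smooth smooth_space_translate[OF ckernel_smooth, of y \<alpha> "- z"]] by simp

lemma jet_weighted_kernel:
  "\<exists>C\<ge>0. \<forall>y>0. \<forall>z \<eta> :: real^'n::finite. jet k (weighted_kernel \<alpha> y z) \<eta> \<le>
     C * (y powr (\<alpha> + 1) * (1 + 1 / y) ^ k *
       ((1 + (norm \<eta>)\<^sup>2) / (y\<^sup>2 + (norm (\<eta> - z))\<^sup>2)) powr ((\<alpha> + real CARD('n) + 1) / 2))"
proof -
  let ?s = "(\<alpha> + real CARD('n) + 1) / 2" and ?L = "leibniz_const TYPE('n) k"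
  obtain C where C: "C \<ge> 0" "\<And>x :: real^'n. jet k (cweight \<alpha>) x \<le> C * weight \<alpha> x"
    using jet_weight[of k \<alpha>] by blast
  obtain D where D: "D \<ge> 0" "\<And>y x :: real^'n. y > 0 \<Longrightarrow> jet k (ckernel \<alpha> y) x \<le>
     D * (y powr (\<alpha> + 1) * (y\<^sup>2 + (norm x)\<^sup>2) powr (- ?s) * (1 + 1 / y) ^ k)"
    using jet_kernel[of k \<alpha>] by blast
  have "jet k (weighted_kernel \<alpha> y z) \<eta> \<le> (?L * (C * D)) * (y powr (\<alpha> + 1) * (1 + 1 / y) ^ k *
       ((1 + (norm \<eta>)\<^sup>2) / (y\<^sup>2 + (norm (\<eta> - z))\<^sup>2)) powr ?s)" if y: "y > 0" for y and z \<eta> :: "real^'n"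
  proof -
    have sm: "(\<lambda>\<eta>. ckernel \<alpha> y (\<eta> - z)) \<in> smooth_space"
      using smooth_space_translate[OF ckernel_smooth[OF y], of \<alpha> "- z"] by simp
    have jt: "jet k (\<lambda>\<eta>. ckernel \<alpha> y (\<eta> - z)) \<eta> = jet k (ckernel \<alpha> y) (\<eta> - z)"
      using jet_translate[OF ckernel_smooth[OF y], of k \<alpha> "- z" \<eta>] by simp
    have "jet k (weighted_kernel \<alpha> y z) \<eta> \<le> ?L * (jet k (cweight \<alpha>) \<eta> * jet k (\<lambda>\<eta>. ckernel \<alpha> y (\<eta> - z)) \<eta>)"
      unfolding weighted_kernel_def[abs_def] by (rule jet_mult[OF cweight_smooth sm])
    also have "\<dots> \<le> ?L * ((C * weight \<alpha> \<eta>) * (D * (y powr (\<alpha> + 1) * (y\<^sup>2 + (norm (\<eta> - z))\<^sup>2) powr (- ?s) * (1 + 1 / y) ^ k)))"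
      unfolding jt using C D y by (intro mult_left_mono mult_mono) auto
    also have "\<dots> = (?L * (C * D)) * (y powr (\<alpha> + 1) * (1 + 1 / y) ^ k *
       ((1 + (norm \<eta>)\<^sup>2) / (y\<^sup>2 + (norm (\<eta> - z))\<^sup>2)) powr ?s)"
    proof -
      have "(a / b) powr t = a powr t * b powr (- t)" if "a \<ge> 0" "b \<ge> 0" for a b t :: real
        using that by (simp add: powr_divide powr_minus_divide)
      then have "((1 + (norm \<eta>)\<^sup>2) / (y\<^sup>2 + (norm (\<eta> - z))\<^sup>2)) powr ?s =
          weight \<alpha> \<eta> * (y\<^sup>2 + (norm (\<eta> - z))\<^sup>2) powr (- ?s)"
        unfolding weight_def by (metis add_nonneg_nonneg zero_le_one zero_le_power2)
      then show ?thesis by (simp only: mult_ac)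
    qed
    finally show ?thesis .
  qed
  then show ?thesis using C(1) D(1) by (intro exI[of _ "?L * (C * D)"]) auto
qed

lemma norm_sq_triangle:
  fixes a b :: "'a::real_normed_vector"
  shows "(norm a)\<^sup>2 \<le> 2 * (norm b)\<^sup>2 + 2 * (norm (a - b))\<^sup>2"
proof -
  have "norm a \<le> norm b + norm (a - b)" using norm_triangle_ineq[of b "a - b"] by simp
  then have "(norm a)\<^sup>2 \<le> (norm b + norm (a - b))\<^sup>2" by (rule power_mono) simp
  also have "\<dots> \<le> 2 * (norm b)\<^sup>2 + 2 * (norm (a - b))\<^sup>2"
    using sum_squares_bound[of "norm b" "norm (a - b)"] by (simp add: power2_sum)
  finally show ?thesis .
qed

lemma peetre: "1 + (norm a)\<^sup>2 \<le> 2 * (1 + (norm b)\<^sup>2) * (1 + (norm (a - b :: 'a::real_normed_vector))\<^sup>2)"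
proof -
  have "2 * (1 + (norm b)\<^sup>2) * (1 + (norm (a - b))\<^sup>2) =
      2 + 2 * (norm b)\<^sup>2 + 2 * (norm (a - b))\<^sup>2 + 2 * ((norm b)\<^sup>2 * (norm (a - b))\<^sup>2)"
    by (simp add: algebra_simps)
  moreover have "0 \<le> (norm b)\<^sup>2 * (norm (a - b))\<^sup>2" by simp
  ultimately show ?thesis using norm_sq_triangle[of a b] by linarith
qed

lemma weight_peetre:
  fixes a b :: "real^'n::finite"
  assumes "\<alpha> > -1"
  shows "weight \<alpha> a \<le> 2 powr ((\<alpha> + real CARD('n) + 1) / 2) * weight \<alpha> b * weight \<alpha> (a - b)"
proof -
  let ?s = "(\<alpha> + real CARD('n) + 1) / 2"
  have "weight \<alpha> a \<le> (2 * (1 + (norm b)\<^sup>2) * (1 + (norm (a - b))\<^sup>2)) powr ?s"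
    unfolding weight_def using assms by (intro powr_mono2 peetre) auto
  also have "\<dots> = 2 powr ?s * weight \<alpha> b * weight \<alpha> (a - b)"
  proof -
    have "(x * y * z) powr ?s = x powr ?s * y powr ?s * z powr ?s" if "0 \<le> x" "0 \<le> y" "0 \<le> z" for x y z :: real
      using that by (simp only: powr_mult mult_nonneg_nonneg)
    then show ?thesis unfolding weight_def by (simp add: add_nonneg_nonneg del: distrib_left_numeral)
  qed
  finally show ?thesis .
qed

text \<open>
  Peetre's inequality compares the weight with the kernel; for fixed \<open>y\<close> only the dependence on \<open>z\<close> matters.
\<close>

lemma jet_weighted_kernel_fixed_height:
  assumes y: "y > 0" and \<alpha>: "\<alpha> > -1"
  shows "\<exists>C\<ge>0. \<forall>z \<eta> :: real^'n::finite. jet k (weighted_kernel \<alpha> y z) \<eta> \<le> C * weight \<alpha> z"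
proof -
  let ?s = "(\<alpha> + real CARD('n) + 1) / 2"
  obtain C where C: "C \<ge> 0" "\<And>z \<eta> :: real^'n. jet k (weighted_kernel \<alpha> y z) \<eta> \<le>
     C * (y powr (\<alpha> + 1) * (1 + 1 / y) ^ k * ((1 + (norm \<eta>)\<^sup>2) / (y\<^sup>2 + (norm (\<eta> - z))\<^sup>2)) powr ?s)"
    using jet_weighted_kernel[of k \<alpha>] y by blast
  define M where "M = max 1 (1 / y\<^sup>2)"
  have M: "M \<ge> 1" "M * y\<^sup>2 \<ge> 1"
  proof -
    have "1 / y\<^sup>2 * y\<^sup>2 \<le> M * y\<^sup>2" unfolding M_def by (intro mult_right_mono) auto
    then show "M * y\<^sup>2 \<ge> 1" using y by simp
  qed (simp add: M_def)
  have "jet k (weighted_kernel \<alpha> y z) \<eta> \<le> C * (y powr (\<alpha> + 1) * (1 + 1 / y) ^ k * (2 * M) powr ?s) * weight \<alpha> z" for z \<eta> :: "real^'n"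
  proof -
    let ?q = "y\<^sup>2 + (norm (\<eta> - z))\<^sup>2"
    have q: "?q > 0" using y by (simp add: add_pos_nonneg)
    have "1 + (norm \<eta>)\<^sup>2 \<le> 2 * (1 + (norm z)\<^sup>2) * (1 + (norm (\<eta> - z))\<^sup>2)" by (rule peetre)
    also have "\<dots> \<le> 2 * (1 + (norm z)\<^sup>2) * (M * ?q)"
    proof (intro mult_left_mono)
      have "(norm (\<eta> - z))\<^sup>2 \<le> M * (norm (\<eta> - z))\<^sup>2" using M(1) mult_right_mono[of 1 M "(norm (\<eta> - z))\<^sup>2"] by simp
      then show "1 + (norm (\<eta> - z))\<^sup>2 \<le> M * ?q" using M(2) by (simp add: distrib_left)
    qed auto
    finally have "(1 + (norm \<eta>)\<^sup>2) / ?q \<le> 2 * M * (1 + (norm z)\<^sup>2)"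
      using q by (simp add: divide_le_eq mult_ac)
    then have "((1 + (norm \<eta>)\<^sup>2) / ?q) powr ?s \<le> (2 * M * (1 + (norm z)\<^sup>2)) powr ?s"
      using q \<alpha> by (intro powr_mono2) auto
    also have "\<dots> = (2 * M) powr ?s * weight \<alpha> z" using M by (simp add: weight_def powr_mult)
    finally have "C * (y powr (\<alpha> + 1) * (1 + 1 / y) ^ k * ((1 + (norm \<eta>)\<^sup>2) / ?q) powr ?s) \<le>
        C * (y powr (\<alpha> + 1) * (1 + 1 / y) ^ k * ((2 * M) powr ?s * weight \<alpha> z))"
      using C(1) y by (intro mult_left_mono) auto
    with C(2)[of z \<eta>] show ?thesis by (simp add: mult_ac)
  qed
  then show ?thesis using C(1) y
    by (intro exI[of _ "C * (y powr (\<alpha> + 1) * (1 + 1 / y) ^ k * (2 * M) powr ?s)"]) auto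
qed

lemma weighted_kernel_B:
  assumes "y > 0" "\<alpha> > -1"
  shows "weighted_kernel \<alpha> y (z :: real^'n::finite) \<in> B_space"
  unfolding B_space_iff using weighted_kernel_smooth[OF assms(1)] jet_weighted_kernel_fixed_height[OF assms] by blast

section \<open>The Poisson integral as a convolution\<close>

text \<open>
  Every Schwartz function is \<open>1 / w\<^sub>\<alpha>\<close> times a Schwartz function, so \<open>f\<close> is recovered from the form that
  represents \<open>f / w\<^sub>\<alpha>\<close>.
\<close>

lemma weighted_DL1_form:
  fixes f :: "'n::finite form"
  assumes "f \<in> weighted_DL1 \<alpha>"
  shows "\<exists>m A l. form_bound m A l \<and> (\<forall>\<phi>\<in>Schwartz_space. f \<phi> = l (\<lambda>x. cweight \<alpha> x * \<phi> x))"
proof -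
  obtain l where l: "l \<in> B_dot_dual"
    "\<And>\<phi>. \<phi> \<in> Schwartz_space \<Longrightarrow> mult_dist (\<lambda>x. complex_of_real (inverse (weight \<alpha> x))) f \<phi> = l \<phi>"
    using assms unfolding weighted_DL1_def DL1_def by blast
  have "f \<phi> = l (\<lambda>x. cweight \<alpha> x * \<phi> x)" if "\<phi> \<in> Schwartz_space" for \<phi>
  proof -
    have "complex_of_real (inverse (weight \<alpha> x)) * (cweight \<alpha> x * \<phi> x) = \<phi> x" for x
    proof -
      have "complex_of_real (inverse (weight \<alpha> x)) * cweight \<alpha> x = 1"
        using weight_pos[of \<alpha> x] unfolding of_real_mult[symmetric] by (simp del: weight_pos)
      then show ?thesis by (simp only: mult.assoc[symmetric] mult_1_left)
    qed
    then have "(\<lambda>x. complex_of_real (inverse (weight \<alpha> x)) * (cweight \<alpha> x * \<phi> x)) = \<phi>" by (rule ext)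
    then show ?thesis using l(2)[OF cweight_mult_Schwartz[OF that, of \<alpha>]] by (simp only: mult_dist_def)
  qed
  then show ?thesis using B_dot_dual_form_bound[OF l(1)] by blast
qed

lemma lborel_translate:
  fixes g :: "'a::euclidean_space \<Rightarrow> 'b::{banach, second_countable_topology}"
  assumes "g \<in> borel_measurable borel"
  shows "(\<integral>x. g (c + x) \<partial>lborel) = (\<integral>x. g x \<partial>lborel)"
  using integral_distr[of "(+) c" lborel borel g] assms by (simp add: lborel_distr_plus)

lemma nn_integral_lborel_translate:
  fixes g :: "'a::euclidean_space \<Rightarrow> ennreal"
  assumes "g \<in> borel_measurable borel"
  shows "(\<integral>\<^sup>+x. g (c + x) \<partial>lborel) = (\<integral>\<^sup>+x. g x \<partial>lborel)"
  using nn_integral_distr[of "(+) c" lborel borel g] assms by (simp add: lborel_distr_plus)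

lemma Schwartz_decay:
  fixes \<phi> :: "real^'n::finite \<Rightarrow> complex"
  assumes "\<phi> \<in> Schwartz_space"
  shows "\<exists>C\<ge>0. \<forall>x. jet k \<phi> x \<le> C * (1 / (1 + norm x) ^ N)"
proof -
  obtain C where C: "\<And>x. (1 + norm x) ^ N * jet k \<phi> x \<le> C" using assms unfolding Schwartz_space_iff by blast
  have pos: "(1 + norm x) ^ N > 0" for x :: "real^'n" by (simp add: add_pos_nonneg)
  have "C \<ge> 0" using order_trans[OF mult_nonneg_nonneg C[of 0]] by simp
  moreover have "jet k \<phi> x \<le> C * (1 / (1 + norm x) ^ N)" for x
    using C[of x] pos[of x] by (simp add: pos_le_divide_eq mult.commute)
  ultimately show ?thesis by blast
qed

lemma weight_times_Schwartz_decay: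
  fixes \<phi> :: "real^'n::finite \<Rightarrow> complex"
  assumes "\<phi> \<in> Schwartz_space"
  shows "\<exists>C\<ge>0. \<forall>x. weight \<alpha> x * jet k \<phi> x \<le> C * (1 / (1 + norm x) ^ (CARD('n) + 2))"
proof -
  obtain N where N: "\<And>x :: real^'n. weight \<alpha> x \<le> (1 + norm x) ^ N" using weight_polynomial_bound by blast
  obtain C where C: "C \<ge> 0" "\<And>x. jet k \<phi> x \<le> C * (1 / (1 + norm x) ^ (N + (CARD('n) + 2)))"
    using Schwartz_decay[OF assms] by blast
  have "weight \<alpha> x * jet k \<phi> x \<le> C * (1 / (1 + norm x) ^ (CARD('n) + 2))" for x
  proof -
    have pos: "1 + norm x > 0" by (simp add: add_pos_nonneg)
    have "weight \<alpha> x * jet k \<phi> x \<le> (1 + norm x) ^ N * (C * (1 / (1 + norm x) ^ (N + (CARD('n) + 2))))"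
      by (intro mult_mono N C) auto
    also have "\<dots> = C * (1 / (1 + norm x) ^ (CARD('n) + 2))"
      using pos by (simp add: power_add)
    finally show ?thesis .
  qed
  then show ?thesis using C(1) by blast
qed

lemma Schwartz_translate_weighted:
  assumes "\<phi> \<in> Schwartz_space"
  shows "(\<lambda>\<eta>. cweight \<alpha> \<eta> * \<phi> (\<eta> + x)) \<in> Schwartz_space"
  by (rule cweight_mult_Schwartz[OF Schwartz_translate[OF assms]])

lemma cutoff_weight_Schwartz: "(\<lambda>x :: real^'n::finite. of_real (cutoff j x) * cweight \<alpha> x) \<in> Schwartz_space"
  using cweight_mult_Schwartz[OF cutoff_Schwartz, of \<alpha> j] by (simp add: mult.commute)

lemma regularisation_continuous:
  assumes l: "form_bound m A l" and \<phi>: "\<phi> \<in> Schwartz_space"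
  shows "continuous_on UNIV (\<lambda>x. l (\<lambda>\<eta>. of_real (cutoff j \<eta>) * (cweight \<alpha> \<eta> * \<phi> (\<eta> + x))))"
proof -
  have B: "\<phi> \<in> B_space" by (intro B_dot_B Schwartz_B_dot \<phi>)
  have b: "(\<lambda>\<eta>. of_real (cutoff j \<eta>) * cweight \<alpha> \<eta>) \<in> B_space"
    by (intro B_dot_B Schwartz_B_dot cutoff_weight_Schwartz)
  have "continuous_on UNIV (\<lambda>x. l (\<lambda>\<eta>. 1 * ((of_real (cutoff j \<eta>) * cweight \<alpha> \<eta>) * \<phi> (\<eta> + 1 *\<^sub>R x))))"
  proof (rule jet_continuous_form[OF l jet_continuous_product_translate[OF continuous_on_const b B]])
    fix z
    show "(\<lambda>\<eta>. 1 * ((of_real (cutoff j \<eta>) * cweight \<alpha> \<eta>) * \<phi> (\<eta> + 1 *\<^sub>R z))) \<in> B_dot_space"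
      using B_dot_space_mult[OF b Schwartz_B_dot[OF Schwartz_translate[OF \<phi>, of z]]] by simp
  qed
  then show ?thesis by (simp add: mult.assoc)
qed

lemma regularisation_measurable:
  assumes l: "form_bound m A l" and \<phi>: "\<phi> \<in> Schwartz_space"
  shows "(\<lambda>x. l (\<lambda>\<eta>. cweight \<alpha> \<eta> * \<phi> (\<eta> + x))) \<in> borel_measurable borel"
proof (rule borel_measurable_LIMSEQ_metric)
  show "(\<lambda>x. l (\<lambda>\<eta>. of_real (cutoff j \<eta>) * (cweight \<alpha> \<eta> * \<phi> (\<eta> + x)))) \<in> borel_measurable borel" for j
    by (rule borel_measurable_continuous_onI[OF regularisation_continuous[OF l \<phi>]])
  show "(\<lambda>j. l (\<lambda>\<eta>. of_real (cutoff j \<eta>) * (cweight \<alpha> \<eta> * \<phi> (\<eta> + x)))) \<longlonglongrightarrow> l (\<lambda>\<eta>. cweight \<alpha> \<eta> * \<phi> (\<eta> + x))" for x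
    by (rule form_cutoff_tendsto[OF l Schwartz_B_dot[OF Schwartz_translate_weighted[OF \<phi>]]])
qed

text \<open>
  The weight \<open>w\<^sub>\<alpha>(\<eta>)\<close> is at most a constant times \<open>w\<^sub>\<alpha>(x) w\<^sub>\<alpha>(\<eta> + x)\<close>. So division by \<open>w\<^sub>\<alpha>(x)\<close> leaves a rapidly decreasing
  function of \<open>\<eta> + x\<close>, whose integral over \<open>x\<close> does not depend on \<open>\<eta>\<close>. That the bound is proportional to the
  norm of the form matters: it will be applied to the tails of \<open>l\<close>.
\<close>

lemma regularisation_integrable:
  fixes \<phi> :: "real^'n::finite \<Rightarrow> complex"
  assumes \<alpha>: "\<alpha> > -1" and \<phi>: "\<phi> \<in> Schwartz_space"
  shows "\<exists>M\<ge>0. \<forall>A l. form_bound m A l \<longrightarrow>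
    (\<integral>\<^sup>+x. ennreal (norm (l (\<lambda>\<eta>. cweight \<alpha> \<eta> * \<phi> (\<eta> + x))) / weight \<alpha> x) \<partial>lborel) \<le> ennreal (A * M)"
proof -
  let ?s = "(\<alpha> + real CARD('n) + 1) / 2" and ?L = "leibniz_const TYPE('n) m"
  let ?h = "\<lambda>x :: real^'n. 1 / (1 + norm x) ^ (CARD('n) + 2)"
  obtain C1 where C1: "C1 \<ge> 0" "\<And>j x. jet m (\<lambda>x :: real^'n. of_real (cutoff j x)) x \<le> C1"
    using jet_cutoff_bounded by blast
  obtain C2 where C2: "C2 \<ge> 0" "\<And>x :: real^'n. jet m (cweight \<alpha>) x \<le> C2 * weight \<alpha> x"
    using jet_weight[of m \<alpha>] by blast
  obtain C3 where C3: "C3 \<ge> 0" "\<And>x. weight \<alpha> x * jet m \<phi> x \<le> C3 * ?h x"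
    using weight_times_Schwartz_decay[OF \<phi>] by blast
  define c where "c = ?L * (?L * (C1 * C2)) * 2 powr ?s * C3"
  have c: "c \<ge> 0" using C1 C2 C3 by (simp add: c_def)
  define M where "M = c * (\<integral>x. ?h x \<partial>lborel)"
  have h0: "?h x \<ge> 0" for x by simp
  have M: "M \<ge> 0" unfolding M_def using c by (intro mult_nonneg_nonneg integral_nonneg_AE) auto
  have sm: "\<phi> \<in> smooth_space" by (rule Schwartz_smooth[OF \<phi>])
  have B: "\<phi> \<in> B_space" by (intro B_dot_B Schwartz_B_dot \<phi>)
  have "(\<integral>\<^sup>+x. ennreal (norm (l (\<lambda>\<eta>. cweight \<alpha> \<eta> * \<phi> (\<eta> + x))) / weight \<alpha> x) \<partial>lborel) \<le> ennreal (A * M)"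
    if l: "form_bound m A l" for A l
  proof (rule nn_integral_le_of_tendsto)
    let ?b = "\<lambda>j \<eta>. of_real (cutoff j \<eta>) * cweight \<alpha> \<eta>"
    let ?\<Phi> = "\<lambda>j x \<eta>. of_real (1 / weight \<alpha> x) * (?b j \<eta> * \<phi> (\<eta> + 1 *\<^sub>R x))"
    have b: "?b j \<in> B_space" for j by (intro B_dot_B Schwartz_B_dot cutoff_weight_Schwartz)
    have b\<phi>: "(\<lambda>\<eta>. ?b j \<eta> * \<phi> (\<eta> + 1 *\<^sub>R x)) \<in> B_dot_space" for j x
      using B_dot_space_mult[OF b Schwartz_B_dot[OF Schwartz_translate[OF \<phi>, of x]]] by simp
    have \<Phi>_dot: "?\<Phi> j x \<in> B_dot_space" for j x by (rule B_dot_space_cmult[OF b\<phi>])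
    have "continuous_on UNIV (\<lambda>x :: real^'n. 1 / weight \<alpha> x)"
      by (intro continuous_intros weight_continuous) (metis weight_pos less_irrefl)
    then have a: "continuous_on UNIV (\<lambda>x :: real^'n. complex_of_real (1 / weight \<alpha> x))"
      by (intro continuous_on_of_real)
    have \<Phi>_cont: "jet_continuous (?\<Phi> j)" for j by (rule jet_continuous_product_translate[OF a b B])
    have bound: "jet m (?\<Phi> j x) \<eta> \<le> c * ?h (\<eta> + x)" for j x \<eta>
    proof -
      let ?W = "2 powr ?s * weight \<alpha> x * weight \<alpha> (\<eta> + x)"
      have "weight \<alpha> \<eta> \<le> ?W"
        using weight_peetre[OF \<alpha>, of \<eta> "- x"] by (simp add: weight_def)
      then have "?L * (C1 * (C2 * weight \<alpha> \<eta>)) \<le> ?L * (C1 * (C2 * ?W))"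
        using C1 C2 by (intro mult_left_mono) auto
      moreover have "jet m (?b j) \<eta> \<le> ?L * (C1 * (C2 * weight \<alpha> \<eta>))"
        by (rule order_trans[OF jet_mult[OF cutoff_smooth cweight_smooth]]) (intro mult_left_mono mult_mono C1 C2, auto simp: C1)
      ultimately have "jet m (?b j) \<eta> \<le> ?L * (C1 * (C2 * ?W))" by linarith
      then have "?L * (jet m (?b j) \<eta> * jet m \<phi> (\<eta> + x)) \<le> ?L * ((?L * (C1 * (C2 * ?W))) * jet m \<phi> (\<eta> + x))"
        by (intro mult_left_mono mult_right_mono) auto
      moreover have "jet m (\<lambda>\<eta>. ?b j \<eta> * \<phi> (\<eta> + 1 *\<^sub>R x)) \<eta> \<le> ?L * (jet m (?b j) \<eta> * jet m \<phi> (\<eta> + x))"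
        using jet_mult[OF B_smooth[OF b] smooth_space_translate[OF sm, of x], of m j \<eta>] jet_translate[OF sm, of m x \<eta>] by simp
      ultimately have le: "jet m (\<lambda>\<eta>. ?b j \<eta> * \<phi> (\<eta> + 1 *\<^sub>R x)) \<eta> \<le> ?L * ((?L * (C1 * (C2 * ?W))) * jet m \<phi> (\<eta> + x))"
        by linarith
      have "jet m (?\<Phi> j x) \<eta> = \<bar>1 / weight \<alpha> x\<bar> * jet m (\<lambda>\<eta>. ?b j \<eta> * \<phi> (\<eta> + 1 *\<^sub>R x)) \<eta>"
        using jet_cmult[OF B_dot_smooth[OF b\<phi>], of m "of_real (1 / weight \<alpha> x)" j x \<eta>]
        by (simp only: norm_of_real)
      also have "\<dots> = (1 / weight \<alpha> x) * jet m (\<lambda>\<eta>. ?b j \<eta> * \<phi> (\<eta> + 1 *\<^sub>R x)) \<eta>" by simp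
      also have "\<dots> \<le> (1 / weight \<alpha> x) * (?L * ((?L * (C1 * (C2 * ?W))) * jet m \<phi> (\<eta> + x)))"
        by (rule mult_left_mono[OF le]) simp
      also have "\<dots> = ?L * (?L * (C1 * C2)) * 2 powr ?s * (weight \<alpha> (\<eta> + x) * jet m \<phi> (\<eta> + x))"
        using weight_pos[of \<alpha> x] by (simp add: mult_ac del: weight_pos)
      also have "\<dots> \<le> ?L * (?L * (C1 * C2)) * 2 powr ?s * (C3 * ?h (\<eta> + x))"
        using C1 C2 by (intro mult_left_mono C3) auto
      finally show ?thesis by (simp add: c_def mult_ac)
    qed
    fix j
    let ?u = "\<lambda>x. norm (l (\<lambda>\<eta>. of_real (cutoff j \<eta>) * (cweight \<alpha> \<eta> * \<phi> (\<eta> + x)))) / weight \<alpha> x"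
    have u_eq: "norm (l (?\<Phi> j x)) = ?u x" for x
      using form_cmult[OF l b\<phi>, of "of_real (1 / weight \<alpha> x)" j x] by (simp add: norm_mult norm_divide mult_ac)
    have wm: "(weight \<alpha> :: real^'n \<Rightarrow> real) \<in> borel_measurable borel"
      by (rule borel_measurable_continuous_onI[OF weight_continuous])
    have "?u \<in> borel_measurable borel"
      by (rule borel_measurable_divide[OF measurable_compose[OF
            borel_measurable_continuous_onI[OF regularisation_continuous[OF l \<phi>]] borel_measurable_norm] wm])
    then show "(\<lambda>x. ennreal (?u x)) \<in> borel_measurable lborel" by simp
    have "(\<integral>\<^sup>+x. ennreal (jet m (?\<Phi> j x) \<eta>) \<partial>lborel) \<le> ennreal M" for \<eta>
    proof -
      have "(\<integral>\<^sup>+x. ennreal (jet m (?\<Phi> j x) \<eta>) \<partial>lborel) \<le> (\<integral>\<^sup>+x. ennreal (c * ?h (\<eta> + x)) \<partial>lborel)"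
        by (intro nn_integral_mono ennreal_leI bound)
      also have "\<dots> = (\<integral>\<^sup>+x. ennreal (c * ?h x) \<partial>lborel)"
        by (rule nn_integral_lborel_translate) simp
      also have "\<dots> = ennreal (\<integral>x. c * ?h x \<partial>lborel)"
        using integrable_inverse_power_norm c by (intro nn_integral_eq_integral) (auto intro!: mult_nonneg_nonneg simp del: times_divide_eq_right mult_1_right)
      also have "(\<integral>x. c * ?h x \<partial>lborel) = M"
        unfolding M_def by (rule integral_mult_right_zero)
      finally show ?thesis .
    qed
    from form_nn_integral_le[OF l \<Phi>_cont \<Phi>_dot this M]
    show "(\<integral>\<^sup>+x. ennreal (?u x) \<partial>lborel) \<le> ennreal (A * M)" unfolding u_eq .
  next
    fix x
    have "(\<lambda>j. l (\<lambda>\<eta>. of_real (cutoff j \<eta>) * (cweight \<alpha> \<eta> * \<phi> (\<eta> + x)))) \<longlonglongrightarrow> l (\<lambda>\<eta>. cweight \<alpha> \<eta> * \<phi> (\<eta> + x))"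
      by (rule form_cutoff_tendsto[OF l Schwartz_B_dot[OF Schwartz_translate_weighted[OF \<phi>]]])
    then show "(\<lambda>j. ennreal (norm (l (\<lambda>\<eta>. of_real (cutoff j \<eta>) * (cweight \<alpha> \<eta> * \<phi> (\<eta> + x)))) / weight \<alpha> x))
       \<longlonglongrightarrow> ennreal (norm (l (\<lambda>\<eta>. cweight \<alpha> \<eta> * \<phi> (\<eta> + x))) / weight \<alpha> x)"
      by (intro tendsto_ennrealI tendsto_divide tendsto_norm tendsto_const) auto
  qed
  then show ?thesis using M by blast
qed

text \<open>
  Since \<open>w\<^sub>\<alpha> \<K>\<^sub>\<alpha>\<^sub>,\<^sub>y\<close> is bounded, the kernel times the regularisation is an integrable function. Its integral
  is the value of the convolution at \<open>\<phi>\<close>.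
\<close>

lemma kernel_regularisation_integrable:
  fixes \<phi> :: "real^'n::finite \<Rightarrow> complex"
  assumes y: "y > 0" and \<alpha>: "\<alpha> > -1" and \<phi>: "\<phi> \<in> Schwartz_space"
  shows "\<exists>M\<ge>0. \<forall>A l. form_bound m A l \<longrightarrow>
    integrable lborel (\<lambda>x. ckernel \<alpha> y x * l (\<lambda>\<eta>. cweight \<alpha> \<eta> * \<phi> (\<eta> + x))) \<and>
    norm (\<integral>x. ckernel \<alpha> y x * l (\<lambda>\<eta>. cweight \<alpha> \<eta> * \<phi> (\<eta> + x)) \<partial>lborel) \<le> A * M"
proof -
  obtain C where C: "C \<ge> 0" "\<And>z \<eta> :: real^'n. jet 0 (weighted_kernel \<alpha> y z) \<eta> \<le> C * weight \<alpha> z"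
    using jet_weighted_kernel_fixed_height[OF y \<alpha>, of 0] by blast
  have K: "norm (ckernel \<alpha> y x) \<le> C / weight \<alpha> x" for x :: "real^'n"
  proof -
    have "norm (weighted_kernel \<alpha> y 0 x) \<le> C * weight \<alpha> (0 :: real^'n)"
      using norm_le_jet C(2) by (rule order_trans)
    then have "weight \<alpha> x * norm (ckernel \<alpha> y x) \<le> C"
      by (simp add: weighted_kernel_def norm_mult) (simp add: weight_def)
    then show ?thesis using weight_pos[of \<alpha> x] by (simp add: pos_le_divide_eq mult.commute del: weight_pos)
  qed
  obtain M where M: "M \<ge> 0" "\<And>A l. form_bound m A l \<Longrightarrow>
    (\<integral>\<^sup>+x. ennreal (norm (l (\<lambda>\<eta>. cweight \<alpha> \<eta> * \<phi> (\<eta> + x))) / weight \<alpha> x) \<partial>lborel) \<le> ennreal (A * M)"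
    using regularisation_integrable[OF \<alpha> \<phi>, of m] by blast
  have Km: "(ckernel \<alpha> y :: real^'n \<Rightarrow> complex) \<in> borel_measurable borel"
    using borel_measurable_continuous_onI[OF smooth_space_continuous[OF ckernel_smooth[OF y], of "[]"]] by simp
  have "integrable lborel (\<lambda>x. ckernel \<alpha> y x * l (\<lambda>\<eta>. cweight \<alpha> \<eta> * \<phi> (\<eta> + x))) \<and>
    norm (\<integral>x. ckernel \<alpha> y x * l (\<lambda>\<eta>. cweight \<alpha> \<eta> * \<phi> (\<eta> + x)) \<partial>lborel) \<le> A * (C * M)"
    if l: "form_bound m A l" for A l
  proof -
    let ?F = "\<lambda>x. ckernel \<alpha> y x * l (\<lambda>\<eta>. cweight \<alpha> \<eta> * \<phi> (\<eta> + x))"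
    let ?r = "\<lambda>x. norm (l (\<lambda>\<eta>. cweight \<alpha> \<eta> * \<phi> (\<eta> + x))) / weight \<alpha> x"
    have A: "A \<ge> 0" by (rule form_bound_nonneg[OF l])
    have wm: "(weight \<alpha> :: real^'n \<Rightarrow> real) \<in> borel_measurable borel"
      by (rule borel_measurable_continuous_onI[OF weight_continuous])
    have rm: "?r \<in> borel_measurable borel"
      by (rule borel_measurable_divide[OF measurable_compose[OF
            regularisation_measurable[OF l \<phi>] borel_measurable_norm] wm])
    have "(\<integral>\<^sup>+x. ennreal (norm (?F x)) \<partial>lborel) \<le> (\<integral>\<^sup>+x. ennreal C * ennreal (?r x) \<partial>lborel)"
    proof (rule nn_integral_mono)
      fix x
      have "norm (?F x) \<le> (C / weight \<alpha> x) * norm (l (\<lambda>\<eta>. cweight \<alpha> \<eta> * \<phi> (\<eta> + x)))"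
        unfolding norm_mult by (intro mult_right_mono K) simp
      also have "\<dots> = C * ?r x" by simp
      finally show "ennreal (norm (?F x)) \<le> ennreal C * ennreal (?r x)"
        using C(1) by (subst ennreal_mult[symmetric]) (auto intro: ennreal_leI)
    qed
    also have "\<dots> = ennreal C * (\<integral>\<^sup>+x. ennreal (?r x) \<partial>lborel)" using rm by (intro nn_integral_cmult) auto
    also have "\<dots> \<le> ennreal C * ennreal (A * M)" by (intro mult_left_mono M(2)[OF l]) simp
    also have "\<dots> = ennreal (A * (C * M))" using C(1) A M(1) by (simp add: ennreal_mult[symmetric] mult_ac)
    finally have le: "(\<integral>\<^sup>+x. ennreal (norm (?F x)) \<partial>lborel) \<le> ennreal (A * (C * M))" .
    have Fm: "?F \<in> borel_measurable lborel"
      using Km regularisation_measurable[OF l \<phi>] by (intro borel_measurable_times) auto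
    have int: "integrable lborel ?F"
      using Fm le by (intro integrableI_bounded) (auto intro: le_less_trans)
    have "ennreal (norm (\<integral>x. ?F x \<partial>lborel)) \<le> (\<integral>\<^sup>+x. ennreal (norm (?F x)) \<partial>lborel)"
      using integral_norm_bound_ennreal[OF int] by simp
    also note le
    finally show ?thesis using int C(1) A M(1) by simp
  qed
  then show ?thesis using C(1) M(1) by (intro exI[of _ "C * M"]) auto
qed

definition poisson_function :: "real \<Rightarrow> 'n::finite form \<Rightarrow> real \<Rightarrow> real^'n \<Rightarrow> complex" where
  "poisson_function \<alpha> l y z = form_extension l (weighted_kernel \<alpha> y z)"

lemma cutoff_kernel_continuous:
  fixes l :: "'n::finite form"
  assumes l: "form_bound m A l" and y: "y > 0" and \<alpha>: "\<alpha> > -1"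
  shows "continuous_on UNIV (\<lambda>z. l (\<lambda>\<eta>. of_real (cutoff j \<eta>) * weighted_kernel \<alpha> y z \<eta>))"
proof -
  have b: "(\<lambda>\<eta> :: real^'n. of_real (cutoff j \<eta>) * cweight \<alpha> \<eta>) \<in> B_dot_space"
    by (intro Schwartz_B_dot cutoff_weight_Schwartz)
  have "continuous_on UNIV (\<lambda>z. l (\<lambda>\<eta>. 1 * ((of_real (cutoff j \<eta>) * cweight \<alpha> \<eta>) * ckernel \<alpha> y (\<eta> + (-1) *\<^sub>R z))))"
  proof (rule jet_continuous_form[OF l jet_continuous_product_translate[OF continuous_on_const B_dot_B[OF b] ckernel_B[OF y \<alpha>]]])
    fix z :: "real^'n"
    show "(\<lambda>\<eta>. 1 * ((of_real (cutoff j \<eta>) * cweight \<alpha> \<eta>) * ckernel \<alpha> y (\<eta> + (-1) *\<^sub>R z))) \<in> B_dot_space"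
      using B_dot_space_mult[OF ckernel_translate_B[OF y \<alpha>, of z] b] by (simp add: mult_ac)
  qed
  then show ?thesis by (simp add: weighted_kernel_def mult.assoc)
qed

lemma poisson_function_approx:
  assumes l: "form_bound m A l" and y: "y > 0" and \<alpha>: "\<alpha> > -1"
  shows "\<exists>C\<ge>0. \<forall>\<epsilon>>0. \<exists>J. \<forall>j\<ge>J. \<forall>z :: real^'n::finite.
    norm (poisson_function \<alpha> l y z - l (\<lambda>\<eta>. of_real (cutoff j \<eta>) * weighted_kernel \<alpha> y z \<eta>)) \<le> \<epsilon> * (C * weight \<alpha> z)"
proof -
  obtain C where C: "C \<ge> 0" "\<And>z \<eta> :: real^'n. jet m (weighted_kernel \<alpha> y z) \<eta> \<le> C * weight \<alpha> z"
    using jet_weighted_kernel_fixed_height[OF y \<alpha>, of m] by blast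
  have "\<exists>J. \<forall>j\<ge>J. \<forall>z :: real^'n.
    norm (poisson_function \<alpha> l y z - l (\<lambda>\<eta>. of_real (cutoff j \<eta>) * weighted_kernel \<alpha> y z \<eta>)) \<le> \<epsilon> * (C * weight \<alpha> z)"
    if "\<epsilon> > 0" for \<epsilon>
    unfolding poisson_function_def
    using form_extension_approx[OF l that] weighted_kernel_B[OF y \<alpha>] C(2) by blast
  then show ?thesis using C(1) by blast
qed

text \<open>
  After division by the weight the functions with the cut-off converge uniformly.
\<close>

lemma poisson_function_continuous:
  fixes l :: "'n::finite form"
  assumes l: "form_bound m A l" and y: "y > 0" and \<alpha>: "\<alpha> > -1"
  shows "continuous_on UNIV (poisson_function \<alpha> l y)"
proof -
  obtain C where C: "C \<ge> 0" "\<And>\<epsilon>. \<epsilon> > 0 \<Longrightarrow> \<exists>J. \<forall>j\<ge>J. \<forall>z :: real^'n.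
    norm (poisson_function \<alpha> l y z - l (\<lambda>\<eta>. of_real (cutoff j \<eta>) * weighted_kernel \<alpha> y z \<eta>)) \<le> \<epsilon> * (C * weight \<alpha> z)"
    using poisson_function_approx[OF l y \<alpha>] by blast
  let ?g = "\<lambda>j z. l (\<lambda>\<eta>. of_real (cutoff j \<eta>) * weighted_kernel \<alpha> y z \<eta>) / cweight \<alpha> z"
  have w: "cweight \<alpha> z \<noteq> 0" for z :: "real^'n" using weight_pos[of \<alpha> z] by (simp del: weight_pos)
  have cw: "continuous_on UNIV (cweight \<alpha> :: real^'n \<Rightarrow> complex)" by (intro continuous_on_of_real weight_continuous)
  have "uniform_limit UNIV ?g (\<lambda>z. poisson_function \<alpha> l y z / cweight \<alpha> z) sequentially"
  proof (rule uniform_limitI)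
    fix e :: real assume e: "e > 0"
    have "e / (C + 1) > 0" using e C(1) by simp
    from C(2)[OF this] obtain J where J: "\<And>j z. j \<ge> J \<Longrightarrow>
      norm (poisson_function \<alpha> l y z - l (\<lambda>\<eta>. of_real (cutoff j \<eta>) * weighted_kernel \<alpha> y z \<eta>)) \<le> e / (C + 1) * (C * weight \<alpha> z)" by blast
    have "dist (?g j z) (poisson_function \<alpha> l y z / cweight \<alpha> z) < e" if "j \<ge> J" for j z
    proof -
      have "dist (?g j z) (poisson_function \<alpha> l y z / cweight \<alpha> z) =
         norm (poisson_function \<alpha> l y z - l (\<lambda>\<eta>. of_real (cutoff j \<eta>) * weighted_kernel \<alpha> y z \<eta>)) / weight \<alpha> z"
        by (simp add: dist_norm norm_minus_commute norm_divide flip: diff_divide_distrib)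
      also have "\<dots> \<le> e / (C + 1) * C"
        using J[OF that, of z] weight_pos[of \<alpha> z] by (simp add: pos_divide_le_eq mult_ac del: weight_pos)
      also have "\<dots> < e" using e C(1) by (simp add: field_simps)
      finally show ?thesis .
    qed
    then show "\<forall>\<^sub>F j in sequentially. \<forall>z\<in>UNIV. dist (?g j z) (poisson_function \<alpha> l y z / cweight \<alpha> z) < e"
      unfolding eventually_sequentially by blast
  qed
  then have "continuous_on UNIV (\<lambda>z. poisson_function \<alpha> l y z / cweight \<alpha> z)"
    by (rule uniform_limit_theorem[rotated])
      (use w in \<open>auto intro!: always_eventually continuous_on_divide cutoff_kernel_continuous[OF l y \<alpha>] cw\<close>)
  then have "continuous_on UNIV (\<lambda>z. poisson_function \<alpha> l y z / cweight \<alpha> z * cweight \<alpha> z)"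
    by (intro continuous_on_mult cw)
  then show ?thesis using w by simp
qed

lemma Schwartz_integrable:
  fixes \<phi> :: "real^'n::finite \<Rightarrow> complex"
  assumes "\<phi> \<in> Schwartz_space"
  shows "integrable lborel (\<lambda>x. weight \<alpha> x * norm (\<phi> x))" "integrable lborel \<phi>"
proof -
  have m: "\<phi> \<in> borel_measurable borel"
    using borel_measurable_continuous_onI[OF smooth_space_continuous[OF Schwartz_smooth[OF assms], of "[]"]] by simp
  have wm: "(weight \<alpha> :: real^'n \<Rightarrow> real) \<in> borel_measurable borel"
    by (rule borel_measurable_continuous_onI[OF weight_continuous])
  obtain C where C: "C \<ge> 0" "\<And>x. weight \<alpha> x * jet 0 \<phi> x \<le> C * (1 / (1 + norm x) ^ (CARD('n) + 2))"
    using weight_times_Schwartz_decay[OF assms] by blast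
  have Ci: "integrable lborel (\<lambda>x :: real^'n. C * (1 / (1 + norm x) ^ (CARD('n) + 2)))"
    by (intro integrable_mult_right integrable_inverse_power_norm)
  show "integrable lborel (\<lambda>x. weight \<alpha> x * norm (\<phi> x))"
  proof (rule Bochner_Integration.integrable_bound[OF Ci])
    show "(\<lambda>x. weight \<alpha> x * norm (\<phi> x)) \<in> borel_measurable lborel"
      using m wm by simp
    show "AE x in lborel. norm (weight \<alpha> x * norm (\<phi> x)) \<le> norm (C * (1 / (1 + norm x) ^ (CARD('n) + 2)))"
    proof (rule AE_I2)
      fix x
      have "weight \<alpha> x * norm (\<phi> x) \<le> weight \<alpha> x * jet 0 \<phi> x" by (intro mult_left_mono norm_le_jet) simp
      also have "\<dots> \<le> C * (1 / (1 + norm x) ^ (CARD('n) + 2))" by (rule C)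
      finally show "norm (weight \<alpha> x * norm (\<phi> x)) \<le> norm (C * (1 / (1 + norm x) ^ (CARD('n) + 2)))"
        using C(1) by simp
    qed
  qed
  obtain D where D: "D \<ge> 0" "\<And>x. jet 0 \<phi> x \<le> D * (1 / (1 + norm x) ^ (CARD('n) + 2))"
    using Schwartz_decay[OF assms] by blast
  have Di: "integrable lborel (\<lambda>x :: real^'n. D * (1 / (1 + norm x) ^ (CARD('n) + 2)))"
    by (intro integrable_mult_right integrable_inverse_power_norm)
  show "integrable lborel \<phi>"
  proof (rule Bochner_Integration.integrable_bound[OF Di])
    show "\<phi> \<in> borel_measurable lborel" using m by simp
    have "norm (\<phi> x) \<le> \<bar>D * (1 / (1 + norm x) ^ (CARD('n) + 2))\<bar>" for x
      using order_trans[OF norm_le_jet[of \<phi> x 0] D(2)[of x]] abs_ge_self order_trans by blast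
    then show "AE x in lborel. norm (\<phi> x) \<le> norm (D * (1 / (1 + norm x) ^ (CARD('n) + 2)))"
      by (intro AE_I2) (simp only: real_norm_def)
  qed
qed

text \<open>
  With the cut-off in place everything decays fast enough to apply \<open>form_integral\<close> on both sides; the
  two parameter integrals are the same function, by the substitution \<open>x = z - \<eta>\<close>.
\<close>

lemma convolution_identity_cutoff:
  fixes l :: "'n::finite form"
  assumes l: "form_bound m A l" and y: "y > 0" and \<alpha>: "\<alpha> > -1" and \<phi>: "\<phi> \<in> Schwartz_space"
  shows "(\<integral>x. ckernel \<alpha> y x * l (\<lambda>\<eta>. of_real (cutoff j \<eta>) * (cweight \<alpha> \<eta> * \<phi> (\<eta> + x))) \<partial>lborel) =
    (\<integral>z. \<phi> z * l (\<lambda>\<eta>. of_real (cutoff j \<eta>) * weighted_kernel \<alpha> y z \<eta>) \<partial>lborel)"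
    and "integrable lborel (\<lambda>z. \<phi> z * l (\<lambda>\<eta>. of_real (cutoff j \<eta>) * weighted_kernel \<alpha> y z \<eta>))"
proof -
  let ?K = "ckernel \<alpha> y :: real^'n \<Rightarrow> complex"
  let ?b = "\<lambda>\<eta> :: real^'n. of_real (cutoff j \<eta>) * cweight \<alpha> \<eta>"
  let ?h = "\<lambda>x :: real^'n. 1 / (1 + norm x) ^ (CARD('n) + 2)"
  let ?\<Phi>1 = "\<lambda>x \<eta>. ?K x * (?b \<eta> * \<phi> (\<eta> + 1 *\<^sub>R x))"
  let ?\<Phi>2 = "\<lambda>z \<eta>. \<phi> z * (?b \<eta> * ?K (\<eta> + (-1) *\<^sub>R z))"
  have bS: "?b \<in> Schwartz_space" by (rule cutoff_weight_Schwartz)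
  have bdot: "?b \<in> B_dot_space" and bB: "?b \<in> B_space" by (auto intro: Schwartz_B_dot B_dot_B bS)
  have \<phi>B: "\<phi> \<in> B_space" by (intro B_dot_B Schwartz_B_dot \<phi>)
  have KB: "?K \<in> B_space" by (rule ckernel_B[OF y \<alpha>])
  have sm: "\<phi> \<in> smooth_space" "?K \<in> smooth_space" "?b \<in> smooth_space" using \<phi>B KB bB by (auto simp: B_smooth)
  have cont: "continuous_on UNIV \<phi>" "continuous_on UNIV ?K"
    using smooth_space_continuous[OF sm(1), of "[]"] smooth_space_continuous[OF sm(2), of "[]"] by auto
  have jc: "jet_continuous ?\<Phi>1" "jet_continuous ?\<Phi>2"
    by (rule jet_continuous_product_translate[OF cont(2) bB \<phi>B], rule jet_continuous_product_translate[OF cont(1) bB KB])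
  have p1: "(\<lambda>\<eta>. ?b \<eta> * \<phi> (\<eta> + 1 *\<^sub>R x)) \<in> B_dot_space" for x
    using B_dot_space_mult[OF B_space_translate[OF \<phi>B, of x] bdot] by (simp add: mult_ac)
  have p2: "(\<lambda>\<eta>. ?b \<eta> * ?K (\<eta> + (-1) *\<^sub>R z)) \<in> B_dot_space" for z
    using B_dot_space_mult[OF ckernel_translate_B[OF y \<alpha>, of z] bdot] by (simp add: mult_ac)
  have dot: "?\<Phi>1 x \<in> B_dot_space" "?\<Phi>2 z \<in> B_dot_space" for x z
    by (rule B_dot_space_cmult[OF p1], rule B_dot_space_cmult[OF p2])
  have dom1: "\<exists>h. integrable lborel h \<and> (\<forall>x \<eta>. jet k (?\<Phi>1 x) \<eta> \<le> h x)" for k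
  proof -
    let ?L = "leibniz_const TYPE('n) k" and ?N = "CARD('n) + 2"
    obtain C1 where C1: "C1 \<ge> 0" "\<And>x. jet k \<phi> x \<le> C1 * ?h x" using Schwartz_decay[OF \<phi>] by blast
    obtain C2 where C2: "C2 \<ge> 0" "\<And>x. jet k ?b x \<le> C2 * ?h x" using Schwartz_decay[OF bS] by blast
    obtain C3 where C3: "\<And>x. jet 0 ?K x \<le> C3" using KB unfolding B_space_iff by blast
    have C30: "C3 \<ge> 0" using order_trans[OF jet_nonneg C3] .
    have "jet k (?\<Phi>1 x) \<eta> \<le> (C3 * (?L * (C2 * C1))) * ?h x" for x \<eta>
    proof -
      have "jet k (?\<Phi>1 x) \<eta> = norm (?K x) * jet k (\<lambda>\<eta>. ?b \<eta> * \<phi> (\<eta> + 1 *\<^sub>R x)) \<eta>"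
        by (rule jet_cmult[OF B_dot_smooth[OF p1]])
      also have "\<dots> \<le> C3 * (?L * ((C2 * ?h \<eta>) * (C1 * ?h (\<eta> + x))))"
      proof (rule mult_mono[OF order_trans[OF norm_le_jet C3] _ C30 jet_nonneg])
        have "jet k (\<lambda>\<eta>. ?b \<eta> * \<phi> (\<eta> + 1 *\<^sub>R x)) \<eta> \<le> ?L * (jet k ?b \<eta> * jet k \<phi> (\<eta> + x))"
          using jet_mult[OF sm(3) smooth_space_translate[OF sm(1), of x], of k \<eta>] jet_translate[OF sm(1), of k x \<eta>] by simp
        also have "\<dots> \<le> ?L * ((C2 * ?h \<eta>) * (C1 * ?h (\<eta> + x)))"
          using C1 C2 by (intro mult_left_mono mult_mono) auto
        finally show "jet k (\<lambda>\<eta>. ?b \<eta> * \<phi> (\<eta> + 1 *\<^sub>R x)) \<eta> \<le> ?L * ((C2 * ?h \<eta>) * (C1 * ?h (\<eta> + x)))" .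
      qed
      also have "\<dots> = (C3 * (?L * (C2 * C1))) * (?h \<eta> * ?h (\<eta> + x))" by (simp add: mult_ac)
      also have "\<dots> \<le> (C3 * (?L * (C2 * C1))) * ?h x"
      proof (rule mult_left_mono)
        have pos: "0 < 1 + norm v" for v :: "real^'n" by (simp add: add_pos_nonneg)
        have "norm x \<le> norm (\<eta> + x) + norm \<eta>" using norm_triangle_ineq4[of "\<eta> + x" \<eta>] by simp
        then have "1 + norm x \<le> (1 + norm \<eta>) * (1 + norm (\<eta> + x))"
        proof -
          have "(1 + norm \<eta>) * (1 + norm (\<eta> + x)) = 1 + norm \<eta> + norm (\<eta> + x) + norm \<eta> * norm (\<eta> + x)"
            by (simp add: algebra_simps)
          moreover have "0 \<le> norm \<eta> * norm (\<eta> + x)" by simp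
          ultimately show ?thesis using \<open>norm x \<le> norm (\<eta> + x) + norm \<eta>\<close> by linarith
        qed
        then have "(1 + norm x) ^ ?N \<le> ((1 + norm \<eta>) * (1 + norm (\<eta> + x))) ^ ?N" by (rule power_mono) simp
        then have "1 / ((1 + norm \<eta>) * (1 + norm (\<eta> + x))) ^ ?N \<le> 1 / (1 + norm x) ^ ?N"
          using pos by (intro divide_left_mono mult_pos_pos zero_less_power) auto
        then show "?h \<eta> * ?h (\<eta> + x) \<le> ?h x" by (simp only: power_mult_distrib times_divide_times_eq mult_1_left)
      qed (use C1 C2 C30 in auto)
      finally show ?thesis .
    qed
    moreover have "integrable lborel (\<lambda>x. (C3 * (?L * (C2 * C1))) * ?h x)"
      by (intro integrable_mult_right integrable_inverse_power_norm)
    ultimately show ?thesis by blast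
  qed
  have dom2: "\<exists>h. integrable lborel h \<and> (\<forall>z \<eta>. jet k (?\<Phi>2 z) \<eta> \<le> h z)" for k
  proof -
    let ?L = "leibniz_const TYPE('n) k"
    obtain C2 where C2: "\<And>x. jet k ?b x \<le> C2" using bB unfolding B_space_iff by blast
    obtain C3 where C3: "\<And>x. jet k ?K x \<le> C3" using KB unfolding B_space_iff by blast
    have C20: "C2 \<ge> 0" using order_trans[OF jet_nonneg C2] .
    have "jet k (?\<Phi>2 z) \<eta> \<le> norm (\<phi> z) * (?L * (C2 * C3))" for z \<eta>
    proof -
      have "jet k (?\<Phi>2 z) \<eta> = norm (\<phi> z) * jet k (\<lambda>\<eta>. ?b \<eta> * ?K (\<eta> + (-1) *\<^sub>R z)) \<eta>"
        by (rule jet_cmult[OF B_dot_smooth[OF p2]])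
      also have "\<dots> \<le> norm (\<phi> z) * (?L * (C2 * C3))"
      proof (rule mult_left_mono)
        have "jet k (\<lambda>\<eta>. ?b \<eta> * ?K (\<eta> + (-1) *\<^sub>R z)) \<eta> \<le> ?L * (jet k ?b \<eta> * jet k ?K (\<eta> + (-1) *\<^sub>R z))"
          using jet_mult[OF sm(3) smooth_space_translate[OF sm(2), of "(-1) *\<^sub>R z"], of k \<eta>] jet_translate[OF sm(2), of k "(-1) *\<^sub>R z" \<eta>] by simp
        also have "\<dots> \<le> ?L * (C2 * C3)" by (intro mult_left_mono mult_mono C2 C3 C20) auto
        finally show "jet k (\<lambda>\<eta>. ?b \<eta> * ?K (\<eta> + (-1) *\<^sub>R z)) \<eta> \<le> ?L * (C2 * C3)" .
      qed simp
      finally show ?thesis .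
    qed
    moreover have "integrable lborel (\<lambda>z. norm (\<phi> z) * (?L * (C2 * C3)))"
      by (intro integrable_mult_left integrable_norm Schwartz_integrable(2)[OF \<phi>])
    ultimately show ?thesis by blast
  qed
  have e1: "l (?\<Phi>1 x) = ?K x * l (\<lambda>\<eta>. of_real (cutoff j \<eta>) * (cweight \<alpha> \<eta> * \<phi> (\<eta> + x)))" for x
    using form_cmult[OF l p1, of "?K x" x] by (simp add: mult.assoc)
  have e2: "l (?\<Phi>2 z) = \<phi> z * l (\<lambda>\<eta>. of_real (cutoff j \<eta>) * weighted_kernel \<alpha> y z \<eta>)" for z
    using form_cmult[OF l p2, of "\<phi> z" z] by (simp add: mult.assoc weighted_kernel_def)
  have same: "(\<integral>x. ?\<Phi>1 x \<eta> \<partial>lborel) = (\<integral>z. ?\<Phi>2 z \<eta> \<partial>lborel)" for \<eta>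
  proof -
    have m: "(\<lambda>z. ?K (z - \<eta>) * (?b \<eta> * \<phi> z)) \<in> borel_measurable borel"
      by (intro borel_measurable_continuous_onI continuous_on_mult continuous_on_const cont(1)
          continuous_on_compose2[OF cont(2)] continuous_intros) auto
    have "(\<integral>x. ?\<Phi>1 x \<eta> \<partial>lborel) = (\<integral>x. ?K ((\<eta> + x) - \<eta>) * (?b \<eta> * \<phi> (\<eta> + x)) \<partial>lborel)" by simp
    also have "\<dots> = (\<integral>z. ?K (z - \<eta>) * (?b \<eta> * \<phi> z) \<partial>lborel)" by (rule lborel_translate[OF m])
    also have "\<dots> = (\<integral>z. ?\<Phi>2 z \<eta> \<partial>lborel)" by (simp add: kernel_even[of _ _ _ \<eta>] mult_ac)
    finally show ?thesis .
  qed
  note I1 = form_integral[OF l jc(1) dot(1) dom1] and I2 = form_integral[OF l jc(2) dot(2) dom2]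
  have "(\<integral>x. l (?\<Phi>1 x) \<partial>lborel) = (\<integral>z. l (?\<Phi>2 z) \<partial>lborel)"
    unfolding I1(3)[symmetric] I2(3)[symmetric] same ..
  then show "(\<integral>x. ?K x * l (\<lambda>\<eta>. of_real (cutoff j \<eta>) * (cweight \<alpha> \<eta> * \<phi> (\<eta> + x))) \<partial>lborel) =
    (\<integral>z. \<phi> z * l (\<lambda>\<eta>. of_real (cutoff j \<eta>) * weighted_kernel \<alpha> y z \<eta>) \<partial>lborel)"
    unfolding e1 e2 .
  show "integrable lborel (\<lambda>z. \<phi> z * l (\<lambda>\<eta>. of_real (cutoff j \<eta>) * weighted_kernel \<alpha> y z \<eta>))"
    using I2(2) unfolding e2 .
qed

text \<open>
  Removing the cut-off: on the left the error is the same integral for a tail of \<open>l\<close>, hence small by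
  the bound that is proportional to the norm of the form; on the right the extension is approximated
  uniformly relative to the weight.
\<close>

lemma convolution_identity:
  fixes l :: "'n::finite form"
  assumes l: "form_bound m A l" and y: "y > 0" and \<alpha>: "\<alpha> > -1" and \<phi>: "\<phi> \<in> Schwartz_space"
  shows "integrable lborel (\<lambda>z. poisson_function \<alpha> l y z * \<phi> z)"
    and "(\<integral>x. ckernel \<alpha> y x * l (\<lambda>\<eta>. cweight \<alpha> \<eta> * \<phi> (\<eta> + x)) \<partial>lborel) =
      (\<integral>z. poisson_function \<alpha> l y z * \<phi> z \<partial>lborel)"
proof -
  let ?G = "poisson_function \<alpha> l y"
  let ?Gj = "\<lambda>j z. l (\<lambda>\<eta>. of_real (cutoff j \<eta>) * weighted_kernel \<alpha> y z \<eta>)"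
  let ?W = "\<integral>z. weight \<alpha> z * norm (\<phi> z) \<partial>lborel"
  have W: "?W \<ge> 0" by (rule integral_nonneg_AE) simp
  have wi: "integrable lborel (\<lambda>z. weight \<alpha> z * norm (\<phi> z))" by (rule Schwartz_integrable[OF \<phi>])
  obtain C where C: "C \<ge> 0" "\<And>\<epsilon>. \<epsilon> > 0 \<Longrightarrow> \<exists>J. \<forall>j\<ge>J. \<forall>z :: real^'n. norm (?G z - ?Gj j z) \<le> \<epsilon> * (C * weight \<alpha> z)"
    using poisson_function_approx[OF l y \<alpha>] by blast
  obtain M where M: "M \<ge> 0" "\<And>A l. form_bound m A l \<Longrightarrow>
    integrable lborel (\<lambda>x. ckernel \<alpha> y x * l (\<lambda>\<eta>. cweight \<alpha> \<eta> * \<phi> (\<eta> + x))) \<and>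
    norm (\<integral>x. ckernel \<alpha> y x * l (\<lambda>\<eta>. cweight \<alpha> \<eta> * \<phi> (\<eta> + x)) \<partial>lborel) \<le> A * M"
    using kernel_regularisation_integrable[OF y \<alpha> \<phi>, of m] by blast
  have \<phi>c: "continuous_on UNIV \<phi>" using smooth_space_continuous[OF Schwartz_smooth[OF \<phi>], of "[]"] by simp
  have Gjc: "continuous_on UNIV (?Gj j)" for j by (rule cutoff_kernel_continuous[OF l y \<alpha>])
  have dm: "(\<lambda>z. (?G z - ?Gj j z) * \<phi> z) \<in> borel_measurable lborel" for j
    using borel_measurable_continuous_onI[OF continuous_on_mult[OF continuous_on_diff[OF poisson_function_continuous[OF l y \<alpha>] Gjc] \<phi>c]]
    by simp
  have diff: "integrable lborel (\<lambda>z. (?G z - ?Gj j z) * \<phi> z)"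
      "norm (\<integral>z. (?G z - ?Gj j z) * \<phi> z \<partial>lborel) \<le> \<epsilon> * (C * ?W)"
    if le: "\<And>z. norm (?G z - ?Gj j z) \<le> \<epsilon> * (C * weight \<alpha> z)" for j \<epsilon>
  proof -
    have le': "norm ((?G z - ?Gj j z) * \<phi> z) \<le> (\<epsilon> * C) * (weight \<alpha> z * norm (\<phi> z))" for z
      using mult_right_mono[OF le[of z] norm_ge_zero[of "\<phi> z"]] by (simp add: norm_mult mult_ac)
    have bi: "integrable lborel (\<lambda>z. (\<epsilon> * C) * (weight \<alpha> z * norm (\<phi> z)))" by (intro integrable_mult_right wi)
    show i: "integrable lborel (\<lambda>z. (?G z - ?Gj j z) * \<phi> z)"
    proof (rule Bochner_Integration.integrable_bound[OF bi dm])
      have "norm ((?G z - ?Gj j z) * \<phi> z) \<le> norm ((\<epsilon> * C) * (weight \<alpha> z * norm (\<phi> z)))" for z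
        using le'[of z] abs_ge_self[of "(\<epsilon> * C) * (weight \<alpha> z * norm (\<phi> z))"] unfolding real_norm_def by linarith
      then show "AE z in lborel. norm ((?G z - ?Gj j z) * \<phi> z) \<le> norm ((\<epsilon> * C) * (weight \<alpha> z * norm (\<phi> z)))" by simp
    qed
    have "norm (\<integral>z. (?G z - ?Gj j z) * \<phi> z \<partial>lborel) \<le> (\<integral>z. norm ((?G z - ?Gj j z) * \<phi> z) \<partial>lborel)"
      by (rule integral_norm_bound)
    also have "\<dots> \<le> (\<integral>z. (\<epsilon> * C) * (weight \<alpha> z * norm (\<phi> z)) \<partial>lborel)"
      by (rule integral_mono[OF integrable_norm[OF i] bi le'])
    also have "\<dots> = \<epsilon> * (C * ?W)" by simp
    finally show "norm (\<integral>z. (?G z - ?Gj j z) * \<phi> z \<partial>lborel) \<le> \<epsilon> * (C * ?W)" .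
  qed
  have Gj_int: "integrable lborel (\<lambda>z. ?Gj j z * \<phi> z)" for j
    using convolution_identity_cutoff(2)[OF l y \<alpha> \<phi>, of j] by (simp add: mult.commute)
  show G_int: "integrable lborel (\<lambda>z. ?G z * \<phi> z)"
  proof -
    obtain j where "\<And>z. norm (?G z - ?Gj j z) \<le> 1 * (C * weight \<alpha> z)" using C(2)[of 1] by auto
    from Bochner_Integration.integrable_add[OF diff(1)[OF this] Gj_int[of j]]
    show ?thesis by (simp add: left_diff_distrib)
  qed
  let ?T = "\<integral>x. ckernel \<alpha> y x * l (\<lambda>\<eta>. cweight \<alpha> \<eta> * \<phi> (\<eta> + x)) \<partial>lborel"
  have "norm (?T - (\<integral>z. ?G z * \<phi> z \<partial>lborel)) \<le> 0"
  proof (rule field_le_epsilon)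
    fix e :: real assume e: "e > 0"
    define \<epsilon> where "\<epsilon> = e / (M + C * ?W + 1)"
    have pos: "M + C * ?W + 1 > 0" using M(1) C(1) W by (simp add: add_nonneg_pos)
    have \<epsilon>: "\<epsilon> > 0" using e pos by (simp add: \<epsilon>_def)
    obtain J1 where J1: "\<And>j z. j \<ge> J1 \<Longrightarrow> norm (?G z - ?Gj j z) \<le> \<epsilon> * (C * weight \<alpha> z)" using C(2)[OF \<epsilon>] by blast
    obtain J2 where J2: "\<And>j. j \<ge> J2 \<Longrightarrow> form_bound m \<epsilon> (\<lambda>\<psi>. l (\<lambda>x. (1 - of_real (cutoff j x)) * \<psi> x))"
      using form_tail[OF l \<epsilon>] by blast
    define j where "j = max J1 J2"
    let ?l = "\<lambda>\<psi>. l (\<lambda>x. (1 - of_real (cutoff j x)) * \<psi> x)"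
    have fb: "form_bound m \<epsilon> ?l" by (rule J2) (simp add: j_def)
    let ?p = "\<lambda>x \<eta>. cweight \<alpha> \<eta> * \<phi> (\<eta> + x)"
    have tail: "?l (?p x) = l (?p x) - l (\<lambda>\<eta>. of_real (cutoff j \<eta>) * ?p x \<eta>)" for x
    proof -
      have p: "?p x \<in> B_dot_space" by (rule Schwartz_B_dot[OF Schwartz_translate_weighted[OF \<phi>]])
      have "l (\<lambda>\<eta>. ?p x \<eta> - of_real (cutoff j \<eta>) * ?p x \<eta>) = l (?p x) - l (\<lambda>\<eta>. of_real (cutoff j \<eta>) * ?p x \<eta>)"
        by (rule form_diff[OF l p cutoff_mult_B_dot[OF B_dot_B[OF p]]])
      moreover have "(\<lambda>\<eta>. ?p x \<eta> - of_real (cutoff j \<eta>) * ?p x \<eta>) = (\<lambda>\<eta>. (1 - of_real (cutoff j \<eta>)) * ?p x \<eta>)"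
        by (simp add: left_diff_distrib)
      ultimately show ?thesis by simp
    qed
    have i1: "integrable lborel (\<lambda>x. ckernel \<alpha> y x * l (?p x))" using M(2)[OF l] by blast
    have i2: "integrable lborel (\<lambda>x. ckernel \<alpha> y x * ?l (?p x))" using M(2)[OF fb] by blast
    have "?T - (\<integral>x. ckernel \<alpha> y x * l (\<lambda>\<eta>. of_real (cutoff j \<eta>) * ?p x \<eta>) \<partial>lborel) = (\<integral>x. ckernel \<alpha> y x * ?l (?p x) \<partial>lborel)"
    proof -
      have eq: "ckernel \<alpha> y x * l (\<lambda>\<eta>. of_real (cutoff j \<eta>) * ?p x \<eta>) = ckernel \<alpha> y x * l (?p x) - ckernel \<alpha> y x * ?l (?p x)" for x
        unfolding tail by (simp add: right_diff_distrib)
      show ?thesis unfolding eq using Bochner_Integration.integral_diff[OF i1 i2] by simp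
    qed
    then have t1: "norm (?T - (\<integral>z. ?Gj j z * \<phi> z \<partial>lborel)) \<le> \<epsilon> * M"
      using M(2)[OF fb] convolution_identity_cutoff(1)[OF l y \<alpha> \<phi>, of j] by (simp add: mult.commute)
    have "(\<integral>z. ?G z * \<phi> z \<partial>lborel) - (\<integral>z. ?Gj j z * \<phi> z \<partial>lborel) = (\<integral>z. (?G z - ?Gj j z) * \<phi> z \<partial>lborel)"
      using G_int Gj_int[of j] by (simp add: left_diff_distrib)
    then have t2: "norm ((\<integral>z. ?G z * \<phi> z \<partial>lborel) - (\<integral>z. ?Gj j z * \<phi> z \<partial>lborel)) \<le> \<epsilon> * (C * ?W)"
      using diff(2)[of j \<epsilon>] J1[of j] by (simp add: j_def)
    have "norm (?T - (\<integral>z. ?G z * \<phi> z \<partial>lborel)) \<le> \<epsilon> * M + \<epsilon> * (C * ?W)"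
      using norm_triangle_ineq4[of "?T - (\<integral>z. ?Gj j z * \<phi> z \<partial>lborel)" "(\<integral>z. ?G z * \<phi> z \<partial>lborel) - (\<integral>z. ?Gj j z * \<phi> z \<partial>lborel)"] t1 t2
      by simp
    also have "\<dots> = \<epsilon> * (M + C * ?W)" by (simp add: distrib_left)
    also have "\<dots> \<le> \<epsilon> * (M + C * ?W + 1)" using \<epsilon> by (intro mult_left_mono) auto
    also have "\<dots> = e"
    proof -
      have "e / t * t = e" if "t > 0" for t :: real using that by simp
      then show ?thesis unfolding \<epsilon>_def using pos by blast
    qed
    finally show "norm (?T - (\<integral>z. ?G z * \<phi> z \<partial>lborel)) \<le> 0 + e" by simp
  qed
  then show "?T = (\<integral>z. ?G z * \<phi> z \<partial>lborel)" by simp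
qed

text \<open>
  The convolution exists, is given by \<open>poisson_function\<close>, and this is the only continuous function
  that represents it.
\<close>

theorem poisson_integral_eq:
  fixes f :: "'n::finite form"
  assumes f: "\<And>\<phi>. \<phi> \<in> Schwartz_space \<Longrightarrow> f \<phi> = l (\<lambda>x. cweight \<alpha> x * \<phi> x)"
    and l: "form_bound m A l" and y: "y > 0" and \<alpha>: "\<alpha> > -1"
  shows "poisson_integral \<alpha> f x y = poisson_function \<alpha> l y x"
proof -
  let ?K = "ckernel \<alpha> y :: real^'n \<Rightarrow> complex"
  let ?g = "\<lambda>\<phi> x. ?K x * l (\<lambda>\<eta>. cweight \<alpha> \<eta> * \<phi> (\<eta> + x))"
  let ?u = "\<lambda>\<phi>. mult_dist (reflected_conv f \<phi>) (fun_dist ?K)"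
  have u: "?u \<phi> \<psi> = fun_dist (?g \<phi>) \<psi>" if "\<phi> \<in> Schwartz_space" for \<phi> \<psi>
    using f[OF Schwartz_translate[OF that]]
    by (simp add: mult_dist_def reflected_conv_def fun_dist_def translate_def mult.assoc)
  have int: "integrable lborel (?g \<phi>)" if "\<phi> \<in> Schwartz_space" for \<phi>
    using kernel_regularisation_integrable[OF y \<alpha> that, of m] l by blast
  have conv: "S_convolvable (fun_dist ?K) f"
    unfolding S_convolvable_def
  proof
    fix \<phi> :: "real^'n \<Rightarrow> complex" assume \<phi>: "\<phi> \<in> Schwartz_space"
    show "?u \<phi> \<in> DL1" by (rule integrable_in_DL1[OF int[OF \<phi>] u[OF \<phi>]])
  qed
  have fn: "is_function (S_conv (fun_dist ?K) f) (poisson_function \<alpha> l y)"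
    unfolding is_function_def
  proof (intro ballI conjI)
    fix \<phi> :: "real^'n \<Rightarrow> complex" assume \<phi>: "\<phi> \<in> Schwartz_space"
    show "integrable lborel (\<lambda>x. poisson_function \<alpha> l y x * \<phi> x)" by (rule convolution_identity(1)[OF l y \<alpha> \<phi>])
    have "S_conv (fun_dist ?K) f \<phi> = DL1_pairing (?u \<phi>) (\<lambda>_. 1)" using conv by (simp add: S_conv_def)
    also have "\<dots> = fun_dist (?g \<phi>) (\<lambda>_. 1)"
      by (rule DL1_pairing_integrable[OF int[OF \<phi>] u[OF \<phi>] B_space_const])
    also have "\<dots> = fun_dist (poisson_function \<alpha> l y) \<phi>"
      using convolution_identity(2)[OF l y \<alpha> \<phi>] by (simp add: fun_dist_def)
    finally show "S_conv (fun_dist ?K) f \<phi> = fun_dist (poisson_function \<alpha> l y) \<phi>" .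
  qed
  note cont = poisson_function_continuous[OF l y \<alpha>]
  have "(THE g. continuous_on UNIV g \<and> is_function (S_conv (fun_dist ?K) f) g) = poisson_function \<alpha> l y"
    by (rule the_equality) (use cont fn continuous_is_function_unique in blast)+
  then show ?thesis by (simp add: poisson_integral_def)
qed

section \<open>The growth estimate\<close>

lemma cos_polar_angle:
  assumes "(x, y) \<in> half_sphere r" "r > 0"
  shows "cos (polar_angle x y) = y / r"
proof -
  have xy: "y > 0" "(norm x)\<^sup>2 + y\<^sup>2 = r\<^sup>2" using assms by (auto simp: half_sphere_def)
  have r: "sqrt ((norm x)\<^sup>2 + y\<^sup>2) = r" using xy assms(2) by simp
  have yr: "0 < y / r" "y / r \<le> 1"
  proof -
    have "0 \<le> (norm x)\<^sup>2" by simp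
    then have "y\<^sup>2 \<le> r\<^sup>2" using xy(2) by linarith
    then have "y \<le> r" by (rule power2_le_imp_le) (use assms(2) in simp)
    then show "y / r \<le> 1" using assms(2) by simp
  qed (use xy assms in simp)
  define \<theta> where "\<theta> = arccos (y / r)"
  have c: "cos \<theta> = y / r" unfolding \<theta>_def using yr by (intro cos_arccos) auto
  have \<theta>: "0 \<le> \<theta>" "\<theta> < pi / 2"
  proof -
    show "0 \<le> \<theta>" unfolding \<theta>_def using yr by (intro arccos_lbound) auto
    show "\<theta> < pi / 2" unfolding \<theta>_def using arccos_less_arccos[of 0 "y / r"] yr by simp
  qed
  have s: "norm x = r * sin \<theta>"
  proof (rule power2_eq_imp_eq)
    have "(r * sin \<theta>)\<^sup>2 = r\<^sup>2 - (r * cos \<theta>)\<^sup>2" by (simp add: power_mult_distrib sin_squared_eq right_diff_distrib)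
    also have "r * cos \<theta> = y" using c assms(2) by simp
    finally show "(norm x)\<^sup>2 = (r * sin \<theta>)\<^sup>2" using xy by simp
    show "0 \<le> r * sin \<theta>" using \<theta> assms(2) by (intro mult_nonneg_nonneg sin_ge_zero) auto
  qed simp
  have "polar_angle x y = \<theta>"
    unfolding polar_angle_def r
  proof (rule the_equality)
    show "0 \<le> \<theta> \<and> \<theta> < pi / 2 \<and> y = r * cos \<theta> \<and> norm x = r * sin \<theta>" using \<theta> c s assms(2) by simp
    fix t assume t: "0 \<le> t \<and> t < pi / 2 \<and> y = r * cos t \<and> norm x = r * sin t"
    then have "cos t = cos \<theta>" using c assms(2) by simp
    then show "t = \<theta>" by (rule cos_inj_pi[rotated -1]) (use t \<theta> in auto)
  qed
  then show ?thesis using c by simp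
qed

text \<open>
  For \<open>r \<ge> 1\<close> a derivative of the kernel costs a factor \<open>1 + 1 / y\<close>, and a factor \<open>cos \<theta> = y / r\<close>
  compensates it. This is why the order of the form enters the exponent of the cosine.
\<close>

lemma half_sphere_height:
  assumes "r \<ge> 1" "(norm x)\<^sup>2 + y\<^sup>2 = r\<^sup>2" "y > 0"
  shows "y \<le> r" "(1 + 1 / y) ^ m * (y / r) ^ m \<le> 2 ^ m"
proof -
  have "0 \<le> (norm x)\<^sup>2" by simp
  then have "y\<^sup>2 \<le> r\<^sup>2" using assms(2) by linarith
  then show yr: "y \<le> r" by (rule power2_le_imp_le) (use assms(1) in simp)
  have "(1 + 1 / y) * (y / r) = y / r + 1 / r" using assms by (simp add: field_simps)
  also have "\<dots> \<le> 2" using yr assms(1) by (simp add: add_divide_distrib[symmetric] divide_le_eq)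
  finally have "((1 + 1 / y) * (y / r)) ^ m \<le> 2 ^ m" using assms by (intro power_mono) auto
  then show "(1 + 1 / y) ^ m * (y / r) ^ m \<le> 2 ^ m" by (simp only: power_mult_distrib)
qed

text \<open>
  For \<open>r \<ge> 1\<close> the quotient \<open>(1 + |\<eta>|\<^sup>2) / (y\<^sup>2 + |\<eta> - x|\<^sup>2)\<close> is at most \<open>3 (r / y)\<^sup>2\<close> on the half sphere. The
  power \<open>(\<alpha> + n + 1) / 2\<close> of \<open>(r / y)\<^sup>2\<close> times \<open>y powr (\<alpha> + 1)\<close> is \<open>r powr (\<alpha> + 1)\<close> times \<open>(r / y)\<^sup>n\<close>, which
  explains the exponent \<open>n\<close> of the cosine.
\<close>

lemma jet_weighted_kernel_half_sphere:
  assumes \<alpha>: "\<alpha> > -1"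
  shows "\<exists>C\<ge>0. \<forall>r\<ge>1. \<forall>x \<eta> :: real^'n::finite. \<forall>y>0. (norm x)\<^sup>2 + y\<^sup>2 = r\<^sup>2 \<longrightarrow>
    jet m (weighted_kernel \<alpha> y x) \<eta> * (y / r) ^ (CARD('n) + m) \<le> C * r powr (\<alpha> + 1)"
proof -
  let ?s = "(\<alpha> + real CARD('n) + 1) / 2" and ?n = "CARD('n)"
  obtain C where C: "C \<ge> 0" "\<And>y x \<eta> :: real^'n. y > 0 \<Longrightarrow> jet m (weighted_kernel \<alpha> y x) \<eta> \<le>
     C * (y powr (\<alpha> + 1) * (1 + 1 / y) ^ m * ((1 + (norm \<eta>)\<^sup>2) / (y\<^sup>2 + (norm (\<eta> - x))\<^sup>2)) powr ?s)"
    using jet_weighted_kernel[of m \<alpha>] by blast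
  have "jet m (weighted_kernel \<alpha> y x) \<eta> * (y / r) ^ (?n + m) \<le> (C * 2 ^ m * 3 powr ?s) * r powr (\<alpha> + 1)"
    if r: "r \<ge> 1" and xy: "(norm x)\<^sup>2 + y\<^sup>2 = r\<^sup>2" and y: "y > 0" for r y and x \<eta> :: "real^'n"
  proof -
    note H = half_sphere_height[OF r xy y]
    let ?q = "y\<^sup>2 + (norm (\<eta> - x))\<^sup>2"
    have q: "?q > 0" using y by (simp add: add_pos_nonneg)
    have "(1 + (norm \<eta>)\<^sup>2) / ?q \<le> 3 * (r / y)\<^sup>2"
    proof -
      have "1 + (norm \<eta>)\<^sup>2 \<le> 1 + (2 * (norm x)\<^sup>2 + 2 * (norm (\<eta> - x))\<^sup>2)" using norm_sq_triangle[of \<eta> x] by simp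
      also have "\<dots> \<le> 3 * r\<^sup>2 + 2 * (norm (\<eta> - x))\<^sup>2"
      proof -
        have "1 \<le> r\<^sup>2" using r by simp
        moreover have "(norm x)\<^sup>2 \<le> r\<^sup>2" using xy zero_le_power2[of y] by linarith
        ultimately show ?thesis by linarith
      qed
      also have "\<dots> \<le> 3 * (r / y)\<^sup>2 * ?q"
      proof -
        have "1 \<le> (r / y)\<^sup>2" using H(1) y by simp
        then have "(norm (\<eta> - x))\<^sup>2 \<le> (r / y)\<^sup>2 * (norm (\<eta> - x))\<^sup>2" using mult_right_mono[of 1 "(r / y)\<^sup>2" "(norm (\<eta> - x))\<^sup>2"] by simp
        moreover have "(r / y)\<^sup>2 * y\<^sup>2 = r\<^sup>2" using y by (simp add: power_divide)
        moreover have "3 * (r / y)\<^sup>2 * ?q = 3 * ((r / y)\<^sup>2 * y\<^sup>2) + 3 * ((r / y)\<^sup>2 * (norm (\<eta> - x))\<^sup>2)" by (simp only: distrib_left mult.assoc)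
        moreover have "0 \<le> (norm (\<eta> - x))\<^sup>2" by simp
        ultimately show ?thesis by linarith
      qed
      finally show ?thesis using q by (simp add: pos_divide_le_eq)
    qed
    then have "((1 + (norm \<eta>)\<^sup>2) / ?q) powr ?s \<le> (3 * (r / y)\<^sup>2) powr ?s"
      using q \<alpha> by (intro powr_mono2) auto
    also have "\<dots> = 3 powr ?s * (r / y) powr (\<alpha> + real ?n + 1)"
    proof -
      have "(r / y)\<^sup>2 = (r / y) powr 2" using r y by simp
      then have "((r / y)\<^sup>2) powr ?s = (r / y) powr (2 * ?s)" by (simp only: powr_powr)
      also have "2 * ?s = \<alpha> + real ?n + 1" by simp
      finally show ?thesis by (simp only: powr_mult)
    qed
    finally have "jet m (weighted_kernel \<alpha> y x) \<eta> \<le>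
        C * (y powr (\<alpha> + 1) * (1 + 1 / y) ^ m * (3 powr ?s * (r / y) powr (\<alpha> + real ?n + 1)))"
      using C(1) y by (intro order_trans[OF C(2)[OF y]] mult_left_mono) auto
    then have "jet m (weighted_kernel \<alpha> y x) \<eta> * (y / r) ^ (?n + m) \<le>
        C * (y powr (\<alpha> + 1) * (1 + 1 / y) ^ m * (3 powr ?s * (r / y) powr (\<alpha> + real ?n + 1))) * (y / r) ^ (?n + m)"
      by (rule mult_right_mono) (use r y in simp)
    also have "\<dots> = C * 3 powr ?s * (y powr (\<alpha> + 1) * (r / y) powr (\<alpha> + real ?n + 1) * (y / r) ^ ?n) * ((1 + 1 / y) ^ m * (y / r) ^ m)"
      by (simp only: power_add mult_ac)
    also have "y powr (\<alpha> + 1) * (r / y) powr (\<alpha> + real ?n + 1) * (y / r) ^ ?n = r powr (\<alpha> + 1)"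
    proof -
      have "(r / y) powr (\<alpha> + real ?n + 1) = (r / y) powr (\<alpha> + 1) * (r / y) ^ ?n"
        using r y by (simp add: powr_add[symmetric] powr_realpow[symmetric] add_ac)
      moreover have "(r / y) ^ ?n * (y / r) ^ ?n = 1" using r y by (simp add: power_mult_distrib[symmetric])
      moreover have "y powr (\<alpha> + 1) * (r / y) powr (\<alpha> + 1) = r powr (\<alpha> + 1)"
        using r y by (simp add: powr_mult[symmetric])
      ultimately show ?thesis by (metis (no_types, lifting) mult.assoc mult_1_right)
    qed
    also have "C * 3 powr ?s * r powr (\<alpha> + 1) * ((1 + 1 / y) ^ m * (y / r) ^ m) \<le> C * 3 powr ?s * r powr (\<alpha> + 1) * 2 ^ m"
      using C(1) by (intro mult_left_mono H(2)) auto
    finally show ?thesis by (simp only: mult_ac)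
  qed
  then show ?thesis using C(1) by (intro exI[of _ "C * 2 ^ m * 3 powr ?s"]) auto
qed

text \<open>
  With a cut-off the weight is bounded and \<open>y\<^sup>2 + |\<eta> - x|\<^sup>2 \<ge> y\<^sup>2\<close> suffices; the growth
  \<open>r powr (\<alpha> + 1)\<close> disappears.
\<close>

lemma jet_cutoff_weighted_kernel_half_sphere:
  assumes \<alpha>: "\<alpha> > -1"
  shows "\<exists>C\<ge>0. \<forall>r\<ge>1. \<forall>x \<eta> :: real^'n::finite. \<forall>y>0. (norm x)\<^sup>2 + y\<^sup>2 = r\<^sup>2 \<longrightarrow>
    jet m (\<lambda>\<eta>. of_real (cutoff j \<eta>) * weighted_kernel \<alpha> y x \<eta>) \<eta> * (y / r) ^ (CARD('n) + m) \<le> C"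
proof -
  let ?s = "(\<alpha> + real CARD('n) + 1) / 2" and ?n = "CARD('n)" and ?L = "leibniz_const TYPE('n) m"
  let ?b = "\<lambda>\<eta> :: real^'n. of_real (cutoff j \<eta>) * cweight \<alpha> \<eta>"
  have bB: "?b \<in> B_space" by (intro B_dot_B Schwartz_B_dot cutoff_weight_Schwartz)
  obtain B where B: "\<And>\<eta>. jet m ?b \<eta> \<le> B" using bB unfolding B_space_iff by blast
  have B0: "B \<ge> 0" using order_trans[OF jet_nonneg B] .
  obtain D where D: "D \<ge> 0" "\<And>y x :: real^'n. y > 0 \<Longrightarrow> jet m (ckernel \<alpha> y) x \<le>
     D * (y powr (\<alpha> + 1) * (y\<^sup>2 + (norm x)\<^sup>2) powr (- ?s) * (1 + 1 / y) ^ m)"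
    using jet_kernel[of m \<alpha>] by blast
  have "jet m (\<lambda>\<eta>. of_real (cutoff j \<eta>) * weighted_kernel \<alpha> y x \<eta>) \<eta> * (y / r) ^ (?n + m) \<le> ?L * (B * D) * 2 ^ m"
    if r: "r \<ge> 1" and xy: "(norm x)\<^sup>2 + y\<^sup>2 = r\<^sup>2" and y: "y > 0" for r y and x \<eta> :: "real^'n"
  proof -
    note H = half_sphere_height[OF r xy y]
    have sm: "(\<lambda>\<eta>. ckernel \<alpha> y (\<eta> - x)) \<in> smooth_space"
      using smooth_space_translate[OF ckernel_smooth[OF y], of \<alpha> "- x"] by simp
    have jt: "jet m (\<lambda>\<eta>. ckernel \<alpha> y (\<eta> - x)) \<eta> = jet m (ckernel \<alpha> y) (\<eta> - x)"
      using jet_translate[OF ckernel_smooth[OF y], of m \<alpha> "- x" \<eta>] by simp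
    have "jet m (\<lambda>\<eta>. of_real (cutoff j \<eta>) * weighted_kernel \<alpha> y x \<eta>) \<eta> \<le> ?L * (jet m ?b \<eta> * jet m (\<lambda>\<eta>. ckernel \<alpha> y (\<eta> - x)) \<eta>)"
      using jet_mult[OF B_smooth[OF bB] sm, of m \<eta>] by (simp add: weighted_kernel_def mult.assoc)
    also have "\<dots> \<le> ?L * (B * (D * (y powr (- real ?n) * (1 + 1 / y) ^ m)))"
    proof (intro mult_left_mono mult_mono B B0)
      have "jet m (ckernel \<alpha> y) (\<eta> - x) \<le> D * (y powr (\<alpha> + 1) * (y\<^sup>2 + (norm (\<eta> - x))\<^sup>2) powr (- ?s) * (1 + 1 / y) ^ m)"
        by (rule D(2)[OF y])
      also have "\<dots> \<le> D * (y powr (\<alpha> + 1) * (y\<^sup>2) powr (- ?s) * (1 + 1 / y) ^ m)"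
        using D(1) y \<alpha> by (intro mult_left_mono mult_right_mono powr_mono2') auto
      also have "y powr (\<alpha> + 1) * (y\<^sup>2) powr (- ?s) = y powr (- real ?n)"
      proof -
        have "y\<^sup>2 = y powr 2" using y by simp
        then have "(y\<^sup>2) powr (- ?s) = y powr (2 * - ?s)" by (simp only: powr_powr)
        then have "y powr (\<alpha> + 1) * (y\<^sup>2) powr (- ?s) = y powr ((\<alpha> + 1) + 2 * - ?s)" by (simp only: powr_add)
        also have "(\<alpha> + 1) + 2 * - ?s = - real ?n" by (simp add: field_simps)
        finally show ?thesis .
      qed
      finally show "jet m (\<lambda>\<eta>. ckernel \<alpha> y (\<eta> - x)) \<eta> \<le> D * (y powr (- real ?n) * (1 + 1 / y) ^ m)" by (simp only: jt)
    qed auto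
    finally have "jet m (\<lambda>\<eta>. of_real (cutoff j \<eta>) * weighted_kernel \<alpha> y x \<eta>) \<eta> * (y / r) ^ (?n + m) \<le>
        ?L * (B * (D * (y powr (- real ?n) * (1 + 1 / y) ^ m))) * (y / r) ^ (?n + m)"
      by (rule mult_right_mono) (use r y in simp)
    also have "\<dots> = ?L * (B * D) * ((y powr (- real ?n) * (y / r) ^ ?n) * ((1 + 1 / y) ^ m * (y / r) ^ m))"
      by (simp only: power_add mult_ac)
    also have "\<dots> \<le> ?L * (B * D) * (1 * 2 ^ m)"
    proof (intro mult_left_mono mult_mono H(2))
      have "y powr (- real ?n) * (y / r) ^ ?n = 1 / r ^ ?n"
        using y by (simp add: powr_minus_divide powr_realpow power_divide)
      also have "\<dots> \<le> 1" using r by (simp add: one_le_power)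
      finally show "y powr (- real ?n) * (y / r) ^ ?n \<le> 1" .
    qed (use B0 D(1) r y in auto)
    finally show ?thesis by simp
  qed
  then show ?thesis using B0 D(1) by (intro exI[of _ "?L * (B * D) * 2 ^ m"]) auto
qed

theorem theorem5p2:
  fixes \<alpha> :: real and f :: "(real^'n::finite \<Rightarrow> complex) \<Rightarrow> complex"
  assumes "\<alpha> > -1" and "f \<in> weighted_DL1 \<alpha>"
  shows "\<exists>m::nat.
    (\<forall>\<^sub>F r in at_top. bdd_above ((\<lambda>(x, y).
        norm (poisson_integral \<alpha> f x y * of_real (cos (polar_angle x y) ^ (CARD('n) + m)))) ` half_sphere r)) \<and>
    (\<lambda>r. SUP (x, y) \<in> half_sphere r.
        norm (poisson_integral \<alpha> f x y * of_real (cos (polar_angle x y) ^ (CARD('n) + m))))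
      \<in> o(\<lambda>r. r powr (\<alpha> + 1))"
proof -
  note \<alpha> = assms(1)
  obtain m A l where l: "form_bound m A l" and f: "\<And>\<phi>. \<phi> \<in> Schwartz_space \<Longrightarrow> f \<phi> = l (\<lambda>x. cweight \<alpha> x * \<phi> x)"
    using weighted_DL1_form[OF assms(2)] by blast
  have A: "A \<ge> 0" by (rule form_bound_nonneg[OF l])
  define F :: "(real^'n) \<times> real \<Rightarrow> real" where
    "F = (\<lambda>(x, y). norm (poisson_integral \<alpha> f x y * of_real (cos (polar_angle x y) ^ (CARD('n) + m))))"
  obtain C where C: "C \<ge> 0" "\<And>r x \<eta> y. r \<ge> 1 \<Longrightarrow> y > 0 \<Longrightarrow> (norm x)\<^sup>2 + y\<^sup>2 = r\<^sup>2 \<Longrightarrow>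
    jet m (weighted_kernel \<alpha> y x) (\<eta> :: real^'n) * (y / r) ^ (CARD('n) + m) \<le> C * r powr (\<alpha> + 1)"
    using jet_weighted_kernel_half_sphere[OF \<alpha>, of m] by blast
  have est: "\<exists>D\<ge>0. \<forall>r\<ge>1. \<forall>p\<in>half_sphere r. F p \<le> \<epsilon> * (C * r powr (\<alpha> + 1)) + D" if \<epsilon>: "\<epsilon> > 0" for \<epsilon> :: real
  proof -
    obtain j where j: "\<And>\<phi> M. \<phi> \<in> B_space \<Longrightarrow> (\<And>x. jet m \<phi> x \<le> M) \<Longrightarrow>
        norm (form_extension l \<phi> - l (\<lambda>x. of_real (cutoff j x) * \<phi> x)) \<le> \<epsilon> * M"
      using form_extension_approx[OF l \<epsilon>] by blast
    obtain D where D: "D \<ge> 0" "\<And>r x \<eta> y. r \<ge> 1 \<Longrightarrow> y > 0 \<Longrightarrow> (norm x)\<^sup>2 + y\<^sup>2 = r\<^sup>2 \<Longrightarrow>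
      jet m (\<lambda>\<eta>. of_real (cutoff j \<eta>) * weighted_kernel \<alpha> y x \<eta>) (\<eta> :: real^'n) * (y / r) ^ (CARD('n) + m) \<le> D"
      using jet_cutoff_weighted_kernel_half_sphere[OF \<alpha>, of m j] by blast
    have "F (x, y) \<le> \<epsilon> * (C * r powr (\<alpha> + 1)) + A * D" if r: "r \<ge> 1" and p: "(x, y) \<in> half_sphere r" for r y and x :: "real^'n"
    proof -
      have y: "y > 0" and xy: "(norm x)\<^sup>2 + y\<^sup>2 = r\<^sup>2" using p by (auto simp: half_sphere_def)
      let ?c = "(y / r) ^ (CARD('n) + m)"
      have c: "?c > 0" using r y by simp
      let ?w = "weighted_kernel \<alpha> y x"
      have wB: "?w \<in> B_space" by (rule weighted_kernel_B[OF y \<alpha>])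
      have "jet m ?w \<eta> \<le> C * r powr (\<alpha> + 1) / ?c" for \<eta>
        using C(2)[OF r y xy, of \<eta>] c by (simp only: pos_le_divide_eq)
      from j[OF wB this]
      have "norm (form_extension l ?w - l (\<lambda>\<eta>. of_real (cutoff j \<eta>) * ?w \<eta>)) \<le> \<epsilon> * (C * r powr (\<alpha> + 1) / ?c)" .
      moreover have "norm (l (\<lambda>\<eta>. of_real (cutoff j \<eta>) * ?w \<eta>)) \<le> A * (D / ?c)"
      proof (rule form_boundD[OF l cutoff_mult_B_dot[OF wB]])
        show "jet m (\<lambda>\<eta>. of_real (cutoff j \<eta>) * ?w \<eta>) \<eta> \<le> D / ?c" for \<eta>
          using D(2)[OF r y xy, of \<eta>] c by (simp only: pos_le_divide_eq)
      qed
      ultimately have "norm (form_extension l ?w) \<le> \<epsilon> * (C * r powr (\<alpha> + 1) / ?c) + A * (D / ?c)"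
        using norm_triangle_ineq[of "form_extension l ?w - l (\<lambda>\<eta>. of_real (cutoff j \<eta>) * ?w \<eta>)" "l (\<lambda>\<eta>. of_real (cutoff j \<eta>) * ?w \<eta>)"]
        by simp
      then have "norm (form_extension l ?w) * ?c \<le> (\<epsilon> * (C * r powr (\<alpha> + 1) / ?c) + A * (D / ?c)) * ?c"
        using c by (intro mult_right_mono) auto
      also have "\<dots> = \<epsilon> * (C * r powr (\<alpha> + 1)) + A * D"
      proof -
        have "(\<epsilon> * (a / t) + A * (D / t)) * t = \<epsilon> * a + A * D" if "t > 0" for a t
          using that by (simp add: distrib_right)
        then show ?thesis using c by blast
      qed
      finally have "norm (poisson_function \<alpha> l y x) * ?c \<le> \<epsilon> * (C * r powr (\<alpha> + 1)) + A * D"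
        by (simp only: poisson_function_def)
      moreover have "F (x, y) = norm (poisson_function \<alpha> l y x) * ?c"
      proof -
        have "cos (polar_angle x y) = y / r" using cos_polar_angle[OF p] r by simp
        then have "F (x, y) = norm (poisson_function \<alpha> l y x * of_real ?c)"
          by (simp only: F_def prod.case poisson_integral_eq[OF f l y \<alpha>])
        also have "\<dots> = norm (poisson_function \<alpha> l y x) * ?c"
          unfolding norm_mult norm_of_real using c by simp
        finally show ?thesis .
      qed
      ultimately show ?thesis by simp
    qed
    then show ?thesis using A D(1) by (intro exI[of _ "A * D"]) auto
  qed
  have bdd: "bdd_above (F ` half_sphere r)" if r: "r \<ge> 1" for r
    using est[of 1] r by (auto simp: bdd_above_def)
  have nonempty: "half_sphere r \<noteq> ({} :: ((real^'n) \<times> real) set)" if "r \<ge> 1" for r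
  proof -
    have "(0 :: real^'n, r) \<in> half_sphere r" using that by (simp add: half_sphere_def)
    then show ?thesis by blast
  qed
  have "(\<lambda>r. SUP p \<in> half_sphere r. F p) \<in> o(\<lambda>r. r powr (\<alpha> + 1))"
  proof (rule landau_o.smallI)
    fix c :: real assume c: "c > 0"
    define \<epsilon> where "\<epsilon> = c / (2 * (C + 1))"
    have \<epsilon>: "\<epsilon> > 0" using c C(1) by (simp add: \<epsilon>_def)
    obtain D where D: "D \<ge> 0" "\<And>r p. r \<ge> 1 \<Longrightarrow> p \<in> half_sphere r \<Longrightarrow> F p \<le> \<epsilon> * (C * r powr (\<alpha> + 1)) + D"
      using est[OF \<epsilon>] by blast
    \<comment> \<open>any positive number above \<open>2 * D / c\<close>, so that it can be raised to real powers\<close>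
    define B where "B = 2 * D / c + 1"
    have B: "B > 0" using D(1) c by (simp add: B_def add_nonneg_pos)
    have "\<forall>\<^sub>F r in at_top. 2 * D / c \<le> r powr (\<alpha> + 1)"
      using eventually_ge_at_top[of "B powr (1 / (\<alpha> + 1))"]
    proof eventually_elim
      case (elim r)
      have "B = (B powr (1 / (\<alpha> + 1))) powr (\<alpha> + 1)" using B \<alpha> by (simp add: powr_powr)
      also have "\<dots> \<le> r powr (\<alpha> + 1)" using elim \<alpha> by (intro powr_mono2) auto
      finally show ?case by (simp add: B_def)
    qed
    then show "\<forall>\<^sub>F r in at_top. norm (SUP p \<in> half_sphere r. F p) \<le> c * norm (r powr (\<alpha> + 1))"
      using eventually_ge_at_top[of 1]
    proof eventually_elim
      case (elim r)
      let ?R = "r powr (\<alpha> + 1)"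
      have "D \<le> c / 2 * ?R" using elim(1) c by (simp add: field_simps)
      moreover have "\<epsilon> * (C * ?R) \<le> c / 2 * ?R"
      proof -
        have "\<epsilon> * C \<le> c / 2" using c C(1) by (simp add: \<epsilon>_def field_simps)
        then show ?thesis using mult_right_mono[of "\<epsilon> * C" "c / 2" ?R] by (simp add: mult.assoc)
      qed
      ultimately have le: "F p \<le> c * ?R" if "p \<in> half_sphere r" for p using D(2)[OF elim(2) that] by linarith
      have "(SUP p \<in> half_sphere r. F p) \<le> c * ?R" by (rule cSUP_least[OF nonempty[OF elim(2)] le])
      moreover have "0 \<le> (SUP p \<in> half_sphere r. F p)"
      proof -
        obtain p :: "(real^'n) \<times> real" where p: "p \<in> half_sphere r" using nonempty[OF elim(2)] by blast
        have "0 \<le> F p" by (simp add: F_def case_prod_beta)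
        also have "\<dots> \<le> (SUP p \<in> half_sphere r. F p)" by (rule cSUP_upper[OF p bdd[OF elim(2)]])
        finally show ?thesis .
      qed
      ultimately show ?case by simp
    qed
  qed
  moreover have "\<forall>\<^sub>F r in at_top. bdd_above (F ` half_sphere r)"
    using eventually_ge_at_top[of 1] by eventually_elim (rule bdd)
  ultimately show ?thesis unfolding F_def by (intro exI[of _ m] conjI)
qed

end
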